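(* Let $(X_i)_{i\in\mathbb{Z}}$ be a stationary collection of real random variables with mean zero and finite variance, let $\delta>0$, and suppose that $\mathbb{E}|X_0|^{2+\delta}<\infty$. If $\sum_{j=1}^{\infty}\alpha(j)^{\delta/(2+\delta)}<\infty$, where $\alpha(j)$ are the $\alpha$-mixing coefficients of the process, then for any $\tau>0$: $$\lim_{n\to\infty} J_{\rm st}\left(V_n^{(\tau)}\right)=0 .$$
   Context: For random variables $S,T$ (defined on the same probability space) the $\alpha$-mixing coefficient is $\alpha(S,T)=\sup_{A,B}|\mathbb{P}((S\in A)\cap(T\in B))-\mathbb{P}(S\in A)\mathbb{P}(T\in B)|$, the supremum being over measurable sets $A,B$. Let $\Sigma_a^b$ be the $\sigma$-field generated by $X_a,X_{a+1},\ldots,X_b$ (where $a$ or $b$ can be infinite). For each $t$, $\alpha(t)=\sup\{\alpha(S,T): S \text{ is } \Sigma_{-\infty}^{0}\text{-measurable},\ T \text{ is } \Sigma_{t}^{\infty}\text{-measurable}\}$. For $\tau>0$, let $(Z_i^{(\tau)})_i$ be $N(0,\tau)$ random variables independent of the collection $(X_i)$ and of each other, and set $V_n^{(\tau)}=\left(\sum_{i=1}^n (X_i+Z_i^{(\tau)})\right)/\sqrt{n}$. For a random variable $U$ with smooth density $p$ and variance $\sigma_U^2$, the score function is $\rho(u)=p'(u)/p(u)$, the Fisher information is $J(U)=\mathbb{E}\rho^2(U)$, and the standardised Fisher information is $J_{\rm st}(U)=\sigma_U^2J(U)-1$. *)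

theory Defs
  imports "HOL-Probability.Probability"
begin

text \<open>Strict stationarity: the law of the whole process on the product space is shift invariant.\<close>
definition stationary_process :: "'a measure \<Rightarrow> (int \<Rightarrow> 'a \<Rightarrow> real) \<Rightarrow> bool" where
  "stationary_process M X \<longleftrightarrow>
     (\<forall>i. X i \<in> borel_measurable M) \<and>
     (\<forall>k. distr M (Pi\<^sub>M UNIV (\<lambda>_. borel)) (\<lambda>\<omega> i. X (i + k) \<omega>) =
          distr M (Pi\<^sub>M UNIV (\<lambda>_. borel)) (\<lambda>\<omega> i. X i \<omega>))"

definition generated_sigma :: "'a measure \<Rightarrow> (int \<Rightarrow> 'a \<Rightarrow> real) \<Rightarrow> int set \<Rightarrow> 'a measure" where
  "generated_sigma M X I =
     sigma (space M) {X i -` A \<inter> space M | i A. i \<in> I \<and> A \<in> sets borel}"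

definition alpha_coeff :: "'a measure \<Rightarrow> ('a \<Rightarrow> real) \<Rightarrow> ('a \<Rightarrow> real) \<Rightarrow> real" where
  "alpha_coeff M S T =
     (SUP (A, B) \<in> sets borel \<times> sets borel.
        \<bar>measure M {\<omega> \<in> space M. S \<omega> \<in> A \<and> T \<omega> \<in> B}
         - measure M {\<omega> \<in> space M. S \<omega> \<in> A} * measure M {\<omega> \<in> space M. T \<omega> \<in> B}\<bar>)"

definition alpha_mixing :: "'a measure \<Rightarrow> (int \<Rightarrow> 'a \<Rightarrow> real) \<Rightarrow> nat \<Rightarrow> real" where
  "alpha_mixing M X t =
     (SUP (S, T) \<in> borel_measurable (generated_sigma M X {..0}) \<times>
                   borel_measurable (generated_sigma M X {int t..}).
        alpha_coeff M S T)"

definition smooth_density :: "'a measure \<Rightarrow> ('a \<Rightarrow> real) \<Rightarrow> (real \<Rightarrow> real) \<Rightarrow> bool" where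
  "smooth_density M U p \<longleftrightarrow>
     (\<forall>u. 0 \<le> p u) \<and> distributed M lborel U (\<lambda>u. ennreal (p u)) \<and>
     (\<forall>k u. (deriv ^^ k) p differentiable (at u))"

definition score :: "(real \<Rightarrow> real) \<Rightarrow> real \<Rightarrow> real" where
  "score p u = deriv p u / p u"

text \<open>
  A smooth density is continuous, hence unique when it exists, so the definite description is
  legitimate. The expectation is a nonnegative extended integral, and the value is infinite when
  there is no smooth density: a finite value therefore certifies that the Fisher information
  is genuinely defined and finite. Points where the density vanishes form a null set for the law
  of \<open>U\<close>, so division by zero in the score does not matter.
\<close>
definition fisher_information :: "'a measure \<Rightarrow> ('a \<Rightarrow> real) \<Rightarrow> ennreal" where
  "fisher_information M U =
     (if \<exists>p. smooth_density M U p
      then \<integral>\<^sup>+\<omega>. ennreal ((score (THE p. smooth_density M U p) (U \<omega>))\<^sup>2) \<partial>M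
      else \<infinity>)"

definition std_fisher_information :: "'a measure \<Rightarrow> ('a \<Rightarrow> real) \<Rightarrow> ereal" where
  "std_fisher_information M U =
     ereal (prob_space.variance M U) * enn2ereal (fisher_information M U) - 1"

definition smoothed_sum ::
  "(int \<Rightarrow> 'a \<Rightarrow> real) \<Rightarrow> (int \<Rightarrow> 'a \<Rightarrow> real) \<Rightarrow> nat \<Rightarrow> 'a \<Rightarrow> real" where
  "smoothed_sum X Z n \<omega> = (\<Sum>i = 1..int n. X i \<omega> + Z i \<omega>) / sqrt (real n)"

end

theory Submission
  imports Defs "HOL-Computational_Algebra.Polynomial"
begin

text \<open>
  Write \<open>V\<^sub>n = S\<^sub>n + G\<^sub>n\<close> with \<open>S\<^sub>n\<close> the normalised sum of the \<open>X\<^sub>i\<close> and \<open>G\<^sub>n\<close> an independent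
  \<open>N(0, \<tau>)\<close> variable. The density of \<open>V\<^sub>n\<close> and its derivatives are integrals of bounded continuous
  functions against the law of \<open>S\<^sub>n\<close>, so they converge pointwise as soon as \<open>S\<^sub>n\<close> converges weakly. By
  Cauchy--Schwarz the integrand \<open>p'\<^sup>2 / p\<close> of the Fisher information is at most the mixture of the
  functions \<open>(u - s)\<^sup>2 \<phi>(u - s) / \<tau>\<^sup>2\<close>, whose integral \<open>1 / \<tau>\<close> does not depend on the law
  of \<open>S\<^sub>n\<close>; hence domination with constant mass gives convergence of the Fisher informations, and the
  theorem reduces to the central limit theorem for \<open>S\<^sub>n\<close> with convergence of variances.

  The latter is the classical one: Davydov's covariance inequality makes the autocovariances
  summable uniformly over truncations of the \<open>X\<^sub>i\<close>, and for bounded variables Bernstein's block method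
  applies, because \<open>n \<alpha>(n)\<close> tends to \<open>0\<close>.
\<close>

section \<open>Fisher information of Gaussian mixtures\<close>

text \<open>The limiting variance \<open>v\<close> may be 0. The limit law of the normalised sums is
  therefore carried as the image of the standard normal law under multiplication by some
  \<open>s >= 0\<close>; for \<open>s = 0\<close> it is a point mass, and the added variance
  \<open>\<tau>\<close> keeps the smoothed law nondegenerate. In every case the variances tend to
  \<open>v + \<tau>\<close> and the Fisher informations to \<open>1 / (v + \<tau>)\<close>, and the
  product of these limits is 1. Expanding the characteristic function of a block needs a third
  moment, which \<open>2 + \<delta>\<close> moments need not supply; this forces the truncation.
  Truncation changes the limiting variance, so its error must be controlled uniformly in the number
  of summands: every function of size at most \<open>|x|\<close> obeys one and the same summable
  covariance bound. The exponent \<open>\<delta> / (2 + \<delta>)\<close> is what Davydov's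
  inequality leaves on the mixing coefficient. As the coefficients are at most 1, they are then
  summable themselves, and monotonicity improves this to \<open>n * \<alpha>(n)\<close> tending to
  0, the rate at which gaps of order \<open>sqrt n\<close> decouple the blocks.\<close>

lemma has_field_derivative_integral_shift:
  fixes f f' :: "real \<Rightarrow> real"
  assumes mu: "prob_space \<mu>" "sets \<mu> = sets borel"
    and der: "\<And>x. (f has_real_derivative f' x) (at x)"
    and bf: "\<And>x. \<bar>f x\<bar> \<le> C" and bf': "\<And>x. \<bar>f' x\<bar> \<le> B"
    and f'm: "f' \<in> borel_measurable borel"
  shows "((\<lambda>u. \<integral>s. f (u - s) \<partial>\<mu>) has_real_derivative (\<integral>s. f' (u - s) \<partial>\<mu>)) (at u)"
proof -
  interpret prob_space \<mu> by fact
  note [measurable_cong] = mu(2)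
  note [measurable] = f'm
  have fm[measurable]: "f \<in> borel_measurable borel"
    by (intro borel_measurable_continuous_onI continuous_at_imp_continuous_on ballI DERIV_isCont[OF der])
  have int: "integrable \<mu> (\<lambda>s. f (u - s))" for u
    by (intro integrable_const_bound[where B=C]) (auto simp: bf)
  \<comment> \<open>The bound on \<open>f'\<close> makes \<open>f\<close> Lipschitz, so every
    difference quotient of the integrand is at most \<open>B\<close>, an integrable majorant under a
    probability measure.\<close>
  have lip: "\<bar>f x - f y\<bar> \<le> B * \<bar>x - y\<bar>" for x y
    using field_differentiable_bound[of UNIV f f' B x y] der bf' by auto
  show ?thesis
    unfolding has_field_derivative_iff
  proof (subst tendsto_at_iff_sequentially, intro allI impI)
    fix Y :: "nat \<Rightarrow> real" assume Y: "\<forall>i. Y i \<in> UNIV - {u}" and Yu: "Y \<longlonglongrightarrow> u"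
    have eq: "(\<integral>s. f (Y i - s) \<partial>\<mu>) - (\<integral>s. f (u - s) \<partial>\<mu>) = (\<integral>s. f (Y i - s) - f (u - s) \<partial>\<mu>)" for i
      using int by simp
    have "(\<lambda>i. \<integral>s. (f (Y i - s) - f (u - s)) / (Y i - u) \<partial>\<mu>) \<longlonglongrightarrow> (\<integral>s. f' (u - s) \<partial>\<mu>)"
    proof (rule integral_dominated_convergence[where w="\<lambda>_. B"])
      show "AE s in \<mu>. (\<lambda>i. (f (Y i - s) - f (u - s)) / (Y i - u)) \<longlonglongrightarrow> f' (u - s)"
      proof (rule AE_I2)
        fix s
        have "((\<lambda>y. (f y - f (u - s)) / (y - (u - s))) \<longlongrightarrow> f' (u - s)) (at (u - s))"
          using der[of "u - s"] by (simp add: has_field_derivative_iff)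
        then have "\<forall>Z. (\<forall>i. Z i \<in> UNIV - {u - s}) \<longrightarrow> Z \<longlonglongrightarrow> u - s \<longrightarrow>
            ((\<lambda>y. (f y - f (u - s)) / (y - (u - s))) \<circ> Z) \<longlonglongrightarrow> f' (u - s)"
          by (simp add: tendsto_at_iff_sequentially)
        moreover have "(\<lambda>i. Y i - s) \<longlonglongrightarrow> u - s"
          by (intro tendsto_intros Yu)
        ultimately show "(\<lambda>i. (f (Y i - s) - f (u - s)) / (Y i - u)) \<longlonglongrightarrow> f' (u - s)"
          using Y by (auto simp: comp_def dest!: spec[of _ "\<lambda>i. Y i - s"])
      qed
      show "AE s in \<mu>. norm ((f (Y i - s) - f (u - s)) / (Y i - u)) \<le> B" for i
        using lip[of "Y i - s" "u - s" for s] Y by (auto simp: divide_le_eq)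
    qed auto
    then show "((\<lambda>y. ((\<integral>s. f (y - s) \<partial>\<mu>) - (\<integral>s. f (u - s) \<partial>\<mu>)) / (y - u)) \<circ> Y) \<longlonglongrightarrow>
        (\<integral>s. f' (u - s) \<partial>\<mu>)"
      by (simp add: comp_def eq)
  qed
qed

section \<open>Gaussian kernels with polynomial factors, and their mixtures\<close>

definition poly_normal :: "real \<Rightarrow> real poly \<Rightarrow> real \<Rightarrow> real" where
  "poly_normal \<sigma> q x = poly q x * normal_density 0 \<sigma> x"

text \<open>The effect of differentiation on the polynomial factor, the kernel contributing
  \<open>- x / \<sigma>\<^sup>2\<close>. Iterated from 1 it yields the Hermite polynomials up to
  scaling and sign. Polynomials times the kernel are thus closed under derivatives, and one bound
  and one differentiation rule serve every order.\<close>

definition hermite_step :: "real \<Rightarrow> real poly \<Rightarrow> real poly" where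
  "hermite_step \<sigma> q = pderiv q - smult (1 / \<sigma>\<^sup>2) ([:0, 1:] * q)"

lemma has_real_derivative_normal_density:
  assumes "\<sigma> > 0"
  shows "(normal_density 0 \<sigma> has_real_derivative - x / \<sigma>\<^sup>2 * normal_density 0 \<sigma> x) (at x)"
  unfolding normal_density_def using assms
  by (auto intro!: derivative_eq_intros simp: field_simps)

lemma has_real_derivative_poly_normal:
  assumes "\<sigma> > 0"
  shows "(poly_normal \<sigma> q has_real_derivative poly_normal \<sigma> (hermite_step \<sigma> q) x) (at x)"
  unfolding poly_normal_def[abs_def] hermite_step_def
  by (rule derivative_eq_intros poly_DERIV has_real_derivative_normal_density assms refl)+
     (simp add: algebra_simps)

lemma borel_measurable_poly_normal[measurable]:
  "poly_normal \<sigma> q \<in> borel_measurable borel"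
  unfolding poly_normal_def[abs_def]
  by (intro borel_measurable_times borel_measurable_normal_density borel_measurable_continuous_onI)
     (auto intro!: continuous_intros)

text \<open>One term of the exponential series bounds the power by \<open>fact k * exp |x|\<close>,
  and completing the square gives \<open>|x| <= x\<^sup>2 / (2 * \<sigma>\<^sup>2) +
  \<sigma>\<^sup>2 / 2\<close>, so the Gaussian factor absorbs the exponential.\<close>

lemma bounded_power_normal:
  assumes "\<sigma> > 0"
  shows "\<exists>B. \<forall>x. \<bar>x ^ k * normal_density 0 \<sigma> x\<bar> \<le> B"
proof (intro exI allI)
  fix x :: real
  have "\<bar>x\<bar> ^ k / fact k \<le> (\<Sum>i\<le>k. \<bar>x\<bar> ^ i / fact i)"
    by (rule member_le_sum) auto
  also have "\<dots> \<le> exp \<bar>x\<bar>"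
    unfolding exp_def using sum_le_suminf[OF summable_exp_generic[of "\<bar>x\<bar>"], of "{..k}"]
    by (simp add: field_simps)
  finally have 1: "\<bar>x\<bar> ^ k \<le> fact k * exp \<bar>x\<bar>"
    by (simp add: field_simps)
  have "(\<bar>x\<bar> - \<sigma>\<^sup>2)\<^sup>2 \<ge> 0" by simp
  then have "2 * \<bar>x\<bar> * \<sigma>\<^sup>2 \<le> x\<^sup>2 + \<sigma>\<^sup>2 * \<sigma>\<^sup>2"
    by (simp add: power2_diff flip: power_mult_distrib) (simp add: power2_eq_square power4_eq_xxxx mult.assoc)
  then have "\<bar>x\<bar> \<le> x\<^sup>2 / (2 * \<sigma>\<^sup>2) + \<sigma>\<^sup>2 / 2"
    using assms by (simp add: field_simps power2_eq_square)
  then have "exp \<bar>x\<bar> \<le> exp (x\<^sup>2 / (2 * \<sigma>\<^sup>2) + \<sigma>\<^sup>2 / 2)" by simp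
  also have "\<dots> = exp (x\<^sup>2 / (2 * \<sigma>\<^sup>2)) * exp (\<sigma>\<^sup>2 / 2)" by (rule exp_add)
  finally have "\<bar>x\<bar> ^ k \<le> fact k * (exp (x\<^sup>2 / (2 * \<sigma>\<^sup>2)) * exp (\<sigma>\<^sup>2 / 2))"
    using 1 by (meson fact_ge_zero mult_left_mono order_trans)
  then have "\<bar>x\<bar> ^ k * exp (- x\<^sup>2 / (2 * \<sigma>\<^sup>2)) \<le> fact k * exp (\<sigma>\<^sup>2 / 2)"
    by (simp add: exp_minus field_simps)
  then show "\<bar>x ^ k * normal_density 0 \<sigma> x\<bar> \<le> 1 / sqrt (2 * pi * \<sigma>\<^sup>2) * (fact k * exp (\<sigma>\<^sup>2 / 2))"
    unfolding normal_density_def abs_mult power_abs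
    using assms by (simp add: divide_right_mono)
qed

lemma bounded_poly_normal:
  assumes "\<sigma> > 0"
  shows "\<exists>B. \<forall>x. \<bar>poly_normal \<sigma> q x\<bar> \<le> B"
proof -
  obtain b where b: "\<And>k x. \<bar>x ^ k * normal_density 0 \<sigma> x\<bar> \<le> b k"
    using bounded_power_normal[OF assms] by metis
  show ?thesis
  proof (intro exI allI)
    fix x
    have "\<bar>poly_normal \<sigma> q x\<bar> = \<bar>\<Sum>i\<le>degree q. coeff q i * (x ^ i * normal_density 0 \<sigma> x)\<bar>"
      unfolding poly_normal_def poly_altdef by (simp add: sum_distrib_right mult.assoc)
    also have "\<dots> \<le> (\<Sum>i\<le>degree q. \<bar>coeff q i\<bar> * b i)"
      by (rule order_trans[OF sum_abs])
         (auto simp: abs_mult intro!: sum_mono mult_left_mono b[unfolded abs_mult, simplified])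
    finally show "\<bar>poly_normal \<sigma> q x\<bar> \<le> (\<Sum>i\<le>degree q. \<bar>coeff q i\<bar> * b i)" .
  qed
qed

text \<open>For \<open>q = 1\<close> and \<open>\<mu>\<close> the law of \<open>S\<close> this is
  the density of \<open>S + G\<close>. Differentiation acts on \<open>q\<close> alone, so the
  density, its derivatives and the majorant of the Fisher integrand are all instances.\<close>

definition normal_mix :: "real \<Rightarrow> real measure \<Rightarrow> real poly \<Rightarrow> real \<Rightarrow> real" where
  "normal_mix \<sigma> \<mu> q u = (\<integral>s. poly_normal \<sigma> q (u - s) \<partial>\<mu>)"

lemma has_real_derivative_normal_mix:
  assumes "\<sigma> > 0" "prob_space \<mu>" "sets \<mu> = sets borel"
  shows "(normal_mix \<sigma> \<mu> q has_real_derivative normal_mix \<sigma> \<mu> (hermite_step \<sigma> q) u) (at u)"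
proof -
  obtain B C where "\<And>x. \<bar>poly_normal \<sigma> q x\<bar> \<le> C" "\<And>x. \<bar>poly_normal \<sigma> (hermite_step \<sigma> q) x\<bar> \<le> B"
    using bounded_poly_normal[OF assms(1)] by metis
  then show ?thesis
    unfolding normal_mix_def[abs_def]
    by (intro has_field_derivative_integral_shift[where C=C and B=B] assms
        has_real_derivative_poly_normal borel_measurable_poly_normal)
qed

lemma deriv_normal_mix:
  assumes "\<sigma> > 0" "prob_space \<mu>" "sets \<mu> = sets borel"
  shows "deriv (normal_mix \<sigma> \<mu> q) = normal_mix \<sigma> \<mu> (hermite_step \<sigma> q)"
  by (intro ext DERIV_imp_deriv has_real_derivative_normal_mix assms)

lemma funpow_deriv_normal_mix:
  assumes "\<sigma> > 0" "prob_space \<mu>" "sets \<mu> = sets borel"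
  shows "(deriv ^^ k) (normal_mix \<sigma> \<mu> q) = normal_mix \<sigma> \<mu> ((hermite_step \<sigma> ^^ k) q)"
  by (induction k arbitrary: q) (simp_all add: deriv_normal_mix[OF assms])

lemma continuous_normal_mix:
  assumes "\<sigma> > 0" "prob_space \<mu>" "sets \<mu> = sets borel"
  shows "continuous_on A (normal_mix \<sigma> \<mu> q)"
  by (intro continuous_at_imp_continuous_on ballI DERIV_isCont[OF has_real_derivative_normal_mix[OF assms]])

lemma borel_measurable_normal_mix:
  assumes "\<sigma> > 0" "prob_space \<mu>" "sets \<mu> = sets borel"
  shows "normal_mix \<sigma> \<mu> q \<in> borel_measurable borel"
  by (intro borel_measurable_continuous_onI continuous_normal_mix assms)

lemma integrable_poly_normal_shift:
  assumes "\<sigma> > 0" "prob_space \<mu>" "sets \<mu> = sets borel"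
  shows "integrable \<mu> (\<lambda>s. poly_normal \<sigma> q (u - s))"
proof -
  interpret prob_space \<mu> by fact
  note [measurable_cong] = assms(3)
  obtain B where "\<And>x. \<bar>poly_normal \<sigma> q x\<bar> \<le> B" using bounded_poly_normal[OF assms(1)] by metis
  then show ?thesis by (intro integrable_const_bound[where B=B]) auto
qed

lemma normal_mix_pos:
  assumes "\<sigma> > 0" "prob_space \<mu>" "sets \<mu> = sets borel"
  shows "normal_mix \<sigma> \<mu> 1 u > 0"
proof -
  interpret prob_space \<mu> by fact
  have "normal_mix \<sigma> \<mu> 1 u \<ge> 0"
    unfolding normal_mix_def by (intro Bochner_Integration.integral_nonneg) (auto simp: poly_normal_def)
  moreover have "normal_mix \<sigma> \<mu> 1 u \<noteq> 0"
  proof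
    assume "normal_mix \<sigma> \<mu> 1 u = 0"
    then have "AE s in \<mu>. poly_normal \<sigma> 1 (u - s) = 0"
      unfolding normal_mix_def
      by (subst (asm) integral_nonneg_eq_0_iff_AE)
         (auto simp: poly_normal_def intro!: integrable_poly_normal_shift[OF assms, where q=1, unfolded poly_normal_def, simplified])
    then have "AE s in \<mu>. False"
      by eventually_elim (use normal_density_pos[OF assms(1)] in \<open>simp add: poly_normal_def less_le\<close>)
    then show False by simp
  qed
  ultimately show ?thesis by simp
qed

text \<open>Tonelli, then the translation \<open>u = s + y\<close>. Two weights \<open>f\<close>
  matter: an indicator identifies the law of an independent sum, and the constant 1 gives the total
  mass of a mixture.\<close>

lemma nn_integral_normal_mix:
  assumes "\<sigma> > 0" "prob_space \<mu>" "sets \<mu> = sets borel"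
    and q: "\<And>x. poly q x \<ge> 0"
    and f: "f \<in> borel_measurable borel"
  shows "(\<integral>\<^sup>+u. ennreal (normal_mix \<sigma> \<mu> q u) * f u \<partial>lborel) =
    (\<integral>\<^sup>+s. \<integral>\<^sup>+y. ennreal (poly_normal \<sigma> q y) * f (s + y) \<partial>lborel \<partial>\<mu>)"
proof -
  interpret prob_space \<mu> by fact
  interpret pair_sigma_finite lborel \<mu> ..
  note [measurable_cong] = assms(3)
  note [measurable] = f
  have nn: "poly_normal \<sigma> q x \<ge> 0" for x using q by (simp add: poly_normal_def)
  have "(\<integral>\<^sup>+u. ennreal (normal_mix \<sigma> \<mu> q u) * f u \<partial>lborel) =
      (\<integral>\<^sup>+u. (\<integral>\<^sup>+s. ennreal (poly_normal \<sigma> q (u - s)) * f u \<partial>\<mu>) \<partial>lborel)"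
    unfolding normal_mix_def
    by (intro nn_integral_cong, subst nn_integral_multc, simp)
       (simp add: nn_integral_eq_integral[OF integrable_poly_normal_shift[OF assms(1-3)]] nn)
  also have "\<dots> = (\<integral>\<^sup>+s. (\<integral>\<^sup>+u. ennreal (poly_normal \<sigma> q (u - s)) * f u \<partial>lborel) \<partial>\<mu>)"
    by (subst Fubini'[symmetric]) auto
  also have "\<dots> = (\<integral>\<^sup>+s. \<integral>\<^sup>+y. ennreal (poly_normal \<sigma> q y) * f (s + y) \<partial>lborel \<partial>\<mu>)"
  proof (rule nn_integral_cong)
    fix s
    have "(\<integral>\<^sup>+u. ennreal (poly_normal \<sigma> q (u - s)) * f u \<partial>lborel) =
       (\<integral>\<^sup>+u. ennreal (poly_normal \<sigma> q (u - s)) * f u \<partial>distr lborel borel ((+) s))"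
      by (simp add: lborel_distr_plus)
    also have "\<dots> = (\<integral>\<^sup>+y. ennreal (poly_normal \<sigma> q y) * f (s + y) \<partial>lborel)"
      by (subst nn_integral_distr) auto
    finally show "(\<integral>\<^sup>+u. ennreal (poly_normal \<sigma> q (u - s)) * f u \<partial>lborel) =
       (\<integral>\<^sup>+y. ennreal (poly_normal \<sigma> q y) * f (s + y) \<partial>lborel)" .
  qed
  finally show ?thesis .
qed

text \<open>The set of disagreement is open and null, whereas a nonempty open set contains an
  interval of positive length.\<close>

lemma continuous_AE_lborel_eq:
  fixes f g :: "real \<Rightarrow> real"
  assumes "continuous_on UNIV f" "continuous_on UNIV g" "AE x in lborel. f x = g x"
  shows "f = g"
proof (rule ccontr)
  assume "f \<noteq> g"
  then obtain x where x: "f x \<noteq> g x" by auto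
  have op: "open {x. f x \<noteq> g x}"
    using assms(1,2) by (intro open_Collect_neq) auto
  obtain e where e: "e > 0" "ball x e \<subseteq> {x. f x \<noteq> g x}"
    by (rule openE[OF op, of x]) (use x in auto)
  have "{x. f x \<noteq> g x} \<in> null_sets lborel"
  proof -
    have "{x \<in> space lborel. \<not> f x = g x} \<in> null_sets lborel"
      using assms(3) op by (subst AE_iff_null[symmetric]) auto
    then show ?thesis by simp
  qed
  then have "ball x e \<in> null_sets lborel"
    by (rule null_sets_subset[OF _ _ e(2)]) auto
  then have "emeasure lborel {x - e<..<x + e} = 0"
    by (simp add: ball_eq_greaterThanLessThan null_setsD1)
  then show False using e by simp
qed

text \<open>Justifies the definite description in \<open>fisher_information\<close>. Continuity is
  read off the instance \<open>k = 0\<close> of the differentiability clause.\<close>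

lemma smooth_density_unique:
  assumes "prob_space M" "smooth_density M U p" "smooth_density M U q"
  shows "p = q"
proof (rule continuous_AE_lborel_eq)
  have "isCont p u" if "smooth_density M U p" for p u
  proof -
    have "\<forall>k u. (deriv ^^ k) p differentiable (at u)"
      using that unfolding smooth_density_def by blast
    from this[rule_format, of 0 u] show ?thesis
      by (simp add: differentiable_imp_continuous_within)
  qed
  with assms show "continuous_on UNIV p" "continuous_on UNIV q"
    by (simp_all add: continuous_at_imp_continuous_on)
  have "AE x in lborel. ennreal (p x) = ennreal (q x)"
    using assms unfolding smooth_density_def by (intro prob_space.distributed_unique[of M lborel U]) auto
  then show "AE x in lborel. p x = q x"
    by eventually_elim (use assms in \<open>auto simp: smooth_density_def ennreal_inj\<close>)
qed

section \<open>Density and Fisher information of a sum with an independent normal variable\<close>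

context
  fixes M :: "'a measure" and S G :: "'a \<Rightarrow> real" and \<sigma> :: real
  assumes M: "prob_space M" and \<sigma>: "\<sigma> > 0"
    and G: "distributed M lborel G (\<lambda>x. ennreal (normal_density 0 \<sigma> x))"
    and ind: "prob_space.indep_var M borel S borel G"
begin

interpretation prob_space M by (rule M)

lemma distributed_indep_normal_sum:
  "distributed M lborel (\<lambda>\<omega>. S \<omega> + G \<omega>) (\<lambda>u. ennreal (normal_mix \<sigma> (distr M borel S) 1 u))"
proof -
  have [measurable]: "S \<in> borel_measurable M" "G \<in> borel_measurable M"
    using ind by (auto dest: indep_var_rv1 indep_var_rv2)
  define \<mu> where "\<mu> = distr M borel S"
  have mu: "prob_space \<mu>" "sets \<mu> = sets borel"
    unfolding \<mu>_def by (auto intro: prob_space_distr)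
  interpret mu: prob_space \<mu> by (rule mu)
  have Gd: "distr M borel G = density lborel (\<lambda>x. ennreal (normal_density 0 \<sigma> x))"
    unfolding distributed_distr_eq_density[OF G, symmetric] by (rule distr_cong) auto
  interpret g: prob_space "distr M borel G" by (rule prob_space_distr) simp
  note [measurable] = borel_measurable_normal_mix[OF \<sigma> mu]
  have "distr M borel (\<lambda>\<omega>. S \<omega> + G \<omega>) = density lborel (\<lambda>u. ennreal (normal_mix \<sigma> \<mu> 1 u))"
  proof (rule measure_eqI)
    fix A assume "A \<in> sets (distr M borel (\<lambda>\<omega>. S \<omega> + G \<omega>))"
    then have A[measurable]: "A \<in> sets borel" by simp
    have "emeasure (distr M borel (\<lambda>\<omega>. S \<omega> + G \<omega>)) A = emeasure (convolution \<mu> (distr M borel G)) A"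
      by (subst sum_indep_random_variable[OF ind]) (auto simp: \<mu>_def)
    also have "\<dots> = (\<integral>\<^sup>+s. \<integral>\<^sup>+y. indicator A (s + y) \<partial>distr M borel G \<partial>\<mu>)"
      by (rule convolution_emeasure')
         (auto simp: mu intro: mu.finite_measure_axioms g.finite_measure_axioms)
    also have "\<dots> = (\<integral>\<^sup>+s. \<integral>\<^sup>+y. ennreal (poly_normal \<sigma> 1 y) * indicator A (s + y) \<partial>lborel \<partial>\<mu>)"
      unfolding Gd by (intro nn_integral_cong) (simp add: nn_integral_density poly_normal_def)
    also have "\<dots> = (\<integral>\<^sup>+u. ennreal (normal_mix \<sigma> \<mu> 1 u) * indicator A u \<partial>lborel)"
      by (subst nn_integral_normal_mix[OF \<sigma> mu]) auto
    also have "\<dots> = emeasure (density lborel (\<lambda>u. ennreal (normal_mix \<sigma> \<mu> 1 u))) A"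
      by (subst emeasure_density) auto
    finally show "emeasure (distr M borel (\<lambda>\<omega>. S \<omega> + G \<omega>)) A = \<dots>" .
  qed simp
  moreover have "distr M lborel (\<lambda>\<omega>. S \<omega> + G \<omega>) = distr M borel (\<lambda>\<omega>. S \<omega> + G \<omega>)"
    by (rule distr_cong) auto
  ultimately show ?thesis
    unfolding distributed_def \<mu>_def[symmetric] by simp
qed

text \<open>Each derivative of the density is again a mixture, with the polynomial iterated under
  \<open>hermite_step\<close>; the smoothness comes from the Gaussian part, whatever the law of
  \<open>S\<close>.\<close>

lemma smooth_density_indep_normal_sum:
  "smooth_density M (\<lambda>\<omega>. S \<omega> + G \<omega>) (normal_mix \<sigma> (distr M borel S) 1)"
proof -
  have "S \<in> borel_measurable M"
    using ind by (auto dest: indep_var_rv1)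
  then have mu: "prob_space (distr M borel S)" "sets (distr M borel S) = sets borel"
    by (auto intro: prob_space_distr)
  show ?thesis
    unfolding smooth_density_def
    using distributed_indep_normal_sum normal_mix_pos[OF \<sigma> mu]
      has_real_derivative_normal_mix[OF \<sigma> mu]
    by (auto simp: funpow_deriv_normal_mix[OF \<sigma> mu] real_differentiable_def intro: less_imp_le)
qed

text \<open>Integrating the squared score against the everywhere positive density \<open>p\<close>
  turns \<open>p * (p' / p)\<^sup>2\<close> into \<open>p'\<^sup>2 / p\<close>. The outcome depends
  on \<open>S\<close> only through its law, which is where weak convergence enters.\<close>

lemma fisher_information_indep_normal_sum:
  "fisher_information M (\<lambda>\<omega>. S \<omega> + G \<omega>) =
    (\<integral>\<^sup>+u. ennreal ((normal_mix \<sigma> (distr M borel S) (hermite_step \<sigma> 1) u)\<^sup>2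
      / normal_mix \<sigma> (distr M borel S) 1 u) \<partial>lborel)"
proof -
  have S: "S \<in> borel_measurable M"
    using ind by (auto dest: indep_var_rv1)
  define \<mu> where "\<mu> = distr M borel S"
  have mu: "prob_space \<mu>" "sets \<mu> = sets borel"
    using S unfolding \<mu>_def by (auto intro: prob_space_distr)
  define p where "p = normal_mix \<sigma> \<mu> 1"
  have [measurable]: "normal_mix \<sigma> \<mu> q \<in> borel_measurable borel" for q
    by (rule borel_measurable_normal_mix[OF \<sigma> mu])
  have sp: "smooth_density M (\<lambda>\<omega>. S \<omega> + G \<omega>) p"
    unfolding p_def \<mu>_def by (rule smooth_density_indep_normal_sum)
  then have the: "(THE p. smooth_density M (\<lambda>\<omega>. S \<omega> + G \<omega>) p) = p"
    by (intro the_equality) (auto intro: smooth_density_unique[OF M])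
  have dp: "deriv p = normal_mix \<sigma> \<mu> (hermite_step \<sigma> 1)"
    unfolding p_def by (rule deriv_normal_mix[OF \<sigma> mu])
  have [measurable]: "p \<in> borel_measurable borel" by (simp add: p_def)
  have pos: "p u > 0" for u unfolding p_def by (rule normal_mix_pos[OF \<sigma> mu])
  have "fisher_information M (\<lambda>\<omega>. S \<omega> + G \<omega>) = (\<integral>\<^sup>+\<omega>. ennreal ((score p (S \<omega> + G \<omega>))\<^sup>2) \<partial>M)"
    unfolding fisher_information_def the using sp by auto
  also have "\<dots> = (\<integral>\<^sup>+u. ennreal (p u) * ennreal ((score p u)\<^sup>2) \<partial>lborel)"
    using sp unfolding smooth_density_def score_def dp
    by (subst distributed_nn_integral[where X="\<lambda>\<omega>. S \<omega> + G \<omega>" and f="\<lambda>u. ennreal (p u)"]) auto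
  also have "\<dots> = (\<integral>\<^sup>+u. ennreal ((deriv p u)\<^sup>2 / p u) \<partial>lborel)"
  proof (rule nn_integral_cong)
    fix u
    have "p u * (score p u)\<^sup>2 = (deriv p u)\<^sup>2 / p u"
      using pos[of u] by (simp add: score_def field_simps power2_eq_square)
    then show "ennreal (p u) * ennreal ((score p u)\<^sup>2) = ennreal ((deriv p u)\<^sup>2 / p u)"
      using pos[of u] by (simp flip: ennreal_mult)
  qed
  finally show ?thesis unfolding dp unfolding p_def \<mu>_def .
qed

end

text \<open>The factor in front of the Gaussian kernel \<open>\<phi>\<close> in \<open>\<phi>'\<^sup>2 / \<phi>\<close>.\<close>

definition energy_poly :: "real \<Rightarrow> real poly" where
  "energy_poly \<sigma> = smult (1 / \<sigma> ^ 4) ([:0, 1:] * [:0, 1:])"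

text \<open>Every translate of the weighted kernel has the same integral,
  \<open>1 / \<sigma> ^ 4\<close> times the variance \<open>\<sigma>\<^sup>2\<close> of the kernel,
  and \<open>\<mu>\<close> has mass one.\<close>

lemma nn_integral_normal_mix_energy:
  assumes "\<sigma> > 0" "prob_space \<mu>" "sets \<mu> = sets borel"
  shows "(\<integral>\<^sup>+u. ennreal (normal_mix \<sigma> \<mu> (energy_poly \<sigma>) u) \<partial>lborel) = ennreal (1 / \<sigma>\<^sup>2)"
proof -
  interpret prob_space \<mu> by fact
  have "has_bochner_integral lborel (\<lambda>x. normal_density 0 \<sigma> x * (x - 0) ^ (2 * 1)) (fact (2 * 1) / ((2 / \<sigma>\<^sup>2) ^ 1 * fact 1))"
    by (rule normal_moment_even) fact
  then have "has_bochner_integral lborel (\<lambda>x. 1 / \<sigma> ^ 4 * (normal_density 0 \<sigma> x * x\<^sup>2)) (1 / \<sigma> ^ 4 * \<sigma>\<^sup>2)"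
    by (intro has_bochner_integral_mult_right) (simp add: fact_numeral)
  moreover have "poly_normal \<sigma> (energy_poly \<sigma>) = (\<lambda>x. 1 / \<sigma> ^ 4 * (normal_density 0 \<sigma> x * x\<^sup>2))"
    by (rule ext) (simp add: poly_normal_def energy_poly_def power2_eq_square)
  moreover have "1 / \<sigma> ^ 4 * \<sigma>\<^sup>2 = 1 / \<sigma>\<^sup>2"
    using assms(1) by (simp add: field_simps power2_eq_square power4_eq_xxxx)
  ultimately have "has_bochner_integral lborel (poly_normal \<sigma> (energy_poly \<sigma>)) (1 / \<sigma>\<^sup>2)"
    by metis
  then have 1: "(\<integral>\<^sup>+y. ennreal (poly_normal \<sigma> (energy_poly \<sigma>) y) \<partial>lborel) = ennreal (1 / \<sigma>\<^sup>2)"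
    by (intro nn_integral_eq_integral[THEN trans])
       (auto simp: has_bochner_integral_iff poly_normal_def[abs_def] energy_poly_def)
  show ?thesis
    using nn_integral_normal_mix[OF assms, of "energy_poly \<sigma>" "\<lambda>_. 1"] 1
    by (simp add: energy_poly_def emeasure_space_1)
qed

lemma hermite_step_one: "hermite_step \<sigma> 1 = [:0, - 1 / \<sigma>\<^sup>2:]"
  by (simp add: hermite_step_def)

text \<open>Cauchy--Schwarz, as the nonnegativity of a quadratic form averaged over the mixing measure.\<close>

lemma normal_mix_score_le_energy:
  assumes "\<sigma> > 0" "prob_space \<mu>" "sets \<mu> = sets borel"
  shows "(normal_mix \<sigma> \<mu> (hermite_step \<sigma> 1) u)\<^sup>2 / normal_mix \<sigma> \<mu> 1 u \<le> normal_mix \<sigma> \<mu> (energy_poly \<sigma>) u"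
proof -
  let ?p = "normal_mix \<sigma> \<mu> 1 u" and ?d = "normal_mix \<sigma> \<mu> (hermite_step \<sigma> 1) u"
  let ?h = "normal_mix \<sigma> \<mu> (energy_poly \<sigma>) u"
  have pos: "?p > 0" by (rule normal_mix_pos[OF assms])
  note int = integrable_poly_normal_shift[OF assms]
  \<comment> \<open>The minimiser of \<open>?h - 2 * c * ?d + c\<^sup>2 * ?p\<close>, whose minimum
    is \<open>?h - ?d\<^sup>2 / ?p\<close>. For each \<open>s\<close> the integrand is a square
    times the kernel, because \<open>hermite_step \<sigma> 1\<close> is
    \<open>- x / \<sigma>\<^sup>2\<close>.\<close>
  define c where "c = ?d / ?p"
  have "0 \<le> (\<integral>s. poly_normal \<sigma> (energy_poly \<sigma>) (u - s) - 2 * c * poly_normal \<sigma> (hermite_step \<sigma> 1) (u - s)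
      + c\<^sup>2 * poly_normal \<sigma> 1 (u - s) \<partial>\<mu>)"
  proof (rule Bochner_Integration.integral_nonneg)
    fix s
    have "poly_normal \<sigma> (energy_poly \<sigma>) (u - s) - 2 * c * poly_normal \<sigma> (hermite_step \<sigma> 1) (u - s)
      + c\<^sup>2 * poly_normal \<sigma> 1 (u - s) = ((u - s) / \<sigma>\<^sup>2 + c)\<^sup>2 * normal_density 0 \<sigma> (u - s)"
      unfolding poly_normal_def energy_poly_def hermite_step_one using assms(1)
      by (simp add: field_simps power2_eq_square power4_eq_xxxx)
    then show "0 \<le> poly_normal \<sigma> (energy_poly \<sigma>) (u - s) - 2 * c * poly_normal \<sigma> (hermite_step \<sigma> 1) (u - s)
      + c\<^sup>2 * poly_normal \<sigma> 1 (u - s)" by simp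
  qed
  also have "\<dots> = ?h - 2 * c * ?d + c\<^sup>2 * ?p"
    unfolding normal_mix_def using int by simp
  also have "\<dots> = ?h - ?d\<^sup>2 / ?p"
    using pos by (simp add: c_def field_simps power2_eq_square)
  finally show ?thesis by simp
qed

section \<open>Passage to the limit in the Fisher information\<close>

lemma tendsto_normal_mix:
  assumes "\<sigma> > 0" "\<And>n. real_distribution (\<mu> n)" "real_distribution \<mu>'" "weak_conv_m \<mu> \<mu>'"
  shows "(\<lambda>n. normal_mix \<sigma> (\<mu> n) q u) \<longlonglongrightarrow> normal_mix \<sigma> \<mu>' q u"
proof -
  obtain B where B: "\<And>x. \<bar>poly_normal \<sigma> q x\<bar> \<le> B" using bounded_poly_normal[OF assms(1)] by metis
  have "isCont (\<lambda>s. poly_normal \<sigma> q (u - s)) x" for x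
    by (rule isCont_o2[where f="\<lambda>s. u - s"])
       (auto intro!: DERIV_isCont[OF has_real_derivative_poly_normal[OF assms(1)]])
  then show ?thesis
    unfolding normal_mix_def
    by (intro weak_conv_imp_integral_bdd_continuous_conv[where B=B] assms) (auto simp: B)
qed

text \<open>Dominated convergence with moving majorants. Constant mass lets Scheffe's lemma upgrade
  the pointwise convergence of \<open>h n\<close> to convergence in L1. Then \<open>g n\<close> is
  split into \<open>min (g n) h'\<close>, which has the fixed majorant \<open>h'\<close>, and an
  excess that the L1 distance controls.\<close>

lemma tendsto_integral_dominated_const_mass:
  fixes g h :: "nat \<Rightarrow> 'a \<Rightarrow> real"
  assumes m: "\<And>n. g n \<in> borel_measurable N" "g' \<in> borel_measurable N"
    "\<And>n. h n \<in> borel_measurable N" "h' \<in> borel_measurable N"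
    and le: "\<And>n x. 0 \<le> g n x" "\<And>n x. g n x \<le> h n x"
    and lim: "\<And>x. (\<lambda>n. g n x) \<longlonglongrightarrow> g' x" "\<And>x. (\<lambda>n. h n x) \<longlonglongrightarrow> h' x"
    and mass: "\<And>n. (\<integral>\<^sup>+x. ennreal (h n x) \<partial>N) = ennreal c" "(\<integral>\<^sup>+x. ennreal (h' x) \<partial>N) = ennreal c"
  shows "\<And>n. integrable N (g n)" "integrable N g'"
    "(\<lambda>n. integral\<^sup>L N (g n)) \<longlonglongrightarrow> integral\<^sup>L N g'"
proof -
  note [measurable] = m
  have le': "0 \<le> g' x" "g' x \<le> h' x" "0 \<le> h n x" for n x
  proof -
    show "0 \<le> g' x" by (rule LIMSEQ_le_const[OF lim(1)]) (auto simp: le)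
    show "g' x \<le> h' x" by (rule LIMSEQ_le[OF lim(1) lim(2)]) (auto simp: le)
    show "0 \<le> h n x" using le[of n x] by linarith
  qed
  have h'0: "0 \<le> h' x" for x using le'(1,2)[of x] by linarith
  have ih: "integrable N (h n)" for n
    by (rule integrableI_nonneg) (auto simp: le' mass)
  have ih': "integrable N h'"
    by (rule integrableI_nonneg) (auto simp: h'0 mass)
  show ig: "integrable N (g n)" for n
    by (rule Bochner_Integration.integrable_bound[OF ih[of n]]) (auto simp: le le')
  show ig': "integrable N g'"
    by (rule Bochner_Integration.integrable_bound[OF ih']) (auto simp: le' h'0)
  have sch: "(\<lambda>n. \<integral>\<^sup>+ x. norm (h n x - h' x) \<partial>N) \<longlonglongrightarrow> 0"
    by (rule Scheffe_lemma2) (auto simp: ih' lim mass le' h'0)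
  have iabs: "integrable N (\<lambda>x. \<bar>h n x - h' x\<bar>)" for n using ih ih' by auto
  have "(\<lambda>n. ennreal (\<integral>x. \<bar>h n x - h' x\<bar> \<partial>N)) \<longlonglongrightarrow> ennreal 0"
    using sch by (simp add: nn_integral_eq_integral[OF iabs])
  then have sch': "(\<lambda>n. \<integral>x. \<bar>h n x - h' x\<bar> \<partial>N) \<longlonglongrightarrow> 0"
    by (subst (asm) tendsto_ennreal_iff) auto
  have imin: "integrable N (\<lambda>x. min (g n x) (h' x))" for n
    using ig ih' by (rule integrable_min)
  have "(\<lambda>n. \<integral>x. min (g n x) (h' x) \<partial>N) \<longlonglongrightarrow> integral\<^sup>L N g'"
  proof (rule integral_dominated_convergence[where w=h'])
    show "AE x in N. (\<lambda>n. min (g n x) (h' x)) \<longlonglongrightarrow> g' x"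
    proof (rule AE_I2)
      fix x
      have "(\<lambda>n. min (g n x) (h' x)) \<longlonglongrightarrow> min (g' x) (h' x)"
        by (intro tendsto_min lim tendsto_const)
      then show "(\<lambda>n. min (g n x) (h' x)) \<longlonglongrightarrow> g' x" using le'(2)[of x] by (simp add: min_def)
    qed
    show "AE x in N. norm (min (g n x) (h' x)) \<le> h' x" for n
      using le(1)[THEN leD] le(1) h'0 by (auto simp: min_def abs_if)
  qed (auto simp: ih')
  \<comment> \<open>Where \<open>g n\<close> exceeds \<open>h'\<close>, the excess is at most
    \<open>h n - h'\<close>, since \<open>g n <= h n\<close>.\<close>
  moreover have "(\<lambda>n. (\<integral>x. g n x \<partial>N) - (\<integral>x. min (g n x) (h' x) \<partial>N)) \<longlonglongrightarrow> 0"
  proof (rule tendsto_sandwich[OF _ _ tendsto_const sch'])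
    have "0 \<le> (\<integral>x. g n x - min (g n x) (h' x) \<partial>N)" for n
      by (rule Bochner_Integration.integral_nonneg) auto
    then show "\<forall>\<^sub>F n in sequentially. 0 \<le> (\<integral>x. g n x \<partial>N) - (\<integral>x. min (g n x) (h' x) \<partial>N)"
      using ig imin by (auto simp: intro!: always_eventually)
    have "(\<integral>x. g n x - min (g n x) (h' x) \<partial>N) \<le> (\<integral>x. \<bar>h n x - h' x\<bar> \<partial>N)" for n
    proof (rule integral_mono)
      show "g n x - min (g n x) (h' x) \<le> \<bar>h n x - h' x\<bar>" for x
        using le(2)[of n x] by (auto simp: min_def)
    qed (use ig imin iabs in auto)
    then show "\<forall>\<^sub>F n in sequentially. (\<integral>x. g n x \<partial>N) - (\<integral>x. min (g n x) (h' x) \<partial>N) \<le> (\<integral>x. \<bar>h n x - h' x\<bar> \<partial>N)"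
      using ig imin by (auto intro!: always_eventually)
  qed
  ultimately have "(\<lambda>n. (\<integral>x. min (g n x) (h' x) \<partial>N) + ((\<integral>x. g n x \<partial>N) - (\<integral>x. min (g n x) (h' x) \<partial>N)))
      \<longlonglongrightarrow> integral\<^sup>L N g' + 0"
    by (rule tendsto_add)
  then show "(\<lambda>n. integral\<^sup>L N (g n)) \<longlonglongrightarrow> integral\<^sup>L N g'" by simp
qed

text \<open>For \<open>s > 0\<close> this is the convolution of two centred normal densities. That
  formula requires positive deviations, so the point mass at \<open>s = 0\<close> is treated
  apart.\<close>

lemma normal_mix_scaled_std_normal:
  assumes "\<sigma> > 0" "s \<ge> 0"
  shows "normal_mix \<sigma> (distr std_normal_distribution borel (\<lambda>x. s * x)) 1 u =
    normal_density 0 (sqrt (s\<^sup>2 + \<sigma>\<^sup>2)) u"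
proof (cases "s = 0")
  case True
  interpret prob_space std_normal_distribution by (rule prob_space_normal_density) simp
  show ?thesis
    unfolding normal_mix_def True
    by (subst integral_distr) (use assms prob_space in \<open>auto simp: poly_normal_def\<close>)
next
  case False
  with assms have s: "s > 0" by simp
  interpret N: prob_space std_normal_distribution by (rule prob_space_normal_density) simp
  have "distributed std_normal_distribution lborel (\<lambda>x. x) (\<lambda>x. ennreal (normal_density 0 1 x))"
    by (auto simp: distributed_def intro!: measure_eqI simp: emeasure_distr)
  from N.normal_density_affine[OF this, of s 0] s
  have "distributed std_normal_distribution lborel (\<lambda>x. s * x) (\<lambda>x. ennreal (normal_density 0 s x))"
    by simp
  then have D: "distr std_normal_distribution lborel (\<lambda>x. s * x) = density lborel (\<lambda>x. ennreal (normal_density 0 s x))"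
    by (simp add: distributed_def)
  have "distr std_normal_distribution borel (\<lambda>x. s * x) = distr std_normal_distribution lborel (\<lambda>x. s * x)"
    by (rule distr_cong) auto
  then have mu: "distr std_normal_distribution borel (\<lambda>x. s * x) = density lborel (\<lambda>x. ennreal (normal_density 0 s x))"
    using D by simp
  have "normal_mix \<sigma> (distr std_normal_distribution borel (\<lambda>x. s * x)) 1 u =
    (\<integral>y. normal_density 0 s y * normal_density 0 \<sigma> (u - y) \<partial>lborel)"
    unfolding normal_mix_def mu poly_normal_def by (subst integral_density) auto
  also have "\<dots> = enn2real (\<integral>\<^sup>+y. ennreal (normal_density 0 \<sigma> (u - y) * normal_density 0 s y) \<partial>lborel)"
    by (subst integral_eq_nn_integral) (auto simp: mult.commute)
  also have "\<dots> = normal_density 0 (sqrt (s\<^sup>2 + \<sigma>\<^sup>2)) u"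
    using fun_cong[OF conv_normal_density_zero_mean[OF assms(1) s], of u] by (simp add: add.commute)
  finally show ?thesis .
qed

text \<open>By uniqueness of derivatives: the mixture for \<open>q = 1\<close> is a known normal
  density, and differentiating it replaces the evaluation of a second integral.\<close>

lemma normal_mix_score_scaled_std_normal:
  assumes "\<sigma> > 0" "s \<ge> 0"
  shows "normal_mix \<sigma> (distr std_normal_distribution borel (\<lambda>x. s * x)) (hermite_step \<sigma> 1) u =
    - u / (s\<^sup>2 + \<sigma>\<^sup>2) * normal_density 0 (sqrt (s\<^sup>2 + \<sigma>\<^sup>2)) u"
proof -
  interpret prob_space std_normal_distribution by (rule prob_space_normal_density) simp
  let ?\<mu> = "distr std_normal_distribution borel (\<lambda>x. s * x)"
  have mu: "prob_space ?\<mu>" "sets ?\<mu> = sets borel"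
    by (auto intro: prob_space_distr)
  have "(normal_mix \<sigma> ?\<mu> 1 has_real_derivative
     - u / (sqrt (s\<^sup>2 + \<sigma>\<^sup>2))\<^sup>2 * normal_density 0 (sqrt (s\<^sup>2 + \<sigma>\<^sup>2)) u) (at u)"
    unfolding normal_mix_scaled_std_normal[OF assms, abs_def]
    by (rule has_real_derivative_normal_density) (use assms in \<open>auto simp: add_nonneg_pos\<close>)
  with has_real_derivative_normal_mix[OF assms(1) mu, of 1 u] show ?thesis
    using assms by (auto dest: DERIV_unique)
qed

text \<open>The real sequence \<open>J\<close> certifies finiteness at every index and allows the
  later product with the variances to be handled by limits of reals.\<close>

lemma tendsto_fisher_information_indep_normal_sum:
  fixes S G :: "nat \<Rightarrow> 'a \<Rightarrow> real"
  assumes M: "prob_space M" and \<sigma>: "\<sigma> > 0" and s: "s \<ge> 0"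
    and G: "\<And>n. distributed M lborel (G n) (\<lambda>x. ennreal (normal_density 0 \<sigma> x))"
    and ind: "\<And>n. prob_space.indep_var M borel (S n) borel (G n)"
    and weak: "weak_conv_m (\<lambda>n. distr M borel (S n)) (distr std_normal_distribution borel (\<lambda>x. s * x))"
  shows "\<exists>J. (\<forall>n. fisher_information M (\<lambda>\<omega>. S n \<omega> + G n \<omega>) = ennreal (J n) \<and> 0 \<le> J n) \<and>
    J \<longlonglongrightarrow> 1 / (s\<^sup>2 + \<sigma>\<^sup>2)"
proof -
  interpret prob_space M by (rule M)
  interpret N: prob_space std_normal_distribution by (rule prob_space_normal_density) simp
  have [measurable]: "S n \<in> borel_measurable M" for n
    using ind by (auto dest: indep_var_rv1)
  define \<mu> where "\<mu> n = distr M borel (S n)" for n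
  define \<mu>' where "\<mu>' = distr std_normal_distribution borel (\<lambda>x. s * x)"
  define v where "v = s\<^sup>2 + \<sigma>\<^sup>2"
  have v: "v > 0" using \<sigma> by (simp add: v_def add_nonneg_pos)
  have mu: "prob_space (\<mu> n)" "sets (\<mu> n) = sets borel" "prob_space \<mu>'" "sets \<mu>' = sets borel" for n
    unfolding \<mu>_def \<mu>'_def by (auto intro: prob_space_distr N.prob_space_distr)
  have rd: "real_distribution (\<mu> n)" "real_distribution \<mu>'" for n
    using mu by (auto simp: real_distribution_def real_distribution_axioms_def)
  have w: "weak_conv_m \<mu> \<mu>'" using weak unfolding \<mu>_def \<mu>'_def .
  define g where "g \<nu> u = (normal_mix \<sigma> \<nu> (hermite_step \<sigma> 1) u)\<^sup>2 / normal_mix \<sigma> \<nu> 1 u" for \<nu> u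
  define h where "h \<nu> u = normal_mix \<sigma> \<nu> (energy_poly \<sigma>) u" for \<nu> u
  have pos: "normal_mix \<sigma> (\<mu> n) 1 u > 0" "normal_mix \<sigma> \<mu>' 1 u > 0" for n u
    by (intro normal_mix_pos \<sigma> mu)+
  note [measurable] = borel_measurable_normal_mix[OF \<sigma> mu(1,2)] borel_measurable_normal_mix[OF \<sigma> mu(3,4)]
  note res = tendsto_integral_dominated_const_mass[where N=lborel and g="\<lambda>n. g (\<mu> n)" and g'="g \<mu>'"
      and h="\<lambda>n. h (\<mu> n)" and h'="h \<mu>'" and c="1 / \<sigma>\<^sup>2"]
  have prem: "g (\<mu> n) \<in> borel_measurable lborel" "g \<mu>' \<in> borel_measurable lborel"
    "h (\<mu> n) \<in> borel_measurable lborel" "h \<mu>' \<in> borel_measurable lborel"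
    "0 \<le> g (\<mu> n) u" "g (\<mu> n) u \<le> h (\<mu> n) u"
    "(\<lambda>n. g (\<mu> n) u) \<longlonglongrightarrow> g \<mu>' u" "(\<lambda>n. h (\<mu> n) u) \<longlonglongrightarrow> h \<mu>' u"
    "(\<integral>\<^sup>+u. ennreal (h (\<mu> n) u) \<partial>lborel) = ennreal (1 / \<sigma>\<^sup>2)"
    "(\<integral>\<^sup>+u. ennreal (h \<mu>' u) \<partial>lborel) = ennreal (1 / \<sigma>\<^sup>2)" for n u
  proof -
    show "g (\<mu> n) \<in> borel_measurable lborel" "g \<mu>' \<in> borel_measurable lborel"
      "h (\<mu> n) \<in> borel_measurable lborel" "h \<mu>' \<in> borel_measurable lborel"
      unfolding g_def[abs_def] h_def[abs_def] by measurable
    show "0 \<le> g (\<mu> n) u" unfolding g_def using pos by (simp add: less_imp_le)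
    show "g (\<mu> n) u \<le> h (\<mu> n) u"
      unfolding g_def h_def by (rule normal_mix_score_le_energy[OF \<sigma> mu(1,2)])
    show "(\<lambda>n. g (\<mu> n) u) \<longlonglongrightarrow> g \<mu>' u" unfolding g_def
      by (intro tendsto_intros tendsto_normal_mix[OF \<sigma> rd w] less_imp_neq[THEN not_sym] pos)
    show "(\<lambda>n. h (\<mu> n) u) \<longlonglongrightarrow> h \<mu>' u" unfolding h_def
      by (intro tendsto_normal_mix[OF \<sigma> rd w])
    show "(\<integral>\<^sup>+u. ennreal (h (\<mu> n) u) \<partial>lborel) = ennreal (1 / \<sigma>\<^sup>2)"
      "(\<integral>\<^sup>+u. ennreal (h \<mu>' u) \<partial>lborel) = ennreal (1 / \<sigma>\<^sup>2)"
      unfolding h_def by (intro nn_integral_normal_mix_energy \<sigma> mu)+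
  qed
  have int: "integrable lborel (g (\<mu> n))" for n
    by (rule res(1)) (rule prem)+
  have lim: "(\<lambda>n. integral\<^sup>L lborel (g (\<mu> n))) \<longlonglongrightarrow> integral\<^sup>L lborel (g \<mu>')"
    by (rule res(3)) (rule prem)+
  \<comment> \<open>For a normal density of variance \<open>v\<close> the score is
    \<open>- u / v\<close>, so the integrand is \<open>u\<^sup>2 / v\<^sup>2\<close> times the
    density; the second moment \<open>v\<close> leaves \<open>1 / v\<close>.\<close>
  have "g \<mu>' = (\<lambda>u. 1 / v\<^sup>2 * (normal_density 0 (sqrt v) u * (u - 0) ^ (2 * 1)))"
  proof
    fix u
    have "normal_density 0 (sqrt v) u > 0" using v by (intro normal_density_pos) simp
    then show "g \<mu>' u = 1 / v\<^sup>2 * (normal_density 0 (sqrt v) u * (u - 0) ^ (2 * 1))"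
      unfolding g_def \<mu>'_def normal_mix_score_scaled_std_normal[OF \<sigma> s] normal_mix_scaled_std_normal[OF \<sigma> s]
        v_def[symmetric]
      using v by (simp add: field_simps power2_eq_square)
  qed
  then have "integral\<^sup>L lborel (g \<mu>') = 1 / v\<^sup>2 * (fact (2 * 1) / ((2 / (sqrt v)\<^sup>2) ^ 1 * fact 1))"
    using has_bochner_integral_integral_eq[OF normal_moment_even[of "sqrt v" 0 1]] v by simp
  also have "\<dots> = 1 / v" using v by (simp add: field_simps power2_eq_square)
  finally have lim': "(\<lambda>n. integral\<^sup>L lborel (g (\<mu> n))) \<longlonglongrightarrow> 1 / v" using lim by simp
  show ?thesis
  proof (intro exI conjI allI)
    fix n
    show "fisher_information M (\<lambda>\<omega>. S n \<omega> + G n \<omega>) = ennreal (integral\<^sup>L lborel (g (\<mu> n)))"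
      unfolding fisher_information_indep_normal_sum[OF M \<sigma> G ind] \<mu>_def[symmetric] g_def[symmetric]
      by (rule nn_integral_eq_integral[OF int]) (simp add: prem)
    show "0 \<le> integral\<^sup>L lborel (g (\<mu> n))"
      by (rule Bochner_Integration.integral_nonneg) (simp add: prem)
    show "(\<lambda>n. integral\<^sup>L lborel (g (\<mu> n))) \<longlonglongrightarrow> 1 / (s\<^sup>2 + \<sigma>\<^sup>2)"
      using lim' by (simp add: v_def)
  qed
qed

section \<open>Covariances under strong mixing\<close>

locale stationary_mixing = prob_space M for M :: "'a measure" +
  fixes X :: "int \<Rightarrow> 'a \<Rightarrow> real"
  assumes stationary: "stationary_process M X"
begin

lemma X_measurable[measurable]: "X i \<in> borel_measurable M"
  using stationary by (auto simp: stationary_process_def)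

text \<open>Stated for Banach-valued functionals because it is applied both to real covariances and
  to complex exponentials.\<close>

lemma expectation_shift:
  fixes \<Phi> :: "(int \<Rightarrow> real) \<Rightarrow> 'b::{banach, second_countable_topology}"
  assumes [measurable]: "\<Phi> \<in> borel_measurable (Pi\<^sub>M UNIV (\<lambda>_. borel))"
  shows "expectation (\<lambda>\<omega>. \<Phi> (\<lambda>i. X (i + k) \<omega>)) = expectation (\<lambda>\<omega>. \<Phi> (\<lambda>i. X i \<omega>))"
proof -
  have m: "(\<lambda>\<omega> i. X (i + k) \<omega>) \<in> measurable M (Pi\<^sub>M UNIV (\<lambda>_. borel))" for k
    by (rule measurable_PiM_single') auto
  have "expectation (\<lambda>\<omega>. \<Phi> (\<lambda>i. X (i + k) \<omega>)) =
      integral\<^sup>L (distr M (Pi\<^sub>M UNIV (\<lambda>_. borel)) (\<lambda>\<omega> i. X (i + k) \<omega>)) \<Phi>"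
    using m by (simp add: integral_distr)
  also have "\<dots> = integral\<^sup>L (distr M (Pi\<^sub>M UNIV (\<lambda>_. borel)) (\<lambda>\<omega> i. X i \<omega>)) \<Phi>"
    using stationary by (simp add: stationary_process_def)
  also have "\<dots> = expectation (\<lambda>\<omega>. \<Phi> (\<lambda>i. X i \<omega>))"
    using m[of 0] by (simp add: integral_distr)
  finally show ?thesis .
qed

lemma space_generated_sigma[simp]: "space (generated_sigma M X I) = space M"
  by (simp add: generated_sigma_def space_measure_of_conv)

lemma sets_generated_sigma:
  "sets (generated_sigma M X I) =
    sigma_sets (space M) {X i -` A \<inter> space M | i A. i \<in> I \<and> A \<in> sets borel}"
  unfolding generated_sigma_def by (rule sets_measure_of) auto

lemma generated_sigma_mono: "I \<subseteq> J \<Longrightarrow> sets (generated_sigma M X I) \<subseteq> sets (generated_sigma M X J)"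
  unfolding sets_generated_sigma by (rule sigma_sets_mono') auto

lemma sets_generated_sigma_subset: "sets (generated_sigma M X I) \<subseteq> sets M"
  unfolding sets_generated_sigma by (rule sets.sigma_sets_subset) auto

lemma borel_measurable_generated_sigma:
  "f \<in> borel_measurable (generated_sigma M X I) \<Longrightarrow> f \<in> borel_measurable M"
  using sets_generated_sigma_subset[of I] by (auto simp: measurable_def)

lemma borel_measurable_generated_sigma_nonempty:
  "borel_measurable (generated_sigma M X I) \<noteq> ({} :: ('a \<Rightarrow> real) set)"
  using measurable_const[of "0::real" borel "generated_sigma M X I"] by (metis UNIV_I empty_iff space_borel)

lemma X_measurable_generated_sigma: "i \<in> I \<Longrightarrow> X i \<in> borel_measurable (generated_sigma M X I)"
  by (rule measurableI) (auto simp: sets_generated_sigma intro!: sigma_sets.Basic)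

text \<open>A supremum of reals carries information only for sets bounded above; this bound supplies
  that for both nested suprema in the definition of the mixing coefficient.\<close>

lemma event_cov_le_1:
  "\<bar>measure M A - measure M B * measure M C\<bar> \<le> 1"
proof -
  have "0 \<le> measure M B * measure M C" "measure M B * measure M C \<le> 1"
    by (simp_all add: mult_le_one)
  then show ?thesis using prob_le_1[of A] measure_nonneg[of M A] by linarith
qed

lemma alpha_coeff_ge:
  assumes "A \<in> sets borel" "B \<in> sets borel"
  shows "\<bar>measure M {\<omega> \<in> space M. S \<omega> \<in> A \<and> T \<omega> \<in> B}
         - measure M {\<omega> \<in> space M. S \<omega> \<in> A} * measure M {\<omega> \<in> space M. T \<omega> \<in> B}\<bar> \<le> alpha_coeff M S T"
  unfolding alpha_coeff_def
  by (rule cSUP_upper2[where x="(A, B)"]) (use assms in \<open>auto intro!: bdd_aboveI2[where M=1] event_cov_le_1\<close>)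

lemma alpha_coeff_le_1: "alpha_coeff M S T \<le> 1"
  unfolding alpha_coeff_def by (rule cSUP_least) (auto intro: event_cov_le_1)

lemma bdd_above_alpha_coeff: "bdd_above ((\<lambda>(S, T). alpha_coeff M S T) ` K)"
  by (auto intro!: bdd_aboveI2[where M=1] alpha_coeff_le_1)

lemma event_cov_le_alpha_mixing:
  fixes S T :: "'a \<Rightarrow> real"
  assumes "S \<in> borel_measurable (generated_sigma M X {..0})"
    "T \<in> borel_measurable (generated_sigma M X {int t..})"
    "A \<in> sets borel" "B \<in> sets borel"
  shows "\<bar>measure M {\<omega> \<in> space M. S \<omega> \<in> A \<and> T \<omega> \<in> B}
         - measure M {\<omega> \<in> space M. S \<omega> \<in> A} * measure M {\<omega> \<in> space M. T \<omega> \<in> B}\<bar> \<le> alpha_mixing M X t"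
proof -
  have "alpha_coeff M S T \<le> alpha_mixing M X t"
    unfolding alpha_mixing_def
    by (rule cSUP_upper2[where x="(S, T)"]) (use assms in \<open>auto intro: bdd_above_alpha_coeff\<close>)
  with alpha_coeff_ge[OF assms(3,4), of S T] show ?thesis by linarith
qed

lemma alpha_mixing_nonneg: "0 \<le> alpha_mixing M X t"
  by (rule order_trans[OF abs_ge_zero event_cov_le_alpha_mixing[of "\<lambda>_. 0" "\<lambda>_. 0" t "{}" "{}"]]) simp_all

lemma alpha_mixing_antimono:
  assumes "s \<le> t"
  shows "alpha_mixing M X t \<le> alpha_mixing M X s"
  unfolding alpha_mixing_def
proof (rule cSUP_subset_mono, goal_cases)
  case 1
  show ?case by (simp add: borel_measurable_generated_sigma_nonempty)
next
  case 3
  have "sets (generated_sigma M X {int t..}) \<subseteq> sets (generated_sigma M X {int s..})"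
    by (rule generated_sigma_mono) (use assms in auto)
  then show ?case by (auto simp: measurable_def)
qed (auto intro: bdd_above_alpha_coeff)

text \<open>The threshold \<open>k / N\<close> is passed exactly when \<open>k <= N * y\<close>.
  Divided by \<open>N\<close>, the count is a staircase approximation of \<open>y\<close> from
  below.\<close>

lemma sum_threshold_indicators:
  fixes y :: real
  assumes "0 \<le> y" "y \<le> 1" "N > 0"
  shows "(\<Sum>k=1..N. indicator {real k / real N..} y) = real (nat \<lfloor>real N * y\<rfloor>)"
proof -
  have le: "nat \<lfloor>real N * y\<rfloor> \<le> N"
    using assms by (simp add: nat_le_iff floor_le_iff) (metis assms(2) mult.right_neutral mult_left_mono of_nat_0_le_iff add.commute less_add_one order_le_less_trans)
  have "(\<Sum>k=1..N. indicator {real k / real N..} y) = (\<Sum>k=1..N. if k \<le> nat \<lfloor>real N * y\<rfloor> then 1 else (0::real))"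
  proof (rule sum.cong)
    fix k assume "k \<in> {1..N}"
    have "real k / real N \<le> y \<longleftrightarrow> real k \<le> real N * y"
      using assms by (simp add: divide_le_eq mult.commute)
    also have "\<dots> \<longleftrightarrow> k \<le> nat \<lfloor>real N * y\<rfloor>"
      using assms by (simp add: le_nat_iff le_floor_iff)
    finally show "indicator {real k / real N..} y = (if k \<le> nat \<lfloor>real N * y\<rfloor> then 1 else (0::real))"
      by (simp add: indicator_def)
  qed simp
  also have "\<dots> = real (card {k \<in> {1..N}. k \<le> nat \<lfloor>real N * y\<rfloor>})"
    by (simp add: sum.If_cases Int_def)
  also have "{k \<in> {1..N}. k \<le> nat \<lfloor>real N * y\<rfloor>} = {1..nat \<lfloor>real N * y\<rfloor>}"
    using le by auto
  finally show ?thesis by simp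
qed

lemma tendsto_floor_div:
  fixes y :: real
  assumes "0 \<le> y"
  shows "(\<lambda>N. real (nat \<lfloor>real (Suc N) * y\<rfloor>) / real (Suc N)) \<longlonglongrightarrow> y"
proof (rule tendsto_sandwich)
  have 1: "real (nat \<lfloor>real (Suc N) * y\<rfloor>) \<le> real (Suc N) * y" "real (Suc N) * y - 1 \<le> real (nat \<lfloor>real (Suc N) * y\<rfloor>)" for N
    using assms of_nat_floor[of "real (Suc N) * y"] floor_correct[of "real (Suc N) * y"]
    by (auto simp: of_nat_nat)
  show "\<forall>\<^sub>F N in sequentially. real (nat \<lfloor>real (Suc N) * y\<rfloor>) / real (Suc N) \<le> y"
    using 1(1) by (intro always_eventually allI) (simp add: divide_le_eq mult.commute del: of_nat_Suc)
  show "\<forall>\<^sub>F N in sequentially. y - 1 / real (Suc N) \<le> real (nat \<lfloor>real (Suc N) * y\<rfloor>) / real (Suc N)"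
    using 1(2) by (intro always_eventually allI) (simp add: le_divide_eq right_diff_distrib mult.commute del: of_nat_Suc)
  show "(\<lambda>N. y - 1 / real (Suc N)) \<longlonglongrightarrow> y"
    using tendsto_diff[OF tendsto_const LIMSEQ_inverse_real_of_nat] by (simp add: inverse_eq_divide)
qed simp

text \<open>A function with values in \<open>[0, 1]\<close> is the limit of the averages of its \<open>N\<close> threshold
  indicators, and the covariance of two such averages is an average of event covariances.\<close>

lemma cov_unit_le_alpha_mixing:
  assumes f: "f \<in> borel_measurable (generated_sigma M X {..0})"
    and g: "g \<in> borel_measurable (generated_sigma M X {int t..})"
    and f01: "\<And>\<omega>. 0 \<le> f \<omega> \<and> f \<omega> \<le> 1" and g01: "\<And>\<omega>. 0 \<le> g \<omega> \<and> g \<omega> \<le> 1"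
  shows "\<bar>expectation (\<lambda>\<omega>. f \<omega> * g \<omega>) - expectation f * expectation g\<bar> \<le> alpha_mixing M X t"
proof -
  have [measurable]: "f \<in> borel_measurable M" "g \<in> borel_measurable M"
    using f g borel_measurable_generated_sigma by blast+
  \<comment> \<open>\<open>Suc N\<close> thresholds, so that the average never divides by 0.\<close>
  define u where "u N y = (\<Sum>k=1..Suc N. indicator {real k / real (Suc N)..} y) / real (Suc N)" for N and y :: real
  have [measurable]: "u N \<in> borel_measurable borel" for N unfolding u_def[abs_def] by measurable
  have u_eq: "u N y = real (nat \<lfloor>real (Suc N) * y\<rfloor>) / real (Suc N)" if "0 \<le> y" "y \<le> 1" for N y
    unfolding u_def using sum_threshold_indicators[OF that, of "Suc N"] by simp
  have u_lim: "(\<lambda>N. u N y) \<longlonglongrightarrow> y" if "0 \<le> y" "y \<le> 1" for y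
    using tendsto_floor_div[OF that(1)] by (simp add: u_eq that)
  have u01: "0 \<le> u N y" "u N y \<le> 1" for N y
  proof -
    show "0 \<le> u N y" unfolding u_def by (simp add: sum_nonneg)
    have "(\<Sum>k=1..Suc N. indicator {real k / real (Suc N)..} y) \<le> (\<Sum>k=1..Suc N. 1 :: real)"
      by (rule sum_mono) (auto simp: indicator_def)
    then show "u N y \<le> 1" unfolding u_def by (simp add: divide_le_eq)
  qed
  have bnd: "\<bar>expectation (\<lambda>\<omega>. u N (f \<omega>) * u N (g \<omega>)) - expectation (\<lambda>\<omega>. u N (f \<omega>)) * expectation (\<lambda>\<omega>. u N (g \<omega>))\<bar>
      \<le> alpha_mixing M X t" for N
  proof -
    define n where "n = Suc N"
    define A where "A k = {real k / real n..}" for k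
    define F where "F k = {\<omega> \<in> space M. f \<omega> \<in> A k}" for k
    define G where "G k = {\<omega> \<in> space M. g \<omega> \<in> A k}" for k
    have [measurable, simp]: "A k \<in> sets borel" "F k \<in> sets M" "G k \<in> sets M" for k
      unfolding F_def G_def by (auto simp: A_def)
    have uf: "u N (f \<omega>) = (\<Sum>k=1..n. indicator (F k) \<omega>) / real n" if "\<omega> \<in> space M" for \<omega>
      unfolding u_def n_def[symmetric] using that by (auto simp: F_def A_def indicator_def intro!: arg_cong2[where f="(/)"] sum.cong)
    have ug: "u N (g \<omega>) = (\<Sum>k=1..n. indicator (G k) \<omega>) / real n" if "\<omega> \<in> space M" for \<omega>
      unfolding u_def n_def[symmetric] using that by (auto simp: G_def A_def indicator_def intro!: arg_cong2[where f="(/)"] sum.cong)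
    have ef: "expectation (\<lambda>\<omega>. u N (f \<omega>)) = (\<Sum>k=1..n. prob (F k)) / real n"
    proof -
      have "expectation (\<lambda>\<omega>. u N (f \<omega>)) = expectation (\<lambda>\<omega>. (\<Sum>k=1..n. indicator (F k) \<omega>) / real n)"
        by (rule Bochner_Integration.integral_cong) (auto simp: uf)
      then show ?thesis by (simp add: Bochner_Integration.integral_sum less_top[symmetric])
    qed
    have eg: "expectation (\<lambda>\<omega>. u N (g \<omega>)) = (\<Sum>k=1..n. prob (G k)) / real n"
    proof -
      have "expectation (\<lambda>\<omega>. u N (g \<omega>)) = expectation (\<lambda>\<omega>. (\<Sum>k=1..n. indicator (G k) \<omega>) / real n)"
        by (rule Bochner_Integration.integral_cong) (auto simp: ug)
      then show ?thesis by (simp add: Bochner_Integration.integral_sum less_top[symmetric])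
    qed
    have efg: "expectation (\<lambda>\<omega>. u N (f \<omega>) * u N (g \<omega>)) = (\<Sum>k=1..n. \<Sum>l=1..n. prob (F k \<inter> G l)) / (real n * real n)"
    proof -
      have "expectation (\<lambda>\<omega>. u N (f \<omega>) * u N (g \<omega>)) =
        expectation (\<lambda>\<omega>. (\<Sum>k=1..n. \<Sum>l=1..n. indicator (F k \<inter> G l) \<omega>) / (real n * real n))"
        by (rule Bochner_Integration.integral_cong)
           (auto simp: uf ug sum_product indicator_inter_arith)
      also have "\<dots> = (\<Sum>k=1..n. \<Sum>l=1..n. prob (F k \<inter> G l)) / (real n * real n)"
      proof -
        have i: "integrable M (indicator (F k \<inter> G l) :: 'a \<Rightarrow> real)" for k l
          by (intro integrable_real_indicator sets.Int) (simp_all add: less_top[symmetric])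
        have e: "expectation (indicator (F k \<inter> G l)) = prob (F k \<inter> G l)" for k l
          by simp
        show ?thesis
          unfolding integral_divide_zero
          by (subst Bochner_Integration.integral_sum, intro Bochner_Integration.integrable_sum i,
              subst Bochner_Integration.integral_sum, rule i) (simp only: e)
      qed
      finally show ?thesis .
    qed
    have "\<bar>expectation (\<lambda>\<omega>. u N (f \<omega>) * u N (g \<omega>)) - expectation (\<lambda>\<omega>. u N (f \<omega>)) * expectation (\<lambda>\<omega>. u N (g \<omega>))\<bar>
      = \<bar>\<Sum>k=1..n. \<Sum>l=1..n. prob (F k \<inter> G l) - prob (F k) * prob (G l)\<bar> / (real n * real n)"
      unfolding ef eg efg by (simp add: sum_product sum_subtractf diff_divide_distrib[symmetric])
    also have "\<dots> \<le> (\<Sum>k=1..n. \<Sum>l=1..n. alpha_mixing M X t) / (real n * real n)"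
    proof (intro divide_right_mono order_trans[OF sum_abs] sum_mono)
      fix k l
      have "F k \<inter> G l = {\<omega> \<in> space M. f \<omega> \<in> A k \<and> g \<omega> \<in> A l}" by (auto simp: F_def G_def)
      then show "\<bar>prob (F k \<inter> G l) - prob (F k) * prob (G l)\<bar> \<le> alpha_mixing M X t"
        using event_cov_le_alpha_mixing[OF f g, of "A k" "A l"] by (simp add: F_def G_def)
    qed auto
    also have "\<dots> = alpha_mixing M X t" by (simp add: n_def)
    finally show ?thesis .
  qed
  \<comment> \<open>One dominated convergence argument for three limits: \<open>h\<close> selects
    the product, the first factor or the second factor.\<close>
  have lim: "(\<lambda>N. expectation (\<lambda>\<omega>. h (u N (f \<omega>)) (u N (g \<omega>)))) \<longlonglongrightarrow> expectation (\<lambda>\<omega>. h (f \<omega>) (g \<omega>))"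
    if h: "h = (\<lambda>a b. a * b) \<or> h = (\<lambda>a b. a) \<or> h = (\<lambda>a b. b)" for h :: "real \<Rightarrow> real \<Rightarrow> real"
  proof (rule integral_dominated_convergence[where w="\<lambda>_. 1"])
    show "AE \<omega> in M. (\<lambda>N. h (u N (f \<omega>)) (u N (g \<omega>))) \<longlonglongrightarrow> h (f \<omega>) (g \<omega>)"
      using h f01 g01 by (auto intro!: tendsto_intros u_lim)
    show "AE \<omega> in M. norm (h (u N (f \<omega>)) (u N (g \<omega>))) \<le> 1" for N
      using h u01 by (auto simp: abs_mult mult_le_one)
    show "(\<lambda>\<omega>. h (f \<omega>) (g \<omega>)) \<in> borel_measurable M" using h by auto
    show "(\<lambda>\<omega>. h (u N (f \<omega>)) (u N (g \<omega>))) \<in> borel_measurable M" for N using h by auto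
  qed simp
  have "(\<lambda>N. \<bar>expectation (\<lambda>\<omega>. u N (f \<omega>) * u N (g \<omega>)) - expectation (\<lambda>\<omega>. u N (f \<omega>)) * expectation (\<lambda>\<omega>. u N (g \<omega>))\<bar>)
    \<longlonglongrightarrow> \<bar>expectation (\<lambda>\<omega>. f \<omega> * g \<omega>) - expectation f * expectation g\<bar>"
    using lim[of "\<lambda>a b. a * b"] lim[of "\<lambda>a b. a"] lim[of "\<lambda>a b. b"]
    by (intro tendsto_intros) auto
  then show ?thesis by (rule LIMSEQ_le_const2) (use bnd in auto)
qed

text \<open>Affine rescaling of \<open>f\<close> and \<open>g\<close> to the unit interval divides
  by the ranges \<open>2 * C\<close> and \<open>2 * D\<close>; the covariance ignores the shifts and
  regains the factor \<open>4 * C * D\<close>.\<close>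

lemma cov_bounded_le_alpha_mixing:
  assumes f: "f \<in> borel_measurable (generated_sigma M X {..0})"
    and g: "g \<in> borel_measurable (generated_sigma M X {int t..})"
    and fC: "\<And>\<omega>. \<bar>f \<omega>\<bar> \<le> C" and gD: "\<And>\<omega>. \<bar>g \<omega>\<bar> \<le> D" and "C > 0" "D > 0"
  shows "\<bar>expectation (\<lambda>\<omega>. f \<omega> * g \<omega>) - expectation f * expectation g\<bar> \<le> 4 * C * D * alpha_mixing M X t"
proof -
  have [measurable]: "f \<in> borel_measurable M" "g \<in> borel_measurable M"
    using f g borel_measurable_generated_sigma by blast+
  have int: "integrable M f" "integrable M g" "integrable M (\<lambda>\<omega>. f \<omega> * g \<omega>)"
    by (rule integrable_const_bound[where B=C], simp_all add: fC,
        rule integrable_const_bound[where B=D], simp_all add: gD,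
        rule integrable_const_bound[where B="C * D"])
       (use mult_mono[OF fC gD] \<open>C > 0\<close> in \<open>simp_all add: abs_mult\<close>)
  define f' where "f' \<omega> = (f \<omega> + C) / (2 * C)" for \<omega>
  define g' where "g' \<omega> = (g \<omega> + D) / (2 * D)" for \<omega>
  have le: "\<bar>expectation (\<lambda>\<omega>. f' \<omega> * g' \<omega>) - expectation f' * expectation g'\<bar> \<le> alpha_mixing M X t"
  proof (rule cov_unit_le_alpha_mixing)
    show "f' \<in> borel_measurable (generated_sigma M X {..0})" using f unfolding f'_def[abs_def] by measurable
    show "g' \<in> borel_measurable (generated_sigma M X {int t..})" using g unfolding g'_def[abs_def] by measurable
    show "0 \<le> f' \<omega> \<and> f' \<omega> \<le> 1" for \<omega> using fC[of \<omega>] \<open>C > 0\<close> by (auto simp: f'_def divide_le_eq)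
    show "0 \<le> g' \<omega> \<and> g' \<omega> \<le> 1" for \<omega> using gD[of \<omega>] \<open>D > 0\<close> by (auto simp: g'_def divide_le_eq)
  qed
  have e1: "expectation f' = (expectation f + C) / (2 * C)" "expectation g' = (expectation g + D) / (2 * D)"
    unfolding f'_def[abs_def] g'_def[abs_def] using int by (simp_all add: prob_space)
  have e2: "expectation (\<lambda>\<omega>. f' \<omega> * g' \<omega>) =
      (expectation (\<lambda>\<omega>. f \<omega> * g \<omega>) + D * expectation f + C * expectation g + C * D) / (4 * C * D)"
  proof -
    have "(\<lambda>\<omega>. f' \<omega> * g' \<omega>) = (\<lambda>\<omega>. (f \<omega> * g \<omega> + D * f \<omega> + C * g \<omega> + C * D) / (4 * C * D))"
      using \<open>C > 0\<close> \<open>D > 0\<close> by (auto simp: f'_def g'_def field_simps)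
    then show ?thesis using int by (simp add: prob_space)
  qed
  have eq: "expectation (\<lambda>\<omega>. f \<omega> * g \<omega>) - expectation f * expectation g =
      4 * C * D * (expectation (\<lambda>\<omega>. f' \<omega> * g' \<omega>) - expectation f' * expectation g')"
    unfolding e1 e2 using \<open>C > 0\<close> \<open>D > 0\<close> by (simp add: field_simps)
  show ?thesis
    unfolding eq abs_mult[of "4 * C * D"] using le \<open>C > 0\<close> \<open>D > 0\<close> by simp
qed

text \<open>The mixing coefficient separates past and future at time 0 only. Shifting the process by
  \<open>- a\<close> moves \<open>I\<close> into the past \<open>{..0}\<close> and \<open>J\<close>
  into \<open>{int t..}\<close>, and stationarity preserves all three expectations.\<close>

lemma cov_blocks_le_alpha_mixing:
  fixes \<phi> \<psi> h k :: "real \<Rightarrow> real"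
  assumes [measurable]: "\<phi> \<in> borel_measurable borel" "\<psi> \<in> borel_measurable borel"
      "h \<in> borel_measurable borel" "k \<in> borel_measurable borel"
    and IJ: "I \<subseteq> {..a}" "J \<subseteq> {a + int t..}"
    and "\<And>x. \<bar>\<phi> x\<bar> \<le> C" "\<And>x. \<bar>\<psi> x\<bar> \<le> D" "C > 0" "D > 0"
  shows "\<bar>expectation (\<lambda>\<omega>. \<phi> (\<Sum>i\<in>I. h (X i \<omega>)) * \<psi> (\<Sum>i\<in>J. k (X i \<omega>)))
     - expectation (\<lambda>\<omega>. \<phi> (\<Sum>i\<in>I. h (X i \<omega>))) * expectation (\<lambda>\<omega>. \<psi> (\<Sum>i\<in>J. k (X i \<omega>)))\<bar>
     \<le> 4 * C * D * alpha_mixing M X t"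
proof -
  let ?f = "\<lambda>x. \<phi> (\<Sum>i\<in>I. h (x i))" and ?g = "\<lambda>x. \<psi> (\<Sum>i\<in>J. k (x i))"
  have "\<bar>expectation (\<lambda>\<omega>. ?f (\<lambda>i. X (i + - a) \<omega>) * ?g (\<lambda>i. X (i + - a) \<omega>))
     - expectation (\<lambda>\<omega>. ?f (\<lambda>i. X (i + - a) \<omega>)) * expectation (\<lambda>\<omega>. ?g (\<lambda>i. X (i + - a) \<omega>))\<bar>
     \<le> 4 * C * D * alpha_mixing M X t"
  proof (rule cov_bounded_le_alpha_mixing)
    have [measurable]: "X (i + - a) \<in> borel_measurable (generated_sigma M X {..0})" if "i \<in> I" for i
      using that IJ by (intro X_measurable_generated_sigma) auto
    show "(\<lambda>\<omega>. ?f (\<lambda>i. X (i + - a) \<omega>)) \<in> borel_measurable (generated_sigma M X {..0})"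
      by (intro measurable_compose[OF borel_measurable_sum assms(1)] measurable_compose[OF _ assms(3)]) measurable
    have [measurable]: "X (i + - a) \<in> borel_measurable (generated_sigma M X {int t..})" if "i \<in> J" for i
      using that IJ by (intro X_measurable_generated_sigma) auto
    show "(\<lambda>\<omega>. ?g (\<lambda>i. X (i + - a) \<omega>)) \<in> borel_measurable (generated_sigma M X {int t..})"
      by (intro measurable_compose[OF borel_measurable_sum assms(2)] measurable_compose[OF _ assms(4)]) measurable
  qed (use assms in auto)
  then show ?thesis
    using expectation_shift[of "\<lambda>x. ?f x * ?g x" "- a"] expectation_shift[of ?f "- a"] expectation_shift[of ?g "- a"]
    by simp
qed

end

section \<open>Averages, sums over distances, and second moments of partial sums\<close>

lemma tendsto_cesaro_zero:
  fixes d :: "nat \<Rightarrow> real"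
  assumes "d \<longlonglongrightarrow> 0"
  shows "(\<lambda>n. (\<Sum>m<n. d m) / real n) \<longlonglongrightarrow> 0"
proof (rule LIMSEQ_I)
  fix e :: real assume e: "e > 0"
  obtain N where N: "\<And>m. m \<ge> N \<Longrightarrow> \<bar>d m\<bar> < e / 2"
    using LIMSEQ_D[OF assms, of "e / 2"] e by auto
  define B where "B = (\<Sum>m<N. \<bar>d m\<bar>)"
  have "\<bar>(\<Sum>m<n. d m) / real n\<bar> < e" if n: "n \<ge> max N (Suc (nat \<lceil>2 * B / e\<rceil>))" for n
  proof -
    have n0: "n > 0" "n \<ge> N" using n by auto
    have "2 * B / e < real n" using n by linarith
    then have B: "B < real n * e / 2" using e by (simp add: field_simps)
    have "\<bar>\<Sum>m<n. d m\<bar> \<le> (\<Sum>m<n. \<bar>d m\<bar>)" by (rule sum_abs)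
    also have "\<dots> = B + (\<Sum>m=N..<n. \<bar>d m\<bar>)"
      unfolding B_def using n0 by (simp add: lessThan_atLeast0 sum.atLeastLessThan_concat)
    also have "\<dots> \<le> B + (\<Sum>m=N..<n. e / 2)"
      by (intro add_left_mono sum_mono) (use N in \<open>auto intro: less_imp_le\<close>)
    also have "\<dots> \<le> B + real n * (e / 2)" using e by simp
    also have "\<dots> < real n * e" using B by simp
    finally show ?thesis using n0 by (simp add: divide_less_eq mult.commute)
  qed
  then show "\<exists>no. \<forall>n\<ge>no. norm ((\<Sum>m<n. d m) / real n - 0) < e"
    by (intro exI[of _ "max N (Suc (nat \<lceil>2 * B / e\<rceil>))"]) simp
qed

lemma tendsto_cesaro:
  fixes b :: "nat \<Rightarrow> real"
  assumes "b \<longlonglongrightarrow> v"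
  shows "(\<lambda>n. (\<Sum>m<n. b m) / real n) \<longlonglongrightarrow> v"
proof -
  have "(\<lambda>n. (\<Sum>m<n. b m - v) / real n) \<longlonglongrightarrow> 0"
    by (rule tendsto_cesaro_zero) (use assms in \<open>simp add: LIM_zero\<close>)
  then have "(\<lambda>n. (\<Sum>m<n. b m - v) / real n + v) \<longlonglongrightarrow> 0 + v" by (intro tendsto_intros)
  moreover have "\<forall>\<^sub>F n in sequentially. (\<Sum>m<n. b m - v) / real n + v = (\<Sum>m<n. b m) / real n"
    using eventually_gt_at_top[of 0]
    by eventually_elim (simp add: sum_subtractf field_simps)
  ultimately show ?thesis by (simp cong: filterlim_cong)
qed

text \<open>A given distance from \<open>i\<close> occurs at most once on each side of
  \<open>i\<close>, hence the factor 2.\<close>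

lemma sum_dist_le_suminf:
  fixes d :: "nat \<Rightarrow> real"
  assumes "finite I" "\<And>j. d j \<ge> 0" "summable d"
  shows "(\<Sum>k\<in>I. d (nat \<bar>i - k\<bar>)) \<le> 2 * suminf d"
proof -
  have half: "(\<Sum>k\<in>{k\<in>I. P k}. d (nat \<bar>i - k\<bar>)) \<le> suminf d"
    if "inj_on (\<lambda>k. nat \<bar>i - k\<bar>) {k\<in>I. P k}" for P
  proof -
    have "(\<Sum>k\<in>{k\<in>I. P k}. d (nat \<bar>i - k\<bar>)) = sum d ((\<lambda>k. nat \<bar>i - k\<bar>) ` {k\<in>I. P k})"
      using that by (simp add: sum.reindex)
    also have "\<dots> \<le> suminf d" by (rule sum_le_suminf) (use assms in auto)
    finally show ?thesis .
  qed
  have "(\<Sum>k\<in>I. d (nat \<bar>i - k\<bar>)) = (\<Sum>k\<in>{k\<in>I. k \<le> i}. d (nat \<bar>i - k\<bar>)) + (\<Sum>k\<in>{k\<in>I. \<not> k \<le> i}. d (nat \<bar>i - k\<bar>))"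
    using assms(1) by (subst sum.union_disjoint[symmetric]) (auto intro!: sum.cong)
  also have "\<dots> \<le> suminf d + suminf d"
    by (intro add_mono half) (auto simp: inj_on_def)
  finally show ?thesis by simp
qed

lemma (in prob_space) integrable_sq_mult:
  fixes f g :: "'a \<Rightarrow> real"
  assumes [measurable]: "f \<in> borel_measurable M" "g \<in> borel_measurable M"
    and "integrable M (\<lambda>\<omega>. (f \<omega>)\<^sup>2)" "integrable M (\<lambda>\<omega>. (g \<omega>)\<^sup>2)"
  shows "integrable M (\<lambda>\<omega>. f \<omega> * g \<omega>)"
proof (rule Bochner_Integration.integrable_bound[of M "\<lambda>\<omega>. (f \<omega>)\<^sup>2 + (g \<omega>)\<^sup>2"])
  have "\<bar>a * b\<bar> \<le> a\<^sup>2 + b\<^sup>2" for a b :: real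
    using sum_squares_bound[of "\<bar>a\<bar>" "\<bar>b\<bar>"] mult_nonneg_nonneg[of "\<bar>a\<bar>" "\<bar>b\<bar>"]
    unfolding abs_mult power2_abs by linarith
  then show "AE \<omega> in M. norm (f \<omega> * g \<omega>) \<le> norm ((f \<omega>)\<^sup>2 + (g \<omega>)\<^sup>2)" by simp
qed (use assms in auto)

lemma (in prob_space) integrable_of_sq:
  fixes f :: "'a \<Rightarrow> real"
  assumes "f \<in> borel_measurable M" "integrable M (\<lambda>\<omega>. (f \<omega>)\<^sup>2)"
  shows "integrable M f"
  using integrable_sq_mult[OF assms(1) _ assms(2), of "\<lambda>_. 1"] by simp

context stationary_mixing
begin

lemma distr_X: "distr M borel (X i) = distr M borel (X 0)"
proof (rule measure_eqI)
  fix A assume "A \<in> sets (distr M borel (X i))"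
  then have [measurable]: "A \<in> sets borel" by simp
  have "expectation (\<lambda>\<omega>. indicator A (X i \<omega>) :: real) = expectation (\<lambda>\<omega>. indicator A (X 0 \<omega>))"
    using expectation_shift[of "\<lambda>x. indicator A (x 0)" i] by simp
  then show "emeasure (distr M borel (X i)) A = emeasure (distr M borel (X 0)) A"
    by (simp add: emeasure_distr emeasure_eq_measure indicator_vimage[symmetric])
qed simp

lemma integrable_X_iff:
  fixes \<phi> :: "real \<Rightarrow> real"
  assumes [measurable]: "\<phi> \<in> borel_measurable borel"
  shows "integrable M (\<lambda>\<omega>. \<phi> (X i \<omega>)) \<longleftrightarrow> integrable M (\<lambda>\<omega>. \<phi> (X 0 \<omega>))"
  using integrable_distr_eq[of "X i" M borel \<phi>] integrable_distr_eq[of "X 0" M borel \<phi>]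
  by (simp add: distr_X[of i])

lemma expectation_X:
  fixes \<phi> :: "real \<Rightarrow> real"
  assumes [measurable]: "\<phi> \<in> borel_measurable borel"
  shows "expectation (\<lambda>\<omega>. \<phi> (X i \<omega>)) = expectation (\<lambda>\<omega>. \<phi> (X 0 \<omega>))"
  using integral_distr[of "X i" M borel \<phi>] integral_distr[of "X 0" M borel \<phi>]
  by (simp add: distr_X[of i])

text \<open>The function \<open>h\<close> is a parameter so that the variables themselves, their
  truncations and the remainders fall under the same results. By stationarity the mean at lag
  \<open>j\<close> equals the mean at 0.\<close>

definition autocov :: "(real \<Rightarrow> real) \<Rightarrow> nat \<Rightarrow> real" where
  "autocov h j = expectation (\<lambda>\<omega>. h (X 0 \<omega>) * h (X (int j) \<omega>)) - (expectation (\<lambda>\<omega>. h (X 0 \<omega>)))\<^sup>2"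

lemma autocov_shift:
  assumes [measurable]: "h \<in> borel_measurable borel"
  shows "expectation (\<lambda>\<omega>. h (X i \<omega>) * h (X k \<omega>)) = autocov h (nat \<bar>i - k\<bar>) + (expectation (\<lambda>\<omega>. h (X 0 \<omega>)))\<^sup>2"
proof -
  have *: "expectation (\<lambda>\<omega>. h (X i \<omega>) * h (X k \<omega>)) = expectation (\<lambda>\<omega>. h (X 0 \<omega>) * h (X (k - i) \<omega>))" for i k
    using expectation_shift[of "\<lambda>x. h (x 0) * h (x (k - i))" i] by simp
  show ?thesis
  proof (cases "i \<le> k")
    case True
    then show ?thesis using *[of i k] by (simp add: autocov_def)
  next
    case False
    have "expectation (\<lambda>\<omega>. h (X i \<omega>) * h (X k \<omega>)) = expectation (\<lambda>\<omega>. h (X 0 \<omega>) * h (X (i - k) \<omega>))"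
      using *[of k i] by (subst mult.commute) simp
    with False show ?thesis by (simp add: autocov_def)
  qed
qed

lemma second_moment_sum:
  assumes [measurable]: "h \<in> borel_measurable borel"
    and sq: "integrable M (\<lambda>\<omega>. (h (X 0 \<omega>))\<^sup>2)"
    and m: "m = expectation (\<lambda>\<omega>. h (X 0 \<omega>))"
    and I: "finite I"
  shows "integrable M (\<lambda>\<omega>. (\<Sum>i\<in>I. h (X i \<omega>) - m)\<^sup>2)"
    "expectation (\<lambda>\<omega>. (\<Sum>i\<in>I. h (X i \<omega>) - m)\<^sup>2) = (\<Sum>i\<in>I. \<Sum>k\<in>I. autocov h (nat \<bar>i - k\<bar>))"
proof -
  have sq': "integrable M (\<lambda>\<omega>. (h (X i \<omega>))\<^sup>2)" for i
    using integrable_X_iff[of "\<lambda>x. (h x)\<^sup>2" i] sq by simp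
  have int: "integrable M (\<lambda>\<omega>. h (X i \<omega>))" for i
    by (rule integrable_of_sq[OF _ sq']) simp
  have prod: "integrable M (\<lambda>\<omega>. h (X i \<omega>) * h (X k \<omega>))" for i k
    by (rule integrable_sq_mult[OF _ _ sq' sq']) simp_all
  have eq: "(h (X i \<omega>) - m) * (h (X k \<omega>) - m) = h (X i \<omega>) * h (X k \<omega>) - m * h (X i \<omega>) - m * h (X k \<omega>) + m\<^sup>2" for i k \<omega>
    by (simp add: algebra_simps power2_eq_square)
  have int2: "integrable M (\<lambda>\<omega>. (h (X i \<omega>) - m) * (h (X k \<omega>) - m))" for i k
    unfolding eq using prod int by simp
  have mi: "expectation (\<lambda>\<omega>. h (X i \<omega>)) = m" for i using expectation_X[of h i] m by simp
  have e2: "expectation (\<lambda>\<omega>. (h (X i \<omega>) - m) * (h (X k \<omega>) - m)) = autocov h (nat \<bar>i - k\<bar>)" for i k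
    unfolding eq using prod int autocov_shift[of h i k]
    by (simp add: mi prob_space m[symmetric]) (simp add: power2_eq_square)
  have sqe: "(\<Sum>i\<in>I. h (X i \<omega>) - m)\<^sup>2 = (\<Sum>i\<in>I. \<Sum>k\<in>I. (h (X i \<omega>) - m) * (h (X k \<omega>) - m))" for \<omega>
    by (simp add: power2_eq_square sum_product)
  show "integrable M (\<lambda>\<omega>. (\<Sum>i\<in>I. h (X i \<omega>) - m)\<^sup>2)"
    unfolding sqe by (intro Bochner_Integration.integrable_sum int2)
  show "expectation (\<lambda>\<omega>. (\<Sum>i\<in>I. h (X i \<omega>) - m)\<^sup>2) = (\<Sum>i\<in>I. \<Sum>k\<in>I. autocov h (nat \<bar>i - k\<bar>))"
    unfolding sqe by (simp add: Bochner_Integration.integral_sum int2 e2)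
qed

text \<open>The bound is linear in the cardinality for any finite index set, not only for intervals:
  it is later applied to the indices left over between blocks.\<close>

lemma second_moment_sum_le:
  assumes "h \<in> borel_measurable borel" "integrable M (\<lambda>\<omega>. (h (X 0 \<omega>))\<^sup>2)"
    and "m = expectation (\<lambda>\<omega>. h (X 0 \<omega>))" "finite I" "summable (\<lambda>j. \<bar>autocov h j\<bar>)"
  shows "expectation (\<lambda>\<omega>. (\<Sum>i\<in>I. h (X i \<omega>) - m)\<^sup>2) \<le> real (card I) * (2 * (\<Sum>j. \<bar>autocov h j\<bar>))"
proof -
  have "(\<Sum>i\<in>I. \<Sum>k\<in>I. autocov h (nat \<bar>i - k\<bar>)) \<le> (\<Sum>i\<in>I. \<Sum>k\<in>I. \<bar>autocov h (nat \<bar>i - k\<bar>)\<bar>)"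
    by (intro sum_mono) auto
  also have "\<dots> \<le> (\<Sum>i\<in>I. 2 * (\<Sum>j. \<bar>autocov h j\<bar>))"
    by (rule sum_mono) (rule sum_dist_le_suminf[of I "\<lambda>j. \<bar>autocov h j\<bar>"], use assms in auto)
  finally show ?thesis unfolding second_moment_sum(2)[OF assms(1-4)] by simp
qed

text \<open>The increments of the second moment in \<open>n\<close> converge, so the quotient by
  \<open>n\<close> converges by Cesaro. The limit is the long-run variance, twice the sum of the
  autocovariances minus the one at lag 0.\<close>

lemma second_moment_sum_tendsto:
  assumes "h \<in> borel_measurable borel" "integrable M (\<lambda>\<omega>. (h (X 0 \<omega>))\<^sup>2)"
    and "m = expectation (\<lambda>\<omega>. h (X 0 \<omega>))" "summable (\<lambda>j. \<bar>autocov h j\<bar>)"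
  shows "\<exists>v\<ge>0. (\<lambda>n. expectation (\<lambda>\<omega>. (\<Sum>i=1..int n. h (X i \<omega>) - m)\<^sup>2) / real n) \<longlonglongrightarrow> v"
proof -
  define c where "c = autocov h"
  define A where "A n = (\<Sum>i=1..int n. \<Sum>k=1..int n. c (nat \<bar>i - k\<bar>))" for n
  define b where "b n = 2 * (\<Sum>j\<le>n. c j) - c 0" for n
  \<comment> \<open>The new index contributes one diagonal term \<open>c 0\<close> and each of the
    lags 1 to \<open>n\<close> twice, which is \<open>b n\<close> because its sum starts at lag
    0.\<close>
  have step: "A (Suc n) = A n + b n" for n
  proof -
    have ins: "{1..int (Suc n)} = insert (int (Suc n)) {1..int n}" by auto
    have s1: "(\<Sum>k=1..int n. c (nat \<bar>int (Suc n) - k\<bar>)) = (\<Sum>j=1..n. c j)"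
      by (rule sum.reindex_bij_witness[where i="\<lambda>j. int (Suc n) - int j" and j="\<lambda>k. nat (int (Suc n) - k)"]) auto
    have s2: "(\<Sum>j\<le>n. c j) = c 0 + (\<Sum>j=1..n. c j)"
      by (simp add: atMost_atLeast0 sum.atLeast_Suc_atMost)
    have "A (Suc n) = c 0 + (\<Sum>k=1..int n. c (nat \<bar>int (Suc n) - k\<bar>)) +
        (\<Sum>i=1..int n. c (nat \<bar>i - int (Suc n)\<bar>) + (\<Sum>k=1..int n. c (nat \<bar>i - k\<bar>)))"
      unfolding A_def ins by (subst sum.insert; simp)
    also have "(\<Sum>i=1..int n. c (nat \<bar>i - int (Suc n)\<bar>) + (\<Sum>k=1..int n. c (nat \<bar>i - k\<bar>)))
        = (\<Sum>k=1..int n. c (nat \<bar>int (Suc n) - k\<bar>)) + A n"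
      unfolding sum.distrib A_def by (simp add: abs_minus_commute)
    finally show ?thesis unfolding s1 b_def s2 by simp
  qed
  have A: "A n = (\<Sum>m<n. b m)" for n
    by (induction n) (simp add: A_def, simp add: step)
  have sm: "summable c" using assms(4) unfolding c_def by (rule summable_rabs_cancel)
  have "b \<longlonglongrightarrow> 2 * suminf c - c 0"
    unfolding b_def[abs_def] by (intro tendsto_intros summable_LIMSEQ' sm)
  then have lim: "(\<lambda>n. A n / real n) \<longlonglongrightarrow> 2 * suminf c - c 0"
    unfolding A by (rule tendsto_cesaro)
  have eq: "A n = expectation (\<lambda>\<omega>. (\<Sum>i=1..int n. h (X i \<omega>) - m)\<^sup>2)" for n
    unfolding A_def c_def by (rule second_moment_sum(2)[symmetric]) (use assms in auto)
  have "0 \<le> A n / real n" for n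
    unfolding eq by (intro divide_nonneg_nonneg Bochner_Integration.integral_nonneg) auto
  then have "0 \<le> 2 * suminf c - c 0" by (intro LIMSEQ_le_const[OF lim]) auto
  with lim show ?thesis unfolding eq by blast
qed

text \<open>Large values become 0 rather than being clipped to the level. The remainder is then
  either 0 or the full value, which exceeds \<open>T\<close> in modulus, and the tail estimates
  below rest on this alternative.\<close>

definition trunc :: "real \<Rightarrow> real \<Rightarrow> real" where
  "trunc T x = (if \<bar>x\<bar> \<le> T then x else 0)"

lemma trunc_measurable[measurable]: "trunc T \<in> borel_measurable borel"
  unfolding trunc_def[abs_def] by measurable

text \<open>Davydov's inequality. The truncation level \<open>T = a powr (- 1 / (2 + \<delta>))\<close> balances the
  contribution \<open>T\<^sup>2 a\<close> of the bounded parts against the tail contributions \<open>T powr (- \<delta>)\<close>.\<close>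

lemma autocov_mixing_bound:
  assumes [measurable]: "h \<in> borel_measurable borel"
    and \<delta>: "\<delta> > 0"
    and mom: "integrable M (\<lambda>\<omega>. \<bar>h (X 0 \<omega>)\<bar> powr (2 + \<delta>))"
    and K: "expectation (\<lambda>\<omega>. \<bar>h (X 0 \<omega>)\<bar> powr (2 + \<delta>)) \<le> K"
    and a: "a > 0" "alpha_mixing M X j \<le> a"
  shows "\<bar>autocov h j\<bar> \<le> (4 + 6 * K) * a powr (\<delta> / (2 + \<delta>))"
proof -
  define \<theta> where "\<theta> = \<delta> / (2 + \<delta>)"
  \<comment> \<open>The level is built from a positive upper bound \<open>a\<close> instead of the
    mixing coefficient itself: the coefficient may be 0, and \<open>powr\<close> would then return
    the level 0.\<close>
  define T where "T = a powr (- 1 / (2 + \<delta>))"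
  have T: "T > 0" using a by (simp add: T_def)
  have T2: "T\<^sup>2 * a = a powr \<theta>"
  proof -
    have "T\<^sup>2 * a = a powr (- 2 / (2 + \<delta>)) * a powr 1"
      unfolding T_def using a by (simp add: powr_power)
    also have "\<dots> = a powr (- 2 / (2 + \<delta>) + 1)" by (rule powr_add[symmetric])
    also have "- 2 / (2 + \<delta>) + 1 = \<theta>" using \<delta> by (simp add: \<theta>_def field_simps)
    finally show ?thesis .
  qed
  have Td: "T powr (- \<delta>) = a powr \<theta>"
    unfolding T_def powr_powr \<theta>_def by simp
  define Y where "Y i \<omega> = trunc T (h (X i \<omega>))" for i \<omega>
  define R where "R i \<omega> = h (X i \<omega>) - Y i \<omega>" for i \<omega>
  define W where "W i \<omega> = \<bar>h (X i \<omega>)\<bar> powr (2 + \<delta>)" for i \<omega>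
  have [measurable]: "Y i \<in> borel_measurable M" "R i \<in> borel_measurable M" "W i \<in> borel_measurable M" for i
    unfolding Y_def R_def W_def by measurable
  have YT: "\<bar>Y i \<omega>\<bar> \<le> T" for i \<omega> using T by (auto simp: Y_def trunc_def)
  have W0: "W i \<omega> \<ge> 0" for i \<omega> by (simp add: W_def)
  have iW: "integrable M (W i)" for i
    using integrable_X_iff[of "\<lambda>x. \<bar>h x\<bar> powr (2 + \<delta>)" i] mom by (simp add: W_def[abs_def])
  have eW: "expectation (W i) \<le> K" for i
    using expectation_X[of "\<lambda>x. \<bar>h x\<bar> powr (2 + \<delta>)" i] K by (simp add: W_def[abs_def])
  \<comment> \<open>Above the level \<open>y / T\<close> exceeds 1, so lower powers of
    \<open>y\<close> can be raised to \<open>2 + \<delta>\<close> at the price of a negative power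
    of \<open>T\<close>.\<close>
  have big: "y \<le> T powr (- (1 + \<delta>)) * y powr (2 + \<delta>)" "y\<^sup>2 \<le> T powr (- \<delta>) * y powr (2 + \<delta>)" if y: "y > T" for y
  proof -
    have y0: "y > 0" using y T by simp
    have "1 \<le> (y / T) powr (1 + \<delta>)" "1 \<le> (y / T) powr \<delta>"
      using y T \<delta> by (auto intro!: ge_one_powr_ge_zero)
    then have 1: "T powr (1 + \<delta>) \<le> y powr (1 + \<delta>)" "T powr \<delta> \<le> y powr \<delta>"
      using T y0 by (auto simp: powr_divide)
    have "y powr (2 + \<delta>) = y * y powr (1 + \<delta>)" "y powr (2 + \<delta>) = y\<^sup>2 * y powr \<delta>"
      using y0 powr_add[of y 1 "1 + \<delta>"] powr_add[of y 2 \<delta>] by (simp_all add: powr_numeral)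
    note e = this
    show "y \<le> T powr (- (1 + \<delta>)) * y powr (2 + \<delta>)"
      using 1(1) T y0 unfolding powr_minus e(1) by (simp add: field_simps mult_left_mono)
    show "y\<^sup>2 \<le> T powr (- \<delta>) * y powr (2 + \<delta>)"
      using 1(2) T y0 unfolding powr_minus e(2) by (simp add: field_simps mult_left_mono)
  qed
  have R1: "\<bar>R i \<omega>\<bar> \<le> T powr (- (1 + \<delta>)) * W i \<omega>" and R2: "(R i \<omega>)\<^sup>2 \<le> T powr (- \<delta>) * W i \<omega>" for i \<omega>
    using big[of "\<bar>h (X i \<omega>)\<bar>"] T by (auto simp: R_def Y_def trunc_def W_def)
  have iR2: "integrable M (\<lambda>\<omega>. (R i \<omega>)\<^sup>2)" for i
    by (rule Bochner_Integration.integrable_bound[of M "\<lambda>\<omega>. T powr (- \<delta>) * W i \<omega>"])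
       (use iW R2 W0 in auto)
  have iY2: "integrable M (\<lambda>\<omega>. (Y i \<omega>)\<^sup>2)" for i
    by (rule integrable_const_bound[where B="T\<^sup>2"]) (use YT in \<open>auto simp: abs_le_square_iff[symmetric] T less_imp_le\<close>)
  have iR: "integrable M (R i)" and iY: "integrable M (Y i)" for i
    by (rule integrable_of_sq[OF _ iR2], simp) (rule integrable_of_sq[OF _ iY2], simp)
  have iP: "integrable M (\<lambda>\<omega>. Y i \<omega> * Y k \<omega>)" "integrable M (\<lambda>\<omega>. Y i \<omega> * R k \<omega>)"
    "integrable M (\<lambda>\<omega>. R i \<omega> * Y k \<omega>)" "integrable M (\<lambda>\<omega>. R i \<omega> * R k \<omega>)" for i k
    by (intro integrable_sq_mult iR2 iY2; simp)+
  have eR1: "expectation (\<lambda>\<omega>. \<bar>R i \<omega>\<bar>) \<le> T powr (- (1 + \<delta>)) * K" for i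
  proof -
    have "expectation (\<lambda>\<omega>. \<bar>R i \<omega>\<bar>) \<le> expectation (\<lambda>\<omega>. T powr (- (1 + \<delta>)) * W i \<omega>)"
      using iR iW R1 by (intro integral_mono) auto
    also have "\<dots> \<le> T powr (- (1 + \<delta>)) * K" using eW by (simp add: mult_left_mono)
    finally show ?thesis .
  qed
  have eR2: "expectation (\<lambda>\<omega>. (R i \<omega>)\<^sup>2) \<le> T powr (- \<delta>) * K" for i
  proof -
    have "expectation (\<lambda>\<omega>. (R i \<omega>)\<^sup>2) \<le> expectation (\<lambda>\<omega>. T powr (- \<delta>) * W i \<omega>)"
      using iR2 iW R2 by (intro integral_mono) auto
    also have "\<dots> \<le> T powr (- \<delta>) * K" using eW by (simp add: mult_left_mono)
    finally show ?thesis .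
  qed
  \<comment> \<open>The common size of all error terms containing a remainder: with one bounded
    factor the bound is \<open>T\<close> times a first moment, with two remainders it is a second
    moment.\<close>
  define D where "D = T powr (- \<delta>) * K"
  have TD: "T * (T powr (- (1 + \<delta>)) * K) = D"
    using T powr_add[of T 1 "- (1 + \<delta>)"] by (simp add: D_def)
  have absR: "\<bar>expectation (R i)\<bar> \<le> T powr (- (1 + \<delta>)) * K" for i
    using eR1[of i] integral_abs_bound[of M "R i"] by linarith
  have absY: "\<bar>expectation (Y i)\<bar> \<le> T" for i
  proof -
    have "\<bar>expectation (Y i)\<bar> \<le> expectation (\<lambda>\<omega>. \<bar>Y i \<omega>\<bar>)" by (rule integral_abs_bound)
    also have "\<dots> \<le> expectation (\<lambda>_. T)" using iY YT by (intro integral_mono) auto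
    finally show ?thesis by (simp add: prob_space)
  qed
  have YR: "\<bar>expectation (\<lambda>\<omega>. Y i \<omega> * R k \<omega>)\<bar> \<le> D" for i k
  proof -
    have "\<bar>expectation (\<lambda>\<omega>. Y i \<omega> * R k \<omega>)\<bar> \<le> expectation (\<lambda>\<omega>. \<bar>Y i \<omega> * R k \<omega>\<bar>)" by (rule integral_abs_bound)
    also have "\<dots> \<le> expectation (\<lambda>\<omega>. T * \<bar>R k \<omega>\<bar>)"
      using iP(2) iR YT
      by (intro integral_mono integrable_abs integrable_mult_right) (auto simp: abs_mult mult_right_mono)
    also have "\<dots> \<le> T * (T powr (- (1 + \<delta>)) * K)" using eR1 T by (simp add: mult_left_mono)
    finally show ?thesis using TD by simp
  qed
  have YRp: "\<bar>expectation (Y i) * expectation (R k)\<bar> \<le> D" for i k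
    unfolding abs_mult TD[symmetric] using T by (intro mult_mono absY absR) auto
  have RR: "\<bar>expectation (\<lambda>\<omega>. R i \<omega> * R k \<omega>)\<bar> \<le> D" for i k
  proof -
    have "\<bar>expectation (\<lambda>\<omega>. R i \<omega> * R k \<omega>)\<bar> \<le> expectation (\<lambda>\<omega>. \<bar>R i \<omega> * R k \<omega>\<bar>)" by (rule integral_abs_bound)
    also have "\<dots> \<le> expectation (\<lambda>\<omega>. (R i \<omega>)\<^sup>2 / 2 + (R k \<omega>)\<^sup>2 / 2)"
    proof (rule integral_mono)
      show "\<bar>R i \<omega> * R k \<omega>\<bar> \<le> (R i \<omega>)\<^sup>2 / 2 + (R k \<omega>)\<^sup>2 / 2" for \<omega>
        using sum_squares_bound[of "\<bar>R i \<omega>\<bar>" "\<bar>R k \<omega>\<bar>"] by (simp add: abs_mult)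
    qed (use iP iR2 in auto)
    also have "\<dots> \<le> D" using eR2[of i] eR2[of k] iR2 by (simp add: D_def)
    finally show ?thesis .
  qed
  have RRp: "\<bar>expectation (R i) * expectation (R k)\<bar> \<le> D" for i k
  proof -
    \<comment> \<open>Jensen for the square, in the form of a nonnegative variance.\<close>
    have sq: "(expectation (R i))\<^sup>2 \<le> D" for i
    proof -
      have "0 \<le> variance (R i)" by (rule variance_positive)
      also have "variance (R i) = expectation (\<lambda>\<omega>. (R i \<omega>)\<^sup>2) - (expectation (R i))\<^sup>2"
        by (rule variance_eq[OF iR iR2])
      finally show ?thesis using eR2[of i] by (simp add: D_def)
    qed
    have "2 * (\<bar>expectation (R i)\<bar> * \<bar>expectation (R k)\<bar>) \<le> (expectation (R i))\<^sup>2 + (expectation (R k))\<^sup>2"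
      using sum_squares_bound[of "\<bar>expectation (R i)\<bar>" "\<bar>expectation (R k)\<bar>"] by simp
    with sq[of i] sq[of k] show ?thesis by (simp add: abs_mult)
  qed
  have YY: "\<bar>expectation (\<lambda>\<omega>. Y 0 \<omega> * Y j \<omega>) - expectation (Y 0) * expectation (Y j)\<bar> \<le> 4 * T * T * a"
  proof -
    have "\<bar>expectation (\<lambda>\<omega>. trunc T (\<Sum>i\<in>{0}. h (X i \<omega>)) * trunc T (\<Sum>i\<in>{int j}. h (X i \<omega>))) -
        expectation (\<lambda>\<omega>. trunc T (\<Sum>i\<in>{0}. h (X i \<omega>))) * expectation (\<lambda>\<omega>. trunc T (\<Sum>i\<in>{int j}. h (X i \<omega>)))\<bar>
        \<le> 4 * T * T * alpha_mixing M X j"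
      by (rule cov_blocks_le_alpha_mixing[where a=0]) (use T in \<open>auto simp: trunc_def\<close>)
    also have "\<dots> \<le> 4 * T * T * a" using a T by simp
    finally show ?thesis by (simp add: Y_def[abs_def])
  qed
  have hX: "h (X i \<omega>) = Y i \<omega> + R i \<omega>" for i \<omega> by (simp add: R_def)
  have e1: "expectation (\<lambda>\<omega>. h (X i \<omega>)) = expectation (Y i) + expectation (R i)" for i
    unfolding hX using iY iR by simp
  have e2: "expectation (\<lambda>\<omega>. h (X 0 \<omega>) * h (X (int j) \<omega>)) =
     expectation (\<lambda>\<omega>. Y 0 \<omega> * Y j \<omega>) + expectation (\<lambda>\<omega>. Y 0 \<omega> * R j \<omega>)
     + expectation (\<lambda>\<omega>. R 0 \<omega> * Y j \<omega>) + expectation (\<lambda>\<omega>. R 0 \<omega> * R j \<omega>)"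
    unfolding hX using iP by (simp add: ring_distribs)
  have sq: "(expectation (\<lambda>\<omega>. h (X 0 \<omega>)))\<^sup>2 = expectation (\<lambda>\<omega>. h (X 0 \<omega>)) * expectation (\<lambda>\<omega>. h (X (int j) \<omega>))"
    using expectation_X[of h "int j"] by (simp add: power2_eq_square)
  \<comment> \<open>Bilinear expansion: one covariance of bounded parts, at most
    \<open>4 * T * T * a\<close>, and six terms of size at most \<open>D\<close>. This is the origin
    of the constant \<open>4 + 6 * K\<close>.\<close>
  have "autocov h j = (expectation (\<lambda>\<omega>. Y 0 \<omega> * Y j \<omega>) - expectation (Y 0) * expectation (Y j))
    + expectation (\<lambda>\<omega>. Y 0 \<omega> * R j \<omega>) - expectation (Y 0) * expectation (R j)
    + expectation (\<lambda>\<omega>. R 0 \<omega> * Y j \<omega>) - expectation (Y j) * expectation (R 0)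
    + expectation (\<lambda>\<omega>. R 0 \<omega> * R j \<omega>) - expectation (R 0) * expectation (R j)"
    unfolding autocov_def sq e2 unfolding e1 by (simp add: algebra_simps)
  moreover have "\<bar>expectation (\<lambda>\<omega>. R 0 \<omega> * Y j \<omega>)\<bar> \<le> D"
    using YR[of j 0] by (simp add: mult.commute)
  ultimately have "\<bar>autocov h j\<bar> \<le> 4 * T * T * a + 6 * D"
    using YY YR[of 0 j] YRp[of 0 j] YRp[of j 0] RR[of 0 j] RRp[of 0 j] unfolding abs_le_iff by linarith
  also have "\<dots> = 4 * (T\<^sup>2 * a) + 6 * (a powr \<theta> * K)"
    unfolding D_def Td by (simp only: power2_eq_square mult.assoc)
  also have "\<dots> = (4 + 6 * K) * a powr \<theta>"
    unfolding T2 by (simp only: ring_distribs mult_ac)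
  finally show ?thesis by (simp add: \<theta>_def)
qed

end

text \<open>By monotonicity \<open>n * a n\<close> is at most twice the sum of \<open>a j\<close>
  over \<open>n div 2 < j <= n\<close>, a difference of two partial sums with the same
  limit.\<close>

lemma tendsto_mult_antimono_summable:
  fixes a :: "nat \<Rightarrow> real"
  assumes nn: "\<And>j. 0 \<le> a j" and anti: "\<And>i j. i \<le> j \<Longrightarrow> a j \<le> a i" and "summable a"
  shows "(\<lambda>n. real n * a n) \<longlonglongrightarrow> 0"
proof -
  define S where "S n = (\<Sum>j<n. a j)" for n
  have S: "S \<longlonglongrightarrow> suminf a" unfolding S_def[abs_def] by (rule summable_LIMSEQ[OF assms(3)])
  have half: "filterlim (\<lambda>n::nat. n div 2) at_top sequentially"
    by (rule filterlim_at_top_div_const_nat) simp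
  have "(\<lambda>n. 2 * (S (Suc n) - S (Suc (n div 2)))) \<longlonglongrightarrow> 2 * (suminf a - suminf a)"
    by (intro tendsto_intros LIMSEQ_Suc[OF S] filterlim_compose[OF LIMSEQ_Suc[OF S] half])
  then have lim: "(\<lambda>n. 2 * (S (Suc n) - S (Suc (n div 2)))) \<longlonglongrightarrow> 0" by simp
  show ?thesis
  proof (rule tendsto_sandwich[OF _ _ tendsto_const lim])
    show "\<forall>\<^sub>F n in sequentially. 0 \<le> real n * a n" using nn by simp
    have "real n * a n \<le> 2 * (S (Suc n) - S (Suc (n div 2)))" for n
    proof -
      have "S (Suc n) - S (Suc (n div 2)) = (\<Sum>j=Suc (n div 2)..<Suc n. a j)"
        unfolding S_def by (simp only: lessThan_atLeast0) (rule sum_diff_nat_ivl; simp)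
      also have "\<dots> \<ge> (\<Sum>j=Suc (n div 2)..<Suc n. a n)"
        by (rule sum_mono) (auto intro: anti)
      finally have 1: "real (n - n div 2) * a n \<le> S (Suc n) - S (Suc (n div 2))" by simp
      have "real n * a n \<le> 2 * real (n - n div 2) * a n"
        by (rule mult_right_mono[OF _ nn]) linarith
      also have "\<dots> = 2 * (real (n - n div 2) * a n)" by (rule mult.assoc)
      also have "\<dots> \<le> 2 * (S (Suc n) - S (Suc (n div 2)))" using 1 by (rule mult_left_mono) simp
      finally show ?thesis .
    qed
    then show "\<forall>\<^sub>F n in sequentially. real n * a n \<le> 2 * (S (Suc n) - S (Suc (n div 2)))" by simp
  qed
qed

section \<open>Characteristic functions of sums over blocks\<close>

lemma norm_iexp_diff_le: "norm (iexp a - iexp b) \<le> \<bar>a - b\<bar>"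
proof -
  have "iexp a - iexp b = iexp b * (iexp (a - b) - 1)"
    by (simp add: algebra_simps exp_diff)
  then have "norm (iexp a - iexp b) = norm (iexp (a - b) - 1)"
    by (simp only: norm_mult norm_exp_i_times mult_1_left)
  then show ?thesis using iexp_approx1[of "a - b" 0] by simp
qed

text \<open>The upper half comes from \<open>exp x >= 1 + x + x\<^sup>2 / 2\<close> and the identity
  \<open>(1 - x + x\<^sup>2 / 2) * (1 + x + x\<^sup>2 / 2) = 1 + x ^ 4 / 4\<close>, whose right side
  is at least 1.\<close>

lemma exp_minus_approx:
  assumes "0 \<le> (x::real)"
  shows "\<bar>exp (- x) - (1 - x)\<bar> \<le> x\<^sup>2 / 2"
proof -
  have "1 - x \<le> exp (- x)" using exp_ge_add_one_self[of "- x"] by simp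
  moreover have "exp (- x) \<le> 1 - x + x\<^sup>2 / 2"
  proof -
    have "1 + x + x\<^sup>2 / 2 \<le> exp x" by (rule exp_lower_Taylor_quadratic) (rule assms)
    moreover have "0 < 1 + x + x\<^sup>2 / 2" using assms by (simp add: add_pos_nonneg)
    ultimately have "exp (- x) \<le> 1 / (1 + x + x\<^sup>2 / 2)"
      unfolding exp_minus by (simp add: inverse_eq_divide frac_le)
    also have "\<dots> \<le> 1 - x + x\<^sup>2 / 2"
    proof -
      have "(1 - x + x\<^sup>2 / 2) * (1 + x + x\<^sup>2 / 2) = 1 + x ^ 4 / 4"
        by (simp add: power2_eq_square power4_eq_xxxx algebra_simps)
      then show ?thesis using \<open>0 < 1 + x + x\<^sup>2 / 2\<close> by (simp add: divide_le_eq)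
    qed
    finally show ?thesis .
  qed
  ultimately show ?thesis by linarith
qed

lemma exp_minus_lipschitz:
  assumes "0 \<le> (x::real)" "0 \<le> y"
  shows "\<bar>exp (- x) - exp (- y)\<bar> \<le> \<bar>x - y\<bar>"
proof -
  have *: "exp (- x) - exp (- y) \<le> y - x" if "x \<le> y" "0 \<le> x" for x y :: real
  proof -
    have "exp (- x) - exp (- y) = exp (- x) * (1 - exp (x - y))"
      by (simp add: algebra_simps flip: exp_add)
    also have "\<dots> \<le> 1 * (1 - exp (x - y))"
      using that by (intro mult_right_mono) auto
    also have "\<dots> \<le> y - x" using exp_ge_add_one_self[of "x - y"] unfolding mult_1_left by linarith
    finally show ?thesis .
  qed
  show ?thesis
  proof (cases "x \<le> y")
    case True
    then show ?thesis using *[OF True assms(1)] by simp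
  next
    case False
    then show ?thesis using *[of y x] assms(2) by simp
  qed
qed

context prob_space
begin

text \<open>Nonnegativity of the variance of \<open>|d|\<close>.\<close>

lemma expectation_abs_le_sqrt:
  fixes d :: "'a \<Rightarrow> real"
  assumes [measurable]: "d \<in> borel_measurable M" and sq: "integrable M (\<lambda>\<omega>. (d \<omega>)\<^sup>2)"
  shows "integrable M d" "expectation (\<lambda>\<omega>. \<bar>d \<omega>\<bar>) \<le> sqrt (expectation (\<lambda>\<omega>. (d \<omega>)\<^sup>2))"
proof -
  show i: "integrable M d"
  proof (rule Bochner_Integration.integrable_bound[of M "\<lambda>\<omega>. 1 + (d \<omega>)\<^sup>2"])
    have "\<bar>x\<bar> \<le> 1 + x\<^sup>2" for x :: real
      using zero_le_power2[of "\<bar>x\<bar> - 1 / 2"] by (simp add: power2_diff power_one_over)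
    then show "AE \<omega> in M. norm (d \<omega>) \<le> norm (1 + (d \<omega>)\<^sup>2)" by (simp add: abs_of_nonneg add_nonneg_nonneg)
  qed (use sq in auto)
  have "0 \<le> variance (\<lambda>\<omega>. \<bar>d \<omega>\<bar>)" by (rule variance_positive)
  also have "\<dots> = expectation (\<lambda>\<omega>. \<bar>d \<omega>\<bar>\<^sup>2) - (expectation (\<lambda>\<omega>. \<bar>d \<omega>\<bar>))\<^sup>2"
    by (rule variance_eq) (use i sq in auto)
  finally show "expectation (\<lambda>\<omega>. \<bar>d \<omega>\<bar>) \<le> sqrt (expectation (\<lambda>\<omega>. (d \<omega>)\<^sup>2))"
    by (intro real_le_rsqrt) simp
qed

lemma integrable_iexp_real:
  assumes [measurable]: "(f :: 'a \<Rightarrow> real) \<in> borel_measurable M"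
  shows "integrable M (\<lambda>\<omega>. iexp (f \<omega>))"
  by (rule integrable_const_bound[where B=1]) auto

lemma norm_expectation_iexp_le_1:
  assumes [measurable]: "(f :: 'a \<Rightarrow> real) \<in> borel_measurable M"
  shows "norm (expectation (\<lambda>\<omega>. iexp (f \<omega>))) \<le> 1"
proof -
  have "norm (expectation (\<lambda>\<omega>. iexp (f \<omega>))) \<le> expectation (\<lambda>\<omega>. norm (iexp (f \<omega>)))"
    by (rule integral_norm_bound)
  then show ?thesis by (simp add: prob_space)
qed

text \<open>Converts closeness in mean square into closeness of characteristic functions. It serves
  twice: to discard the gaps between blocks, and to replace the variables by truncations.\<close>

lemma char_diff_le:
  fixes f g :: "'a \<Rightarrow> real"
  assumes [measurable]: "f \<in> borel_measurable M" "g \<in> borel_measurable M"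
    and sq: "integrable M (\<lambda>\<omega>. (f \<omega> - g \<omega>)\<^sup>2)"
  shows "norm (expectation (\<lambda>\<omega>. iexp (s * f \<omega>)) - expectation (\<lambda>\<omega>. iexp (s * g \<omega>)))
    \<le> \<bar>s\<bar> * sqrt (expectation (\<lambda>\<omega>. (f \<omega> - g \<omega>)\<^sup>2))"
proof -
  note i = expectation_abs_le_sqrt[of "\<lambda>\<omega>. f \<omega> - g \<omega>", OF _ sq]
  have ie: "integrable M (\<lambda>\<omega>. iexp (s * f \<omega>))" "integrable M (\<lambda>\<omega>. iexp (s * g \<omega>))"
    by (rule integrable_iexp_real, simp)+
  have "norm (expectation (\<lambda>\<omega>. iexp (s * f \<omega>)) - expectation (\<lambda>\<omega>. iexp (s * g \<omega>)))
      = norm (expectation (\<lambda>\<omega>. iexp (s * f \<omega>) - iexp (s * g \<omega>)))"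
    using ie by simp
  also have "\<dots> \<le> expectation (\<lambda>\<omega>. norm (iexp (s * f \<omega>) - iexp (s * g \<omega>)))"
    by (rule integral_norm_bound)
  also have "\<dots> \<le> expectation (\<lambda>\<omega>. \<bar>s\<bar> * \<bar>f \<omega> - g \<omega>\<bar>)"
  proof (rule integral_mono)
    show "norm (iexp (s * f \<omega>) - iexp (s * g \<omega>)) \<le> \<bar>s\<bar> * \<bar>f \<omega> - g \<omega>\<bar>" for \<omega>
      using norm_iexp_diff_le[of "s * f \<omega>" "s * g \<omega>"] by (simp add: abs_mult right_diff_distrib[symmetric])
  qed (use ie i(1) in auto)
  also have "\<dots> = \<bar>s\<bar> * expectation (\<lambda>\<omega>. \<bar>f \<omega> - g \<omega>\<bar>)" by simp
  also have "\<dots> \<le> \<bar>s\<bar> * sqrt (expectation (\<lambda>\<omega>. (f \<omega> - g \<omega>)\<^sup>2))"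
    using i(2) by (intro mult_left_mono) auto
  finally show ?thesis .
qed

text \<open>Boundedness turns the cubic Taylor remainder into \<open>b\<close> times the second
  moment; this is the place that requires truncated variables. The second summand pays for replacing
  \<open>1 - x\<close> by \<open>exp (- x)\<close>.\<close>

lemma char_taylor_le:
  fixes U :: "'a \<Rightarrow> real"
  assumes [measurable]: "U \<in> borel_measurable M" and bd: "\<And>\<omega>. \<bar>U \<omega>\<bar> \<le> b" and mean: "expectation U = 0"
  shows "norm (expectation (\<lambda>\<omega>. iexp (s * U \<omega>)) - of_real (exp (- (s\<^sup>2 * expectation (\<lambda>\<omega>. (U \<omega>)\<^sup>2) / 2))))
    \<le> \<bar>s\<bar> ^ 3 * b * expectation (\<lambda>\<omega>. (U \<omega>)\<^sup>2) / 6 + (s\<^sup>2 * expectation (\<lambda>\<omega>. (U \<omega>)\<^sup>2) / 2)\<^sup>2 / 2"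
proof -
  define e2 where "e2 = expectation (\<lambda>\<omega>. (U \<omega>)\<^sup>2)"
  have e20: "e2 \<ge> 0" unfolding e2_def by (rule Bochner_Integration.integral_nonneg) simp
  have iU: "integrable M U" by (rule integrable_const_bound[where B=b]) (use bd in auto)
  have iU2: "integrable M (\<lambda>\<omega>. (U \<omega>)\<^sup>2)"
    by (rule integrable_const_bound[where B="b\<^sup>2"])
       (use bd in \<open>auto simp: abs_le_square_iff[symmetric] intro: order_trans[OF _ abs_ge_self]\<close>)
  have ie: "integrable M (\<lambda>\<omega>. iexp (s * U \<omega>))" by (rule integrable_iexp_real) simp
  define P where "P \<omega> = 1 + \<i> * of_real (s * U \<omega>) - of_real ((s * U \<omega>)\<^sup>2 / 2)" for \<omega>
  have P: "expectation P = of_real (1 - s\<^sup>2 * e2 / 2)" and iP: "integrable M P"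
  proof -
    have "integrable M (\<lambda>\<omega>. complex_of_real (s * U \<omega>))" "integrable M (\<lambda>\<omega>. complex_of_real ((s * U \<omega>)\<^sup>2 / 2))"
      using iU iU2 unfolding power_mult_distrib by (intro integrable_of_real; simp)+
    moreover have "expectation (\<lambda>\<omega>. complex_of_real (s * U \<omega>)) = of_real (expectation (\<lambda>\<omega>. s * U \<omega>))"
      "expectation (\<lambda>\<omega>. complex_of_real ((s * U \<omega>)\<^sup>2 / 2)) = of_real (expectation (\<lambda>\<omega>. (s * U \<omega>)\<^sup>2 / 2))"
      by (rule integral_complex_of_real)+
    moreover have "expectation (\<lambda>\<omega>. (s * U \<omega>)\<^sup>2 / 2) = s\<^sup>2 * e2 / 2"
      by (simp add: power_mult_distrib e2_def)
    ultimately show "expectation P = of_real (1 - s\<^sup>2 * e2 / 2)" "integrable M P"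
      unfolding P_def[abs_def] by (simp_all add: prob_space mean del: of_real_mult of_real_divide of_real_power)
  qed
  have "norm (expectation (\<lambda>\<omega>. iexp (s * U \<omega>)) - of_real (1 - s\<^sup>2 * e2 / 2))
    = norm (expectation (\<lambda>\<omega>. iexp (s * U \<omega>) - P \<omega>))"
    unfolding P[symmetric] using ie iP by simp
  also have "\<dots> \<le> expectation (\<lambda>\<omega>. norm (iexp (s * U \<omega>) - P \<omega>))" by (rule integral_norm_bound)
  also have "\<dots> \<le> expectation (\<lambda>\<omega>. \<bar>s\<bar> ^ 3 * b / 6 * (U \<omega>)\<^sup>2)"
  proof (rule integral_mono)
    fix \<omega>
    have "norm (iexp (s * U \<omega>) - P \<omega>) \<le> \<bar>s * U \<omega>\<bar> ^ 3 / 6"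
      using iexp_approx1[of "s * U \<omega>" 2]
      by (simp add: P_def numeral_eq_Suc power_mult_distrib field_simps)
    also have "\<dots> = \<bar>s\<bar> ^ 3 * \<bar>U \<omega>\<bar> / 6 * (U \<omega>)\<^sup>2"
    proof -
      have "\<bar>U \<omega>\<bar> ^ 3 = \<bar>U \<omega>\<bar> * \<bar>U \<omega>\<bar>\<^sup>2" unfolding power3_eq_cube power2_eq_square by (rule mult.assoc)
      then show ?thesis unfolding abs_mult power_mult_distrib by simp
    qed
    also have "\<dots> \<le> \<bar>s\<bar> ^ 3 * b / 6 * (U \<omega>)\<^sup>2"
      using bd[of \<omega>] by (intro mult_right_mono divide_right_mono mult_left_mono) auto
    finally show "norm (iexp (s * U \<omega>) - P \<omega>) \<le> \<bar>s\<bar> ^ 3 * b / 6 * (U \<omega>)\<^sup>2" .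
  qed (use ie iP iU2 in auto)
  also have "\<dots> = \<bar>s\<bar> ^ 3 * b * e2 / 6" by (simp add: e2_def)
  finally have 1: "norm (expectation (\<lambda>\<omega>. iexp (s * U \<omega>)) - of_real (1 - s\<^sup>2 * e2 / 2)) \<le> \<bar>s\<bar> ^ 3 * b * e2 / 6" .
  have 2: "norm (complex_of_real (1 - s\<^sup>2 * e2 / 2) - of_real (exp (- (s\<^sup>2 * e2 / 2)))) \<le> (s\<^sup>2 * e2 / 2)\<^sup>2 / 2"
    using exp_minus_approx[of "s\<^sup>2 * e2 / 2"] e20
    by (simp only: of_real_diff[symmetric] norm_of_real) (simp add: abs_minus_commute)
  show ?thesis
    unfolding e2_def[symmetric] using norm_triangle_le[OF add_mono[OF 1 2]] by (simp add: add_diff_add)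
qed

end

section \<open>Factorisation over separated blocks\<close>

lemma norm_mult_diff_le:
  fixes a b c :: complex
  assumes "norm (d - a * c) \<le> e1" "norm (a - b) \<le> e2" "norm c \<le> 1"
  shows "norm (d - b * c) \<le> e1 + e2"
proof -
  have "d - b * c = (d - a * c) + (a - b) * c" by (simp add: algebra_simps)
  then have "norm (d - b * c) \<le> norm (d - a * c) + norm (a - b) * norm c"
    by (simp only: norm_mult[symmetric]) (rule norm_triangle_ineq)
  also have "\<dots> \<le> e1 + e2 * 1"
    by (intro add_mono mult_mono assms order_trans[OF norm_ge_zero assms(2)]) auto
  finally show ?thesis by simp
qed

lemma (in prob_space) expectation_complex_of_real_pair:
  fixes f g :: "'a \<Rightarrow> real"
  assumes "integrable M f" "integrable M g"
  shows "expectation (\<lambda>\<omega>. of_real (f \<omega>) + \<i> * of_real (g \<omega>)) = of_real (expectation f) + \<i> * of_real (expectation g)"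
  using assms by (simp add: integrable_of_real)

context stationary_mixing
begin

text \<open>Splitting both exponentials into cosine and sine produces four real covariances of
  functions bounded by 1, each at most 4 times the mixing coefficient; hence 16.\<close>

lemma char_blocks_le_alpha_mixing:
  assumes [measurable]: "h \<in> borel_measurable borel"
    and I: "I \<subseteq> {..a}" and J: "J \<subseteq> {a + int t..}"
  shows "norm (expectation (\<lambda>\<omega>. iexp (s * (\<Sum>i\<in>I. h (X i \<omega>))) * iexp (s * (\<Sum>i\<in>J. h (X i \<omega>))))
     - expectation (\<lambda>\<omega>. iexp (s * (\<Sum>i\<in>I. h (X i \<omega>)))) * expectation (\<lambda>\<omega>. iexp (s * (\<Sum>i\<in>J. h (X i \<omega>)))))
     \<le> 16 * alpha_mixing M X t"
proof -
  define U where "U \<omega> = (\<Sum>i\<in>I. h (X i \<omega>))" for \<omega>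
  define V where "V \<omega> = (\<Sum>i\<in>J. h (X i \<omega>))" for \<omega>
  have [measurable]: "U \<in> borel_measurable M" "V \<in> borel_measurable M" unfolding U_def V_def by measurable
  define E2 where "E2 f g = expectation (\<lambda>\<omega>. f (s * U \<omega>) * g (s * V \<omega>))" for f g :: "real \<Rightarrow> real"
  define EU where "EU f = expectation (\<lambda>\<omega>. f (s * U \<omega>))" for f :: "real \<Rightarrow> real"
  define EV where "EV f = expectation (\<lambda>\<omega>. f (s * V \<omega>))" for f :: "real \<Rightarrow> real"
  have cov: "\<bar>E2 f g - EU f * EV g\<bar> \<le> 4 * alpha_mixing M X t"
    if [measurable]: "f \<in> borel_measurable borel" "g \<in> borel_measurable borel"
      and "\<And>x. \<bar>f x\<bar> \<le> 1" "\<And>x. \<bar>g x\<bar> \<le> 1" for f g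
    unfolding E2_def EU_def EV_def U_def V_def
    using cov_blocks_le_alpha_mixing[of "\<lambda>x. f (s * x)" "\<lambda>x. g (s * x)" h h I a J t 1 1] that I J by simp
  have int: "integrable M (\<lambda>\<omega>. f (s * U \<omega>) * g (s * V \<omega>))" "integrable M (\<lambda>\<omega>. f (s * U \<omega>))" "integrable M (\<lambda>\<omega>. f (s * V \<omega>))"
    if [measurable]: "f \<in> borel_measurable borel" "g \<in> borel_measurable borel"
      and le: "\<And>x. \<bar>f x\<bar> \<le> 1" "\<And>x. \<bar>g x\<bar> \<le> 1" for f g :: "real \<Rightarrow> real"
  proof -
    have ae: "AE \<omega> in M. norm (f (s * U \<omega>) * g (s * V \<omega>)) \<le> 1"
      using le by (simp add: abs_mult mult_le_one)
    show "integrable M (\<lambda>\<omega>. f (s * U \<omega>) * g (s * V \<omega>))"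
      by (rule integrable_const_bound[OF ae]) measurable
    show "integrable M (\<lambda>\<omega>. f (s * U \<omega>))" "integrable M (\<lambda>\<omega>. f (s * V \<omega>))"
      by (rule integrable_const_bound[where B=1], simp add: le, measurable)+
  qed
  have cs: "(cos :: real \<Rightarrow> real) \<in> borel_measurable borel" "(sin :: real \<Rightarrow> real) \<in> borel_measurable borel" "\<And>x. \<bar>cos x\<bar> \<le> (1::real)" "\<And>x. \<bar>sin x\<bar> \<le> (1::real)"
    by (auto intro!: borel_measurable_continuous_onI continuous_at_imp_continuous_on DERIV_isCont[OF DERIV_cos] DERIV_isCont[OF DERIV_sin])
  have ie: "iexp x = of_real (cos x) + \<i> * of_real (sin x)" for x
    by (simp add: exp_Euler cos_of_real sin_of_real)
  have eU: "expectation (\<lambda>\<omega>. iexp (s * U \<omega>)) = of_real (EU cos) + \<i> * of_real (EU sin)"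
    unfolding ie EU_def by (rule expectation_complex_of_real_pair) (use int cs in blast)+
  have eV: "expectation (\<lambda>\<omega>. iexp (s * V \<omega>)) = of_real (EV cos) + \<i> * of_real (EV sin)"
    unfolding ie EV_def by (rule expectation_complex_of_real_pair) (use int cs in blast)+
  have eUV: "expectation (\<lambda>\<omega>. iexp (s * U \<omega>) * iexp (s * V \<omega>)) =
    of_real (E2 cos cos - E2 sin sin) + \<i> * of_real (E2 cos sin + E2 sin cos)"
  proof -
    have i2: "integrable M (\<lambda>\<omega>. cos (s * U \<omega>) * cos (s * V \<omega>))" "integrable M (\<lambda>\<omega>. sin (s * U \<omega>) * sin (s * V \<omega>))"
      "integrable M (\<lambda>\<omega>. cos (s * U \<omega>) * sin (s * V \<omega>))" "integrable M (\<lambda>\<omega>. sin (s * U \<omega>) * cos (s * V \<omega>))"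
      using int(1) cs by blast+
    have "(\<lambda>\<omega>. iexp (s * U \<omega>) * iexp (s * V \<omega>)) =
      (\<lambda>\<omega>. of_real (cos (s * U \<omega>) * cos (s * V \<omega>) - sin (s * U \<omega>) * sin (s * V \<omega>))
        + \<i> * of_real (cos (s * U \<omega>) * sin (s * V \<omega>) + sin (s * U \<omega>) * cos (s * V \<omega>)))"
      unfolding ie by (auto simp: algebra_simps)
    then have "expectation (\<lambda>\<omega>. iexp (s * U \<omega>) * iexp (s * V \<omega>)) =
      of_real (expectation (\<lambda>\<omega>. cos (s * U \<omega>) * cos (s * V \<omega>) - sin (s * U \<omega>) * sin (s * V \<omega>)))
      + \<i> * of_real (expectation (\<lambda>\<omega>. cos (s * U \<omega>) * sin (s * V \<omega>) + sin (s * U \<omega>) * cos (s * V \<omega>)))"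
      using expectation_complex_of_real_pair[OF Bochner_Integration.integrable_diff[OF i2(1,2)]
          Bochner_Integration.integrable_add[OF i2(3,4)]] by simp
    then show ?thesis unfolding E2_def using i2 by simp
  qed
  let ?c = "\<lambda>f g. E2 f g - EU f * EV g"
  have "norm (of_real (?c cos cos - ?c sin sin) + \<i> * of_real (?c cos sin + ?c sin cos))
    \<le> \<bar>?c cos cos - ?c sin sin\<bar> + \<bar>?c cos sin + ?c sin cos\<bar>"
    by (rule order_trans[OF norm_triangle_ineq]) (simp only: norm_mult norm_of_real norm_ii mult_1_left order_refl)
  also have "\<dots> \<le> 16 * alpha_mixing M X t"
    using cov[OF cs(1,1,3,3)] cov[OF cs(1,2,3,4)] cov[OF cs(2,1,4,3)] cov[OF cs(2,2,4,4)] by linarith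
  also have "of_real (?c cos cos - ?c sin sin) + \<i> * of_real (?c cos sin + ?c sin cos) =
    expectation (\<lambda>\<omega>. iexp (s * U \<omega>) * iexp (s * V \<omega>)) - expectation (\<lambda>\<omega>. iexp (s * U \<omega>)) * expectation (\<lambda>\<omega>. iexp (s * V \<omega>))"
    unfolding eU eV eUV by (simp add: algebra_simps)
  finally show ?thesis unfolding U_def V_def .
qed

text \<open>Induction on the number of blocks. The next block is separated from all earlier ones by
  a gap of length \<open>q\<close>, and since \<open>c\<close> has norm at most 1 the errors add up
  instead of multiplying.\<close>

lemma char_separated_blocks:
  fixes p q :: nat and s :: real
  assumes [measurable]: "h \<in> borel_measurable borel"
  defines "c \<equiv> expectation (\<lambda>\<omega>. iexp (s * (\<Sum>i=1..int p. h (X i \<omega>))))"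
  shows "norm (expectation (\<lambda>\<omega>. iexp (s * (\<Sum>i\<in>(\<Union>r<k. {int (r * (p + q)) + 1..int (r * (p + q)) + int p}). h (X i \<omega>)))) - c ^ k)
    \<le> real k * (16 * alpha_mixing M X q)"
proof (induction k)
  case 0
  then show ?case by (simp add: prob_space)
next
  case (Suc k)
  define L where "L = p + q"
  define B where "B r = {int (r * L) + 1..int (r * L) + int p}" for r
  define I where "I = (\<Union>r<k. B r)"
  let ?W = "\<lambda>I \<omega>. \<Sum>i\<in>I. h (X i \<omega>)"
  have IH: "norm (expectation (\<lambda>\<omega>. iexp (s * ?W I \<omega>)) - c ^ k) \<le> real k * (16 * alpha_mixing M X q)"
    using Suc by (simp add: I_def B_def L_def)
  \<comment> \<open>The earlier blocks end at \<open>int (k * L) - int q\<close> at the latest. With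
    this as the dividing time the future begins at \<open>k * L\<close>, one step before the block
    \<open>B k\<close>.\<close>
  have Ia: "I \<subseteq> {..int (k * L) - int q}"
  proof
    fix i assume "i \<in> I"
    then obtain r where r: "r < k" "i \<le> int (r * L) + int p" by (auto simp: I_def B_def)
    have "Suc r * L \<le> k * L" using r by (intro mult_right_mono) auto
    then have "int (Suc r * L) \<le> int (k * L)" by (simp only: of_nat_le_iff)
    then have "int (r * L) + int p + int q \<le> int (k * L)" by (simp add: L_def algebra_simps)
    then show "i \<in> {..int (k * L) - int q}" using r by simp
  qed
  have cB: "expectation (\<lambda>\<omega>. iexp (s * ?W (B k) \<omega>)) = c"
  proof -
    have "?W (B k) \<omega> = (\<Sum>i=1..int p. h (X (i + int (k * L)) \<omega>))" for \<omega>
      unfolding B_def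
      by (rule sum.reindex_bij_witness[where i="\<lambda>i. i + int (k * L)" and j="\<lambda>i. i - int (k * L)"]) auto
    then show ?thesis
      using expectation_shift[of "\<lambda>x. iexp (s * (\<Sum>i=1..int p. h (x i)))" "int (k * L)"]
      unfolding c_def by simp
  qed
  have "norm (expectation (\<lambda>\<omega>. iexp (s * ?W I \<omega>) * iexp (s * ?W (B k) \<omega>)) -
     expectation (\<lambda>\<omega>. iexp (s * ?W I \<omega>)) * c) \<le> 16 * alpha_mixing M X q"
    unfolding cB[symmetric]
    by (rule char_blocks_le_alpha_mixing[where a="int (k * L) - int q", OF assms(1) Ia]) (auto simp: B_def)
  moreover have "norm c \<le> 1" unfolding c_def by (rule norm_expectation_iexp_le_1) simp
  ultimately have "norm (expectation (\<lambda>\<omega>. iexp (s * ?W I \<omega>) * iexp (s * ?W (B k) \<omega>)) - c ^ k * c)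
    \<le> 16 * alpha_mixing M X q + real k * (16 * alpha_mixing M X q)"
    using IH by (intro norm_mult_diff_le)
  moreover have "iexp (s * ?W I \<omega>) * iexp (s * ?W (B k) \<omega>) = iexp (s * ?W (\<Union>r<Suc k. B r) \<omega>)" for \<omega>
  proof -
    have "I \<inter> B k = {}" using Ia by (auto simp: B_def)
    moreover have "finite I" "finite (B k)" by (auto simp: I_def B_def)
    moreover have "(\<Union>r<Suc k. B r) = I \<union> B k" by (auto simp: I_def less_Suc_eq)
    ultimately have "?W (\<Union>r<Suc k. B r) \<omega> = ?W I \<omega> + ?W (B k) \<omega>" by (simp add: sum.union_disjoint)
    then show ?thesis by (simp add: ring_distribs exp_add)
  qed
  ultimately show ?case by (simp add: B_def L_def algebra_simps)
qed

text \<open>Bernstein's big-block/small-block decomposition: \<open>k\<close> blocks of length \<open>p\<close> separated by gaps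
  of length \<open>q\<close>.\<close>

lemma char_bernstein_bound:
  fixes n p q k :: nat
  assumes h[measurable]: "h \<in> borel_measurable borel" and B: "\<And>x. \<bar>h x\<bar> \<le> B"
    and mean: "expectation (\<lambda>\<omega>. h (X 0 \<omega>)) = 0"
    and C: "\<And>I. finite I \<Longrightarrow> expectation (\<lambda>\<omega>. (\<Sum>i\<in>I. h (X i \<omega>))\<^sup>2) \<le> real (card I) * C"
    and v: "v \<ge> 0" and n: "n > 0" "k * (p + q) \<le> n"
  defines "\<sigma>2 \<equiv> expectation (\<lambda>\<omega>. (\<Sum>i=1..int p. h (X i \<omega>))\<^sup>2)"
  shows "norm (expectation (\<lambda>\<omega>. iexp (t / sqrt n * (\<Sum>i=1..int n. h (X i \<omega>)))) - of_real (exp (- (t\<^sup>2 * v / 2))))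
    \<le> \<bar>t\<bar> * sqrt (C * ((real n - real k * real p) / real n)) + 16 * (real k * alpha_mixing M X q)
      + (\<bar>t\<bar> ^ 3 * B * C / 6 * (real k * real p / real n * (real p / sqrt n))
         + (t\<^sup>2 * C)\<^sup>2 / 8 * (real k * real p / real n * (real p / real n)))
      + t\<^sup>2 / 2 * \<bar>real k * \<sigma>2 / real n - v\<bar>"
proof -
  define s where "s = t / sqrt n"
  define I where "I = (\<Union>r<k. {int (r * (p + q)) + 1..int (r * (p + q)) + int p})"
  define c where "c = expectation (\<lambda>\<omega>. iexp (s * (\<Sum>i=1..int p. h (X i \<omega>))))"
  define y where "y = s\<^sup>2 * \<sigma>2 / 2"
  let ?W = "\<lambda>I \<omega>. \<Sum>i\<in>I. h (X i \<omega>)"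
  have s2: "s\<^sup>2 = t\<^sup>2 / real n" by (simp add: s_def power_divide)
  have B0: "B \<ge> 0" using order_trans[OF abs_ge_zero B[of 0]] .
  have C0: "C \<ge> 0"
    using order_trans[OF Bochner_Integration.integral_nonneg C[of "{0}"]] by simp
  have \<sigma>0: "\<sigma>2 \<ge> 0" unfolding \<sigma>2_def by (rule Bochner_Integration.integral_nonneg) simp
  have \<sigma>C: "\<sigma>2 \<le> real p * C" unfolding \<sigma>2_def using C[of "{1..int p}"] by simp
  have y0: "y \<ge> 0" unfolding y_def using \<sigma>0 by simp
  have finI: "finite I" by (simp add: I_def)
  have cardI: "card I = k * p"
  proof -
    have "card I = (\<Sum>r<k. card {int (r * (p + q)) + 1..int (r * (p + q)) + int p})"
      unfolding I_def
    proof (rule card_UN_disjoint, simp, simp, safe)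
      fix r r' x assume "r \<noteq> r'"
        and x: "x \<in> {int (r * (p + q)) + 1..int (r * (p + q)) + int p}" "x \<in> {int (r' * (p + q)) + 1..int (r' * (p + q)) + int p}"
      have False if "r < r'" "x \<in> {int (r * (p + q)) + 1..int (r * (p + q)) + int p}" "x \<in> {int (r' * (p + q)) + 1..int (r' * (p + q)) + int p}" for r r'
      proof -
        have "Suc r * (p + q) \<le> r' * (p + q)" using that by (intro mult_right_mono) auto
        then have "int (Suc r * (p + q)) \<le> int (r' * (p + q))" by (simp only: of_nat_le_iff)
        then have "int (r * (p + q)) + int p \<le> int (r' * (p + q))" by (simp add: algebra_simps)
        with that show False by simp
      qed
      with x \<open>r \<noteq> r'\<close> show "x \<in> {}" by (metis linorder_neqE_nat)
    qed
    then show ?thesis by simp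
  qed
  have Isub: "I \<subseteq> {1..int n}"
  proof
    fix i assume "i \<in> I"
    then obtain r where r: "r < k" "int (r * (p + q)) + 1 \<le> i" "i \<le> int (r * (p + q)) + int p" by (auto simp: I_def)
    have "Suc r * (p + q) \<le> k * (p + q)" using r by (intro mult_right_mono) auto
    then have "r * (p + q) + p \<le> n" using n(2) by simp
    then have "int (r * (p + q) + p) \<le> int n" by (simp only: of_nat_le_iff)
    then have "int (r * (p + q)) + int p \<le> int n" by simp
    moreover have "0 \<le> int (r * (p + q))" by (rule of_nat_0_le_iff)
    ultimately show "i \<in> {1..int n}" using r unfolding atLeastAtMost_iff by linarith
  qed
  have kp: "k * p \<le> n" using card_mono[OF _ Isub] cardI by simp
  have bdW: "\<bar>?W J \<omega>\<bar> \<le> real (card J) * B" for J \<omega>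
    by (rule order_trans[OF sum_abs], rule order_trans[OF sum_bounded_above[of _ _ B]]) (use B in auto)
  have iW2: "integrable M (\<lambda>\<omega>. (?W J \<omega>)\<^sup>2)" for J
    by (rule integrable_const_bound[where B="(real (card J) * B)\<^sup>2"])
       (use bdW B0 in \<open>auto simp: abs_le_square_iff[symmetric]\<close>)
  have iX: "integrable M (\<lambda>\<omega>. h (X i \<omega>))" for i
    by (rule integrable_const_bound[where B=B]) (use B in auto)
  have eX: "expectation (\<lambda>\<omega>. h (X i \<omega>)) = 0" for i
    using expectation_X[of h i] mean by simp
  \<comment> \<open>The sum over the \<open>n - k * p\<close> indices outside the blocks, including
    the incomplete end piece, is discarded in mean square.\<close>
  have gap: "norm (expectation (\<lambda>\<omega>. iexp (s * ?W {1..int n} \<omega>)) - expectation (\<lambda>\<omega>. iexp (s * ?W I \<omega>)))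
    \<le> \<bar>t\<bar> * sqrt (C * ((real n - real k * real p) / real n))"
  proof -
    have d: "?W {1..int n} \<omega> - ?W I \<omega> = ?W ({1..int n} - I) \<omega>" for \<omega>
      using Isub finI by (simp add: sum_diff)
    have "expectation (\<lambda>\<omega>. (?W ({1..int n} - I) \<omega>)\<^sup>2) \<le> real (card ({1..int n} - I)) * C"
      by (rule C) simp
    also have "card ({1..int n} - I) = n - k * p"
      using Isub finI cardI by (simp add: card_Diff_subset)
    also have "real (n - k * p) = real n - real k * real p"
      using kp by (simp add: of_nat_diff)
    finally have e: "expectation (\<lambda>\<omega>. (?W ({1..int n} - I) \<omega>)\<^sup>2) \<le> (real n - real k * real p) * C" .
    have "norm (expectation (\<lambda>\<omega>. iexp (s * ?W {1..int n} \<omega>)) - expectation (\<lambda>\<omega>. iexp (s * ?W I \<omega>)))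
      \<le> \<bar>s\<bar> * sqrt (expectation (\<lambda>\<omega>. (?W {1..int n} \<omega> - ?W I \<omega>)\<^sup>2))"
      by (rule char_diff_le) (simp_all add: d iW2)
    also have "\<dots> \<le> \<bar>s\<bar> * sqrt ((real n - real k * real p) * C)"
      unfolding d using e by (intro mult_left_mono real_sqrt_le_mono) auto
    also have "\<dots> = \<bar>t\<bar> * sqrt (C * ((real n - real k * real p) / real n))"
      by (simp add: s_def real_sqrt_divide real_sqrt_mult)
    finally show ?thesis .
  qed
  have mix: "norm (expectation (\<lambda>\<omega>. iexp (s * ?W I \<omega>)) - c ^ k) \<le> 16 * (real k * alpha_mixing M X q)"
    unfolding mult.left_commute[of 16] I_def c_def by (rule char_separated_blocks[OF h])
  have tay: "norm (c - of_real (exp (- y))) \<le> \<bar>s\<bar> ^ 3 * (real p * B) * \<sigma>2 / 6 + y\<^sup>2 / 2"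
    unfolding c_def y_def \<sigma>2_def
    by (rule char_taylor_le) (use bdW[of _ "{1..int p}"] iX eX in auto)
  \<comment> \<open>Both bases lie in the closed unit disc, so telescoping the \<open>k\<close>-th
    powers costs only a factor \<open>k\<close>.\<close>
  have "norm (c ^ k - of_real (exp (- y)) ^ k) \<le> real k * norm (c - of_real (exp (- y)))"
  proof (rule norm_power_diff)
    show "norm c \<le> 1" unfolding c_def by (rule norm_expectation_iexp_le_1) simp
    show "norm (complex_of_real (exp (- y))) \<le> 1" using y0 by simp
  qed
  also have "\<dots> \<le> real k * (\<bar>s\<bar> ^ 3 * (real p * B) * (real p * C) / 6 + (s\<^sup>2 * (real p * C) / 2)\<^sup>2 / 2)"
  proof -
    have 1: "\<bar>s\<bar> ^ 3 * (real p * B) * \<sigma>2 \<le> \<bar>s\<bar> ^ 3 * (real p * B) * (real p * C)"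
      using \<sigma>C B0 by (intro mult_left_mono) auto
    have 2: "y\<^sup>2 \<le> (s\<^sup>2 * (real p * C) / 2)\<^sup>2"
      using y0 \<sigma>C unfolding y_def by (intro power_mono divide_right_mono mult_left_mono) auto
    show ?thesis
      by (rule mult_left_mono[OF order_trans[OF tay add_mono[OF divide_right_mono[OF 1] divide_right_mono[OF 2]]]]) auto
  qed
  \<comment> \<open>Regrouped into the ratios \<open>k * p / n\<close>, \<open>p / sqrt n\<close>
    and \<open>p / n\<close>, whose limits are known once the block lengths are chosen.\<close>
  also have "\<dots> = \<bar>t\<bar> ^ 3 * B * C / 6 * (real k * real p / real n * (real p / sqrt n))
         + (t\<^sup>2 * C)\<^sup>2 / 8 * (real k * real p / real n * (real p / real n))"
  proof -
    have "\<bar>s\<bar> ^ 3 = \<bar>t\<bar> ^ 3 / (real n * sqrt n)"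
      using n by (simp add: s_def power_divide power3_eq_cube)
    then show ?thesis unfolding s2 using n by (simp add: power2_eq_square field_simps)
  qed
  finally have pow: "norm (c ^ k - of_real (exp (- y)) ^ k) \<le> \<bar>t\<bar> ^ 3 * B * C / 6 * (real k * real p / real n * (real p / sqrt n))
         + (t\<^sup>2 * C)\<^sup>2 / 8 * (real k * real p / real n * (real p / real n))" .
  \<comment> \<open>The product of the \<open>k\<close> Gaussian factors has exponent
    \<open>k * y\<close>; its distance from the limit exponent is the error in approximating
    \<open>v\<close> by the block variances.\<close>
  have last: "norm (complex_of_real (exp (- y)) ^ k - of_real (exp (- (t\<^sup>2 * v / 2)))) \<le> t\<^sup>2 / 2 * \<bar>real k * \<sigma>2 / real n - v\<bar>"
  proof -
    have e: "complex_of_real (exp (- y)) ^ k = of_real (exp (- (real k * y)))"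
      by (simp add: exp_of_nat_mult[symmetric] flip: of_real_power)
    have "norm (complex_of_real (exp (- y)) ^ k - of_real (exp (- (t\<^sup>2 * v / 2)))) = \<bar>exp (- (real k * y)) - exp (- (t\<^sup>2 * v / 2))\<bar>"
      unfolding e by (simp only: of_real_diff[symmetric] norm_of_real)
    also have "\<dots> \<le> \<bar>real k * y - t\<^sup>2 * v / 2\<bar>"
      by (rule exp_minus_lipschitz) (use y0 v in auto)
    also have "real k * y - t\<^sup>2 * v / 2 = t\<^sup>2 / 2 * (real k * \<sigma>2 / real n - v)"
      by (simp add: y_def s2 algebra_simps)
    finally show ?thesis by (simp add: abs_mult)
  qed
  have tri: "norm (a - e) \<le> x1 + x2 + x3 + x4"
    if "norm (a - b) \<le> x1" "norm (b - c) \<le> x2" "norm (c - d) \<le> x3" "norm (d - e) \<le> x4" for a b c d e :: complex and x1 x2 x3 x4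
    using norm_triangle_le[OF add_mono[OF norm_triangle_le[OF add_mono[OF norm_triangle_le[OF add_mono[OF that(1,2)]] that(3)]] that(4)]]
    by simp
  show ?thesis using tri[OF gap mix pow last] unfolding s_def .
qed

text \<open>For fixed \<open>m\<close> the gaps have length \<open>q \<sim> sqrt n / m\<^sup>2\<close> and the blocks length
  \<open>p = m q\<close>. The limit of the bound as \<open>n \<rightarrow> \<infinity>\<close> then vanishes as \<open>m \<rightarrow> \<infinity>\<close>.\<close>

lemma clt_char_bounded_eventually:
  fixes m :: nat
  assumes h[measurable]: "h \<in> borel_measurable borel" and B: "\<And>x. \<bar>h x\<bar> \<le> B"
    and mean: "expectation (\<lambda>\<omega>. h (X 0 \<omega>)) = 0"
    and C: "\<And>I. finite I \<Longrightarrow> expectation (\<lambda>\<omega>. (\<Sum>i\<in>I. h (X i \<omega>))\<^sup>2) \<le> real (card I) * C"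
    and v: "v \<ge> 0" and lim: "(\<lambda>n. expectation (\<lambda>\<omega>. (\<Sum>i=1..int n. h (X i \<omega>))\<^sup>2) / real n) \<longlonglongrightarrow> v"
    and mix: "(\<lambda>n. real n * alpha_mixing M X n) \<longlonglongrightarrow> 0"
    and m: "m > 0"
  shows "\<exists>b. (\<forall>\<^sub>F n in sequentially.
      norm (expectation (\<lambda>\<omega>. iexp (t / sqrt n * (\<Sum>i=1..int n. h (X i \<omega>)))) - of_real (exp (- (t\<^sup>2 * v / 2)))) \<le> b n)
    \<and> b \<longlonglongrightarrow> \<bar>t\<bar> * sqrt (C / (m + 1)) + \<bar>t\<bar> ^ 3 * B * C / 6 / (m + 1) + t\<^sup>2 / 2 * (v / (m + 1))"
proof -
  \<comment> \<open>The order \<open>sqrt n\<close> reconciles two demands: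
    \<open>p / sqrt n\<close> must stay bounded for the cubic Taylor term, and
    \<open>n / (q n)\<^sup>2\<close> must stay bounded for the mixing term. The factor
    \<open>1 / m\<^sup>2\<close> makes \<open>p / sqrt n\<close> tend to \<open>1 / m\<close>, and
    \<open>p = m * q\<close> makes the fraction of discarded indices tend to
    \<open>1 / (m + 1)\<close>.\<close>
  define q where "q n = nat \<lfloor>sqrt (real n) / (real m)\<^sup>2\<rfloor>" for n
  define p where "p n = m * q n" for n
  define k where "k n = n div (p n + q n)" for n
  define Q where "Q n = real (q n) / sqrt (real n)" for n
  define \<mu> where "\<mu> = real m"
  have \<mu>: "\<mu> > 0" using m by (simp add: \<mu>_def)
  have L: "real (p n + q n) = (\<mu> + 1) * real (q n)" for n
    by (simp add: p_def \<mu>_def algebra_simps)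
  have sq: "filterlim (\<lambda>n. sqrt (real n)) at_top sequentially"
    by (rule filterlim_compose[OF sqrt_at_top filterlim_real_sequentially])
  have inv: "(\<lambda>n. 1 / sqrt (real n)) \<longlonglongrightarrow> 0"
    using tendsto_inverse_0_at_top[OF sq] by (simp add: inverse_eq_divide)
  have n0: "\<forall>\<^sub>F n in sequentially. (n::nat) > 0" by (rule eventually_gt_at_top)
  have qb: "real (q n) \<le> sqrt (real n) / \<mu>\<^sup>2" "sqrt (real n) / \<mu>\<^sup>2 - 1 \<le> real (q n)" for n
  proof -
    have "0 \<le> sqrt (real n) / \<mu>\<^sup>2" by simp
    then show "real (q n) \<le> sqrt (real n) / \<mu>\<^sup>2" unfolding q_def \<mu>_def by (rule of_nat_floor)
    show "sqrt (real n) / \<mu>\<^sup>2 - 1 \<le> real (q n)" unfolding q_def \<mu>_def by linarith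
  qed
  have Q: "Q \<longlonglongrightarrow> 1 / \<mu>\<^sup>2"
  proof (rule tendsto_sandwich)
    show "\<forall>\<^sub>F n in sequentially. Q n \<le> 1 / \<mu>\<^sup>2"
      using n0 by eventually_elim (use qb(1) in \<open>simp add: Q_def divide_le_eq field_simps\<close>)
    show "\<forall>\<^sub>F n in sequentially. 1 / \<mu>\<^sup>2 - 1 / sqrt (real n) \<le> Q n"
      using n0
    proof eventually_elim
      case (elim n)
      have "1 / \<mu>\<^sup>2 - 1 / sqrt (real n) = (sqrt (real n) / \<mu>\<^sup>2 - 1) / sqrt (real n)"
        using elim by (simp add: diff_divide_distrib)
      also have "\<dots> \<le> Q n" unfolding Q_def by (rule divide_right_mono[OF qb(2)]) simp
      finally show ?case .
    qed
    show "(\<lambda>n. 1 / \<mu>\<^sup>2 - 1 / sqrt (real n)) \<longlonglongrightarrow> 1 / \<mu>\<^sup>2"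
      using tendsto_diff[OF tendsto_const inv, of "1 / \<mu>\<^sup>2"] by simp
  qed simp
  have qinf: "filterlim (\<lambda>n. real (q n)) at_top sequentially"
  proof (rule filterlim_at_top_mono)
    have "filterlim (\<lambda>n. - 1 + sqrt (real n) * (1 / \<mu>\<^sup>2)) at_top sequentially"
      by (intro filterlim_tendsto_add_at_top[OF tendsto_const]
          filterlim_at_top_mult_tendsto_pos[OF tendsto_const _ sq]) (use \<mu> in auto)
    then show "filterlim (\<lambda>n. sqrt (real n) / \<mu>\<^sup>2 - 1) at_top sequentially"
      by (simp add: algebra_simps)
    show "\<forall>\<^sub>F n in sequentially. sqrt (real n) / \<mu>\<^sup>2 - 1 \<le> real (q n)" using qb(2) by simp
  qed
  then have qinf': "filterlim q at_top sequentially"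
    by (simp add: filterlim_sequentially_iff_filterlim_real)
  have q0: "\<forall>\<^sub>F n in sequentially. q n > 0"
    by (rule eventually_compose_filterlim[OF eventually_gt_at_top qinf'])
  have pinf: "filterlim p at_top sequentially"
    by (rule filterlim_at_top_mono[OF qinf']) (use m in \<open>simp add: p_def\<close>)
  have kL: "k n * (p n + q n) \<le> n" for n by (simp add: k_def)
  have kLr: "real (k n) * ((\<mu> + 1) * real (q n)) \<le> real n" for n
    using kL[of n] unfolding L[symmetric] of_nat_mult[symmetric] by (simp only: of_nat_le_iff)
  \<comment> \<open>Rounding \<open>k\<close> down loses less than one period of length
    \<open>(\<mu> + 1) * q\<close>, which is of order \<open>sqrt n\<close> and so negligible
    against \<open>n\<close>.\<close>
  have kLlim: "(\<lambda>n. real (k n) * ((\<mu> + 1) * real (q n)) / real n) \<longlonglongrightarrow> 1"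
  proof (rule tendsto_sandwich)
    show "\<forall>\<^sub>F n in sequentially. real (k n) * ((\<mu> + 1) * real (q n)) / real n \<le> 1"
      using n0 by eventually_elim (use kLr in \<open>simp add: divide_le_eq\<close>)
    show "\<forall>\<^sub>F n in sequentially. 1 - (\<mu> + 1) * Q n * (1 / sqrt (real n)) \<le> real (k n) * ((\<mu> + 1) * real (q n)) / real n"
      using n0 q0
    proof eventually_elim
      case (elim n)
      have "n mod (p n + q n) < p n + q n" using elim by simp
      moreover have "n = k n * (p n + q n) + n mod (p n + q n)" by (simp only: k_def div_mult_mod_eq)
      ultimately have "n \<le> k n * (p n + q n) + (p n + q n)" by linarith
      then have "real n \<le> real (k n * (p n + q n) + (p n + q n))" by (simp only: of_nat_le_iff)
      then have "real n - (\<mu> + 1) * real (q n) \<le> real (k n) * ((\<mu> + 1) * real (q n))"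
        unfolding of_nat_add[of "k n * (p n + q n)"] of_nat_mult L by linarith
      then have "(real n - (\<mu> + 1) * real (q n)) / real n \<le> real (k n) * ((\<mu> + 1) * real (q n)) / real n"
        by (rule divide_right_mono) simp
      moreover have "(real n - (\<mu> + 1) * real (q n)) / real n = 1 - (\<mu> + 1) * Q n * (1 / sqrt (real n))"
        using elim by (simp add: Q_def diff_divide_distrib)
      ultimately show ?case by simp
    qed
    show "(\<lambda>n. 1 - (\<mu> + 1) * Q n * (1 / sqrt (real n))) \<longlonglongrightarrow> 1"
      using tendsto_diff[OF tendsto_const tendsto_mult[OF tendsto_mult[OF tendsto_const Q] inv], of 1 "\<mu> + 1"] by simp
  qed simp
  have kp: "(\<lambda>n. real (k n) * real (p n) / real n) \<longlonglongrightarrow> \<mu> / (\<mu> + 1)"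
  proof -
    have eq: "real (k n) * real (p n) / real n = \<mu> / (\<mu> + 1) * (real (k n) * ((\<mu> + 1) * real (q n)) / real n)" for n
      using \<mu> by (simp add: p_def \<mu>_def)
    show ?thesis
      unfolding eq using tendsto_mult[OF tendsto_const kLlim, of "\<mu> / (\<mu> + 1)"] by (simp only: mult_1_right)
  qed
  have ps: "(\<lambda>n. real (p n) / sqrt n) \<longlonglongrightarrow> 1 / \<mu>"
  proof -
    have "real (p n) / sqrt n = \<mu> * Q n" for n by (simp add: p_def Q_def \<mu>_def)
    then show ?thesis using tendsto_mult[OF tendsto_const Q, of \<mu>] \<mu> by (simp add: power2_eq_square)
  qed
  have pn: "(\<lambda>n. real (p n) / real n) \<longlonglongrightarrow> 0"
  proof -
    have "real (p n) / real n = real (p n) / sqrt n * (1 / sqrt n)" for n by simp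
    then show ?thesis using tendsto_mult[OF ps inv] by simp
  qed
  \<comment> \<open>As \<open>k\<close> is at most \<open>n / ((\<mu> + 1) * q)\<close>, the product
    is at most \<open>q * \<alpha>(q)\<close> divided by \<open>(\<mu> + 1) * (Q n)\<^sup>2\<close>,
    with \<open>Q n = q / sqrt n\<close> converging to a positive limit.\<close>
  have ka: "(\<lambda>n. real (k n) * alpha_mixing M X (q n)) \<longlonglongrightarrow> 0"
  proof (rule tendsto_sandwich[OF _ _ tendsto_const])
    show "\<forall>\<^sub>F n in sequentially. 0 \<le> real (k n) * alpha_mixing M X (q n)"
      by (simp add: alpha_mixing_nonneg)
    show "\<forall>\<^sub>F n in sequentially. real (k n) * alpha_mixing M X (q n)
        \<le> (real (q n) * alpha_mixing M X (q n)) / ((\<mu> + 1) * (Q n)\<^sup>2)"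
      using n0 q0
    proof eventually_elim
      case (elim n)
      have "real (k n) \<le> real n / ((\<mu> + 1) * real (q n))"
        using kLr[of n] elim \<mu> by (simp add: le_divide_eq)
      then have "real (k n) * alpha_mixing M X (q n) \<le> real n / ((\<mu> + 1) * real (q n)) * alpha_mixing M X (q n)"
        by (rule mult_right_mono[OF _ alpha_mixing_nonneg])
      also have "\<dots> = (real (q n) * alpha_mixing M X (q n)) / ((\<mu> + 1) * (Q n)\<^sup>2)"
        using elim \<mu> by (simp add: Q_def power_divide power2_eq_square)
      finally show ?case .
    qed
    have "(\<lambda>n. (real (q n) * alpha_mixing M X (q n)) / ((\<mu> + 1) * (Q n)\<^sup>2)) \<longlonglongrightarrow> 0 / ((\<mu> + 1) * (1 / \<mu>\<^sup>2)\<^sup>2)"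
      by (intro tendsto_intros Q filterlim_compose[OF mix qinf']) (use \<mu> in auto)
    then show "(\<lambda>n. (real (q n) * alpha_mixing M X (q n)) / ((\<mu> + 1) * (Q n)\<^sup>2)) \<longlonglongrightarrow> 0" by simp
  qed
  define \<sigma>2 where "\<sigma>2 p = expectation (\<lambda>\<omega>. (\<Sum>i=1..int p. h (X i \<omega>))\<^sup>2)" for p
  have ks: "(\<lambda>n. real (k n) * \<sigma>2 (p n) / real n) \<longlonglongrightarrow> \<mu> / (\<mu> + 1) * v"
  proof -
    have "(\<lambda>n. (real (k n) * real (p n) / real n) * (\<sigma>2 (p n) / real (p n))) \<longlonglongrightarrow> \<mu> / (\<mu> + 1) * v"
      using lim unfolding \<sigma>2_def[symmetric]
      by (intro tendsto_mult[OF kp] filterlim_compose[OF _ pinf])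
    moreover have "\<forall>\<^sub>F n in sequentially. (real (k n) * real (p n) / real n) * (\<sigma>2 (p n) / real (p n)) = real (k n) * \<sigma>2 (p n) / real n"
      using q0 by eventually_elim (use m in \<open>simp add: p_def\<close>)
    ultimately show ?thesis by (rule Lim_transform_eventually)
  qed
  define b where "b n = \<bar>t\<bar> * sqrt (C * (1 - real (k n) * real (p n) / real n)) + 16 * (real (k n) * alpha_mixing M X (q n))
      + (\<bar>t\<bar> ^ 3 * B * C / 6 * (real (k n) * real (p n) / real n * (real (p n) / sqrt n))
         + (t\<^sup>2 * C)\<^sup>2 / 8 * (real (k n) * real (p n) / real n * (real (p n) / real n)))
      + t\<^sup>2 / 2 * \<bar>real (k n) * \<sigma>2 (p n) / real n - v\<bar>" for n
  \<comment> \<open>The mixing and quartic terms vanish. The gaps, the cubic term and the variance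
    lost in the gaps survive, and these shrink as \<open>m\<close> grows.\<close>
  have "b \<longlonglongrightarrow> \<bar>t\<bar> * sqrt (C * (1 - \<mu> / (\<mu> + 1))) + 16 * 0
      + (\<bar>t\<bar> ^ 3 * B * C / 6 * (\<mu> / (\<mu> + 1) * (1 / \<mu>))
         + (t\<^sup>2 * C)\<^sup>2 / 8 * (\<mu> / (\<mu> + 1) * 0))
      + t\<^sup>2 / 2 * \<bar>\<mu> / (\<mu> + 1) * v - v\<bar>"
    unfolding b_def[abs_def] by (intro tendsto_intros kp ps pn ka ks)
  also have "1 - \<mu> / (\<mu> + 1) = 1 / (\<mu> + 1)" using \<mu> by (simp add: field_simps)
  also have "\<mu> / (\<mu> + 1) * (1 / \<mu>) = 1 / (\<mu> + 1)" using \<mu> by simp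
  also have "\<mu> / (\<mu> + 1) * v - v = - (v / (\<mu> + 1))" using \<mu> by (simp add: field_simps)
  finally have blim: "b \<longlonglongrightarrow> \<bar>t\<bar> * sqrt (C / (m + 1)) + \<bar>t\<bar> ^ 3 * B * C / 6 / (m + 1) + t\<^sup>2 / 2 * (v / (m + 1))"
    using v \<mu> by (simp add: \<mu>_def add.commute)
  have "\<forall>\<^sub>F n in sequentially.
      norm (expectation (\<lambda>\<omega>. iexp (t / sqrt n * (\<Sum>i=1..int n. h (X i \<omega>)))) - of_real (exp (- (t\<^sup>2 * v / 2)))) \<le> b n"
    using n0
  proof eventually_elim
    case (elim n)
    have "(real n - real (k n) * real (p n)) / real n = 1 - real (k n) * real (p n) / real n"
      using elim by (simp add: diff_divide_distrib)
    then show ?case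
      using char_bernstein_bound[OF h B mean C v elim kL, of t] unfolding b_def \<sigma>2_def by simp
  qed
  with blim show ?thesis by blast
qed

text \<open>An iterated limit: \<open>m\<close> is fixed first so that the limiting bound is below
  \<open>e\<close>, and only then \<open>n\<close> is taken large.\<close>

lemma clt_char_bounded:
  assumes h[measurable]: "h \<in> borel_measurable borel" and B: "\<And>x. \<bar>h x\<bar> \<le> B"
    and mean: "expectation (\<lambda>\<omega>. h (X 0 \<omega>)) = 0"
    and C: "\<And>I. finite I \<Longrightarrow> expectation (\<lambda>\<omega>. (\<Sum>i\<in>I. h (X i \<omega>))\<^sup>2) \<le> real (card I) * C"
    and v: "v \<ge> 0" and lim: "(\<lambda>n. expectation (\<lambda>\<omega>. (\<Sum>i=1..int n. h (X i \<omega>))\<^sup>2) / real n) \<longlonglongrightarrow> v"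
    and mix: "(\<lambda>n. real n * alpha_mixing M X n) \<longlonglongrightarrow> 0"
  shows "(\<lambda>n. expectation (\<lambda>\<omega>. iexp (t / sqrt n * (\<Sum>i=1..int n. h (X i \<omega>)))))
    \<longlonglongrightarrow> of_real (exp (- (t\<^sup>2 * v / 2)))"
proof (rule tendstoI)
  fix e :: real assume e: "e > 0"
  define E where "E m = \<bar>t\<bar> * sqrt (C / real (m + 1)) + \<bar>t\<bar> ^ 3 * B * C / 6 / real (m + 1) + t\<^sup>2 / 2 * (v / real (m + 1))" for m
  have inv: "(\<lambda>m. c / real (m + 1)) \<longlonglongrightarrow> 0" for c
    using LIMSEQ_Suc[OF lim_const_over_n[of c]] by simp
  have "E \<longlonglongrightarrow> \<bar>t\<bar> * sqrt 0 + 0 + t\<^sup>2 / 2 * 0"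
    unfolding E_def[abs_def] by (intro tendsto_intros inv)
  then have "E \<longlonglongrightarrow> 0" by simp
  then have "\<forall>\<^sub>F m in sequentially. E m < e \<and> m > 0"
    using e by (intro eventually_conj order_tendstoD(2) eventually_gt_at_top)
  then obtain m where m: "E m < e" "m > 0" using eventually_happens'[OF trivial_limit_sequentially] by blast
  obtain b where b: "\<forall>\<^sub>F n in sequentially.
      norm (expectation (\<lambda>\<omega>. iexp (t / sqrt n * (\<Sum>i=1..int n. h (X i \<omega>)))) - of_real (exp (- (t\<^sup>2 * v / 2)))) \<le> b n"
    "b \<longlonglongrightarrow> E m"
    using clt_char_bounded_eventually[OF h B mean C v lim mix m(2), of t] unfolding E_def by auto
  show "\<forall>\<^sub>F n in sequentially. dist (expectation (\<lambda>\<omega>. iexp (t / sqrt n * (\<Sum>i=1..int n. h (X i \<omega>)))))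
      (of_real (exp (- (t\<^sup>2 * v / 2)))) < e"
    using b(1) order_tendstoD(2)[OF b(2) m(1)]
    by eventually_elim (simp only: dist_norm)
qed

end

section \<open>The central limit theorem and convergence of the Fisher information\<close>

lemma tendsto_suminf_dominated:
  fixes a :: "nat \<Rightarrow> nat \<Rightarrow> real"
  assumes "\<And>j. (\<lambda>T. a j T) \<longlonglongrightarrow> b j" "\<And>j T. \<bar>a j T\<bar> \<le> D j" "summable D"
  shows "(\<lambda>T. \<Sum>j. a j T) \<longlonglongrightarrow> suminf b"
  using tannerys_theorem[of a b sequentially D] assms by (simp add: always_eventually)

context stationary_mixing
begin

lemma alpha_mixing_le_1: "alpha_mixing M X t \<le> 1"
  unfolding alpha_mixing_def
proof (rule cSUP_least, goal_cases)
  case 1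
  show ?case by (simp add: borel_measurable_generated_sigma_nonempty)
qed (auto intro: alpha_coeff_le_1)

text \<open>A number in the unit interval is at most its power with exponent
  \<open>\<theta> <= 1\<close>, so the coefficients are summable themselves; being monotone, they
  decay faster than \<open>1 / n\<close>.\<close>

lemma tendsto_mult_alpha_mixing:
  assumes "0 < \<theta>" "\<theta> \<le> 1" "summable (\<lambda>j. alpha_mixing M X (Suc j) powr \<theta>)"
  shows "(\<lambda>n. real n * alpha_mixing M X n) \<longlonglongrightarrow> 0"
proof (rule tendsto_mult_antimono_summable[OF alpha_mixing_nonneg alpha_mixing_antimono])
  have "alpha_mixing M X j \<le> alpha_mixing M X j powr \<theta>" for j
    using powr_mono'[of \<theta> 1 "alpha_mixing M X j"] assms alpha_mixing_nonneg[of j] alpha_mixing_le_1[of j]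
    by (simp add: powr_one)
  then have "summable (\<lambda>j. alpha_mixing M X (Suc j))"
    by (intro summable_comparison_test'[OF assms(3), of 0]) (simp add: alpha_mixing_nonneg)
  then show "summable (alpha_mixing M X)" by (simp only: summable_Suc_iff)
qed

text \<open>Cauchy-Schwarz without mixing. Applied to the remainders of the truncation it makes each
  single autocovariance vanish as the level grows, while mixing provides the summable majorant over
  the lags.\<close>

lemma autocov_zero_bound:
  assumes [measurable]: "h \<in> borel_measurable borel" and sq: "integrable M (\<lambda>\<omega>. (h (X 0 \<omega>))\<^sup>2)"
  shows "\<bar>autocov h j\<bar> \<le> 2 * expectation (\<lambda>\<omega>. (h (X 0 \<omega>))\<^sup>2)"
proof -
  let ?e = "expectation (\<lambda>\<omega>. (h (X 0 \<omega>))\<^sup>2)"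
  have sqi: "integrable M (\<lambda>\<omega>. (h (X i \<omega>))\<^sup>2)" for i
    using integrable_X_iff[of "\<lambda>x. (h x)\<^sup>2" i] sq by simp
  have ei: "expectation (\<lambda>\<omega>. (h (X i \<omega>))\<^sup>2) = ?e" for i
    using expectation_X[of "\<lambda>x. (h x)\<^sup>2" i] by simp
  have int: "integrable M (\<lambda>\<omega>. h (X 0 \<omega>))"
    by (rule integrable_of_sq[OF _ sq]) simp
  have prod: "integrable M (\<lambda>\<omega>. h (X 0 \<omega>) * h (X (int j) \<omega>))"
    by (rule integrable_sq_mult[OF _ _ sqi sqi]) simp_all
  have "\<bar>expectation (\<lambda>\<omega>. h (X 0 \<omega>) * h (X (int j) \<omega>))\<bar> \<le> expectation (\<lambda>\<omega>. \<bar>h (X 0 \<omega>) * h (X (int j) \<omega>)\<bar>)"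
    by (rule integral_abs_bound)
  also have "\<dots> \<le> expectation (\<lambda>\<omega>. (h (X 0 \<omega>))\<^sup>2 / 2 + (h (X (int j) \<omega>))\<^sup>2 / 2)"
  proof (rule integral_mono)
    show "\<bar>h (X 0 \<omega>) * h (X (int j) \<omega>)\<bar> \<le> (h (X 0 \<omega>))\<^sup>2 / 2 + (h (X (int j) \<omega>))\<^sup>2 / 2" for \<omega>
      using sum_squares_bound[of "\<bar>h (X 0 \<omega>)\<bar>" "\<bar>h (X (int j) \<omega>)\<bar>"] by (simp add: abs_mult)
  qed (use prod sqi in auto)
  also have "\<dots> = ?e" using sqi ei[of "int j"] by simp
  finally have 1: "\<bar>expectation (\<lambda>\<omega>. h (X 0 \<omega>) * h (X (int j) \<omega>))\<bar> \<le> ?e" .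
  have "0 \<le> variance (\<lambda>\<omega>. h (X 0 \<omega>))" by (rule variance_positive)
  also have "\<dots> = ?e - (expectation (\<lambda>\<omega>. h (X 0 \<omega>)))\<^sup>2" by (rule variance_eq[OF int sq])
  finally show ?thesis using 1 zero_le_power2[of "expectation (\<lambda>\<omega>. h (X 0 \<omega>))"]
    unfolding autocov_def by linarith
qed

text \<open>The identity, the truncations and the remainders all satisfy
  \<open>|h x| <= |x|\<close>. Hence one moment bound \<open>K\<close>, one summable majorant
  \<open>D\<close> and one constant \<open>C\<close> cover every truncation level.\<close>

lemma central_limit_theorem_mixing:
  assumes \<delta>: "\<delta> > 0"
    and mom: "integrable M (\<lambda>\<omega>. \<bar>X 0 \<omega>\<bar> powr (2 + \<delta>))"
    and sq: "integrable M (\<lambda>\<omega>. (X 0 \<omega>)\<^sup>2)"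
    and mean: "expectation (X 0) = 0"
    and summ: "summable (\<lambda>j. alpha_mixing M X (Suc j) powr (\<delta> / (2 + \<delta>)))"
  shows "\<exists>v\<ge>0. (\<lambda>n. expectation (\<lambda>\<omega>. (\<Sum>i=1..int n. X i \<omega>)\<^sup>2) / real n) \<longlonglongrightarrow> v \<and>
    (\<forall>t. (\<lambda>n. expectation (\<lambda>\<omega>. iexp (t / sqrt n * (\<Sum>i=1..int n. X i \<omega>)))) \<longlonglongrightarrow> of_real (exp (- (t\<^sup>2 * v / 2))))"
proof -
  define \<theta> where "\<theta> = \<delta> / (2 + \<delta>)"
  have \<theta>: "0 < \<theta>" "\<theta> \<le> 1" using \<delta> by (auto simp: \<theta>_def)
  define K where "K = expectation (\<lambda>\<omega>. \<bar>X 0 \<omega>\<bar> powr (2 + \<delta>))"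
  have K0: "K \<ge> 0" unfolding K_def by (rule Bochner_Integration.integral_nonneg) simp
  \<comment> \<open>The geometric term keeps the bound positive when a mixing coefficient is 0, and
    its powers are still summable.\<close>
  define a where "a j = max (alpha_mixing M X j) ((1 / 2) ^ j)" for j
  have a0: "a j > 0" for j by (simp add: a_def less_max_iff_disj)
  define D where "D j = (4 + 6 * K) * a j powr \<theta>" for j
  have D0: "D j \<ge> 0" for j using K0 by (simp add: D_def)
  have "summable (\<lambda>j. alpha_mixing M X j powr \<theta>)"
    using summ unfolding \<theta>_def by (subst summable_Suc_iff[symmetric])
  moreover have "summable (\<lambda>j. ((1 / 2) powr \<theta>) ^ j)"
    by (rule summable_geometric) (use \<theta> powr_less_mono2[of \<theta> "1 / 2" 1] in simp)
  ultimately have "summable (\<lambda>j. alpha_mixing M X j powr \<theta> + ((1 / 2) powr \<theta>) ^ j)"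
    by (rule summable_add)
  then have "summable (\<lambda>j. a j powr \<theta>)"
  proof (rule summable_comparison_test'[of _ 0])
    fix j :: nat
    have "((1 / 2) ^ j) powr \<theta> = ((1 / 2 :: real) powr \<theta>) ^ j"
      by (simp add: powr_realpow[symmetric] powr_powr mult.commute)
    then show "norm (a j powr \<theta>) \<le> alpha_mixing M X j powr \<theta> + ((1 / 2) powr \<theta>) ^ j"
      unfolding a_def max_def by auto
  qed
  then have sD: "summable D" unfolding D_def[abs_def] by (rule summable_mult)
  have acov: "\<bar>autocov h j\<bar> \<le> D j" if [measurable]: "h \<in> borel_measurable borel" and le: "\<And>x. \<bar>h x\<bar> \<le> \<bar>x\<bar>" for h j
    unfolding D_def \<theta>_def
  proof (rule autocov_mixing_bound)
    have p: "\<bar>h x\<bar> powr (2 + \<delta>) \<le> \<bar>x\<bar> powr (2 + \<delta>)" for x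
      by (rule powr_mono2) (use \<delta> le in auto)
    show i: "integrable M (\<lambda>\<omega>. \<bar>h (X 0 \<omega>)\<bar> powr (2 + \<delta>))"
      by (rule Bochner_Integration.integrable_bound[OF mom]) (use p in auto)
    show "expectation (\<lambda>\<omega>. \<bar>h (X 0 \<omega>)\<bar> powr (2 + \<delta>)) \<le> K"
      unfolding K_def by (rule integral_mono[OF i mom]) (rule p)
  qed (use \<delta> a0 in \<open>auto simp: a_def\<close>)
  have scov: "summable (\<lambda>j. \<bar>autocov h j\<bar>)" if "h \<in> borel_measurable borel" "\<And>x. \<bar>h x\<bar> \<le> \<bar>x\<bar>" for h
    by (rule summable_comparison_test'[OF sD, of 0]) (use acov[OF that] in auto)
  have sq': "integrable M (\<lambda>\<omega>. (h (X 0 \<omega>))\<^sup>2)" if [measurable]: "h \<in> borel_measurable borel" and le: "\<And>x. \<bar>h x\<bar> \<le> \<bar>x\<bar>" for h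
    by (rule Bochner_Integration.integrable_bound[OF sq]) (use le in \<open>auto simp: abs_le_square_iff[symmetric]\<close>)
  define C where "C = 2 * suminf D"
  have sm: "integrable M (\<lambda>\<omega>. (\<Sum>i\<in>I. h (X i \<omega>) - m)\<^sup>2)"
     "expectation (\<lambda>\<omega>. (\<Sum>i\<in>I. h (X i \<omega>) - m)\<^sup>2) \<le> real (card I) * (2 * (\<Sum>j. \<bar>autocov h j\<bar>))"
     "expectation (\<lambda>\<omega>. (\<Sum>i\<in>I. h (X i \<omega>) - m)\<^sup>2) \<le> real (card I) * C"
    if h: "h \<in> borel_measurable borel" "\<And>x. \<bar>h x\<bar> \<le> \<bar>x\<bar>" and m: "m = expectation (\<lambda>\<omega>. h (X 0 \<omega>))" and "finite I" for h m I
  proof -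
    show "integrable M (\<lambda>\<omega>. (\<Sum>i\<in>I. h (X i \<omega>) - m)\<^sup>2)"
      by (rule second_moment_sum(1)[OF h(1) sq'[OF h] m \<open>finite I\<close>])
    show 1: "expectation (\<lambda>\<omega>. (\<Sum>i\<in>I. h (X i \<omega>) - m)\<^sup>2) \<le> real (card I) * (2 * (\<Sum>j. \<bar>autocov h j\<bar>))"
      by (rule second_moment_sum_le[OF h(1) sq'[OF h] m \<open>finite I\<close> scov[OF h]])
    have "(\<Sum>j. \<bar>autocov h j\<bar>) \<le> suminf D"
      by (rule suminf_le[OF acov[OF h] scov[OF h] sD])
    then have "real (card I) * (2 * (\<Sum>j. \<bar>autocov h j\<bar>)) \<le> real (card I) * C"
      unfolding C_def by (intro mult_left_mono) auto
    with 1 show "expectation (\<lambda>\<omega>. (\<Sum>i\<in>I. h (X i \<omega>) - m)\<^sup>2) \<le> real (card I) * C" by (rule order_trans)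
  qed
  have mixl: "(\<lambda>n. real n * alpha_mixing M X n) \<longlonglongrightarrow> 0"
    by (rule tendsto_mult_alpha_mixing[OF \<theta>]) (use summ in \<open>simp add: \<theta>_def\<close>)
  define tr where "tr T = trunc (real T)" for T :: nat
  define R where "R T x = x - tr T x" for T :: nat and x :: real
  define m where "m T = expectation (\<lambda>\<omega>. tr T (X 0 \<omega>))" for T
  define W where "W n \<omega> = (\<Sum>i=1..int n. X i \<omega>)" for n :: nat and \<omega>
  define WT where "WT T n \<omega> = (\<Sum>i=1..int n. tr T (X i \<omega>) - m T)" for T and n :: nat and \<omega>
  have [measurable]: "W n \<in> borel_measurable M" "WT T n \<in> borel_measurable M" "tr T \<in> borel_measurable borel"
     "R T \<in> borel_measurable borel" for n T
    unfolding W_def[abs_def] WT_def[abs_def] tr_def R_def[abs_def] by measurable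
  have trle: "\<bar>tr T x\<bar> \<le> \<bar>x\<bar>" "\<bar>R T x\<bar> \<le> \<bar>x\<bar>" "\<bar>tr T x\<bar> \<le> real T" for T x
    by (auto simp: tr_def R_def trunc_def)
  have iX: "integrable M (X 0)" by (rule integrable_of_sq[OF _ sq]) simp
  have itr: "integrable M (\<lambda>\<omega>. tr T (X 0 \<omega>))" for T
    by (rule integrable_of_sq[OF _ sq'[OF _ trle(1)]]) auto
  \<comment> \<open>As \<open>X 0\<close> has mean zero, the remainder has mean
    \<open>- m T\<close>. The truncation error of the whole sum is therefore a centred sum of
    remainders, to which the second moment bound applies.\<close>
  have mR: "- m T = expectation (\<lambda>\<omega>. R T (X 0 \<omega>))" for T
    unfolding R_def m_def using iX itr mean by simp
  define \<rho> where "\<rho> T = 2 * (\<Sum>j. \<bar>autocov (R T) j\<bar>)" for T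
  have \<rho>0: "\<rho> T \<ge> 0" for T
    unfolding \<rho>_def by (intro mult_nonneg_nonneg suminf_nonneg scov) (auto simp: trle)
  have \<rho>lim: "\<rho> \<longlonglongrightarrow> 0"
  proof -
    have RT: "(\<lambda>T. R T x) \<longlonglongrightarrow> 0" for x
    proof (rule tendsto_eventually)
      show "\<forall>\<^sub>F T in sequentially. R T x = 0"
        using eventually_ge_at_top[of "nat \<lceil>\<bar>x\<bar>\<rceil>"]
        by eventually_elim (auto simp: R_def tr_def trunc_def)
    qed
    have "(\<lambda>T. expectation (\<lambda>\<omega>. (R T (X 0 \<omega>))\<^sup>2)) \<longlonglongrightarrow> expectation (\<lambda>\<omega>. 0)"
    proof (rule integral_dominated_convergence[OF _ _ sq])
      show "AE \<omega> in M. (\<lambda>T. (R T (X 0 \<omega>))\<^sup>2) \<longlonglongrightarrow> 0"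
        using tendsto_power[OF RT, of _ 2] by simp
      show "AE \<omega> in M. norm ((R T (X 0 \<omega>))\<^sup>2) \<le> (X 0 \<omega>)\<^sup>2" for T
        using trle(2) by (simp add: abs_le_square_iff[symmetric])
    qed auto
    then have lim2: "(\<lambda>T. 2 * expectation (\<lambda>\<omega>. (R T (X 0 \<omega>))\<^sup>2)) \<longlonglongrightarrow> 0"
      using tendsto_mult_right_zero by fastforce
    \<comment> \<open>Tannery's theorem: convergence lag by lag together with the majorant
      \<open>D\<close>, valid for all \<open>T\<close>, permits exchanging limit and sum.\<close>
    have "(\<lambda>T. \<bar>autocov (R T) j\<bar>) \<longlonglongrightarrow> 0" for j
      by (rule tendsto_sandwich[OF _ _ tendsto_const lim2])
         (auto intro!: always_eventually autocov_zero_bound sq' simp: trle)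
    then have "(\<lambda>T. \<Sum>j. \<bar>autocov (R T) j\<bar>) \<longlonglongrightarrow> suminf (\<lambda>j. 0)"
      by (rule tendsto_suminf_dominated[OF _ _ sD]) (use acov trle in auto)
    then show ?thesis unfolding \<rho>_def[abs_def] using tendsto_mult_right_zero by fastforce
  qed
  have dW: "W n \<omega> - WT T n \<omega> = (\<Sum>i=1..int n. R T (X i \<omega>) - - m T)" for n T \<omega>
    unfolding W_def WT_def R_def sum_subtractf[symmetric] by (rule sum.cong) auto
  have id: "integrable M (\<lambda>\<omega>. (W n \<omega> - WT T n \<omega>)\<^sup>2)" and
    ed: "expectation (\<lambda>\<omega>. (W n \<omega> - WT T n \<omega>)\<^sup>2) \<le> real n * \<rho> T" for n T
    unfolding dW \<rho>_def using sm(1,2)[OF _ _ mR, of T "{1..int n}"] trle by auto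
  have mean': "0 = expectation (\<lambda>\<omega>. X 0 \<omega>)" using mean by simp
  have iW: "integrable M (\<lambda>\<omega>. (W n \<omega>)\<^sup>2)" and eW: "expectation (\<lambda>\<omega>. (W n \<omega>)\<^sup>2) \<le> real n * C" for n
    using sm(1,3)[of "\<lambda>x. x" 0 "{1..int n}", OF _ _ mean'] unfolding W_def by auto
  have iWT: "integrable M (\<lambda>\<omega>. (WT T n \<omega>)\<^sup>2)" for n T
    using sm(1)[OF _ _ m_def, of T "{1..int n}"] trle unfolding WT_def by auto
  obtain v where v: "v \<ge> 0" "(\<lambda>n. expectation (\<lambda>\<omega>. (W n \<omega>)\<^sup>2) / real n) \<longlonglongrightarrow> v"
    using second_moment_sum_tendsto[of "\<lambda>x. x" 0, OF _ _ mean' scov] sq unfolding W_def by auto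
  have "\<forall>T. \<exists>v. v \<ge> 0 \<and> (\<lambda>n. expectation (\<lambda>\<omega>. (WT T n \<omega>)\<^sup>2) / real n) \<longlonglongrightarrow> v"
    unfolding WT_def
    by (rule allI, rule second_moment_sum_tendsto[OF _ sq' m_def scov]) (auto simp: trle)
  from choice[OF this] obtain vT where vT: "\<And>T. vT T \<ge> 0" "\<And>T. (\<lambda>n. expectation (\<lambda>\<omega>. (WT T n \<omega>)\<^sup>2) / real n) \<longlonglongrightarrow> vT T"
    by blast
  have clt: "(\<lambda>n. expectation (\<lambda>\<omega>. iexp (t / sqrt n * WT T n \<omega>))) \<longlonglongrightarrow> of_real (exp (- (t\<^sup>2 * vT T / 2)))" for T t
    unfolding WT_def
  proof (rule clt_char_bounded[where h="\<lambda>x. tr T x - m T" and B="real T + \<bar>m T\<bar>" and C=C, OF _ _ _ _ vT(1) _ mixl])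
    show "\<bar>tr T x - m T\<bar> \<le> real T + \<bar>m T\<bar>" for x using trle(3)[of T x] by linarith
    show "expectation (\<lambda>\<omega>. tr T (X 0 \<omega>) - m T) = 0"
      using itr by (simp add: m_def prob_space)
    show "expectation (\<lambda>\<omega>. (\<Sum>i\<in>I. tr T (X i \<omega>) - m T)\<^sup>2) \<le> real (card I) * C" if "finite I" for I
      by (rule sm(3)[OF _ _ m_def that]) (auto simp: trle)
    show "(\<lambda>n. expectation (\<lambda>\<omega>. (\<Sum>i=1..int n. tr T (X i \<omega>) - m T)\<^sup>2) / real n) \<longlonglongrightarrow> vT T"
      using vT(2)[of T] unfolding WT_def .
  qed simp
  \<comment> \<open>The weight for comparing second moments. At least
    \<open>sqrt (\<rho> T)\<close>, it gives
    \<open>\<rho> T / \<epsilon> T <= sqrt (\<rho> T)\<close>; the extra \<open>1 / Suc T\<close>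
    keeps it positive when \<open>\<rho> T = 0\<close>.\<close>
  define \<epsilon> where "\<epsilon> T = sqrt (\<rho> T) + 1 / real (Suc T)" for T
  have \<epsilon>0: "\<epsilon> T > 0" for T unfolding \<epsilon>_def using \<rho>0 by (simp add: add_nonneg_pos)
  have vdiff: "\<bar>v - vT T\<bar> \<le> \<epsilon> T * C + \<rho> T + sqrt (\<rho> T)" for T
  proof -
    have bound: "\<bar>expectation (\<lambda>\<omega>. (W n \<omega>)\<^sup>2) / real n - expectation (\<lambda>\<omega>. (WT T n \<omega>)\<^sup>2) / real n\<bar>
        \<le> \<epsilon> T * C + \<rho> T + sqrt (\<rho> T)" if n: "n > 0" for n
    proof -
      \<comment> \<open>From
        \<open>x\<^sup>2 - y\<^sup>2 = 2 * x * (x - y) - (x - y)\<^sup>2\<close>, with the cross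
        term split by the weighted arithmetic-geometric inequality.\<close>
      have pt: "\<bar>x\<^sup>2 - y\<^sup>2\<bar> \<le> \<epsilon> T * x\<^sup>2 + (1 + 1 / \<epsilon> T) * (x - y)\<^sup>2" for x y :: real
      proof -
        have "0 \<le> (\<epsilon> T * \<bar>x\<bar> - \<bar>x - y\<bar>)\<^sup>2 / \<epsilon> T" using \<epsilon>0[of T] by simp
        also have "\<dots> = \<epsilon> T * x\<^sup>2 - 2 * \<bar>x * (x - y)\<bar> + (1 / \<epsilon> T) * (x - y)\<^sup>2"
          using \<epsilon>0[of T] by (simp add: power2_diff power_mult_distrib abs_mult diff_divide_distrib add_divide_distrib power2_eq_square[of "\<epsilon> T"])
        finally have "2 * \<bar>x * (x - y)\<bar> \<le> \<epsilon> T * x\<^sup>2 + (1 / \<epsilon> T) * (x - y)\<^sup>2" by simp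
        moreover have "x\<^sup>2 - y\<^sup>2 = 2 * (x * (x - y)) - (x - y)\<^sup>2" by (simp add: power2_eq_square algebra_simps)
        ultimately show ?thesis using zero_le_power2[of "x - y"] unfolding distrib_right mult_1_left by linarith
      qed
      have "\<bar>expectation (\<lambda>\<omega>. (W n \<omega>)\<^sup>2) - expectation (\<lambda>\<omega>. (WT T n \<omega>)\<^sup>2)\<bar> = \<bar>expectation (\<lambda>\<omega>. (W n \<omega>)\<^sup>2 - (WT T n \<omega>)\<^sup>2)\<bar>"
        using iW iWT by simp
      also have "\<dots> \<le> expectation (\<lambda>\<omega>. \<bar>(W n \<omega>)\<^sup>2 - (WT T n \<omega>)\<^sup>2\<bar>)" by (rule integral_abs_bound)
      also have "\<dots> \<le> expectation (\<lambda>\<omega>. \<epsilon> T * (W n \<omega>)\<^sup>2 + (1 + 1 / \<epsilon> T) * (W n \<omega> - WT T n \<omega>)\<^sup>2)"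
        by (rule integral_mono)
           (intro integrable_abs Bochner_Integration.integrable_diff Bochner_Integration.integrable_add
              integrable_mult_right iW iWT id pt)+
      also have "\<dots> = \<epsilon> T * expectation (\<lambda>\<omega>. (W n \<omega>)\<^sup>2) + (1 + 1 / \<epsilon> T) * expectation (\<lambda>\<omega>. (W n \<omega> - WT T n \<omega>)\<^sup>2)"
        using iW id by simp
      also have "\<dots> \<le> \<epsilon> T * (real n * C) + (1 + 1 / \<epsilon> T) * (real n * \<rho> T)"
        using \<epsilon>0[of T] by (intro add_mono mult_left_mono eW ed) auto
      also have "\<dots> = real n * (\<epsilon> T * C + \<rho> T + \<rho> T / \<epsilon> T)" by (simp add: algebra_simps)
      also have "\<dots> \<le> real n * (\<epsilon> T * C + \<rho> T + sqrt (\<rho> T))"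
      proof (intro mult_left_mono add_left_mono)
        have "\<rho> T = sqrt (\<rho> T) * sqrt (\<rho> T)" using \<rho>0[of T] by simp
        also have "\<dots> \<le> sqrt (\<rho> T) * \<epsilon> T" unfolding \<epsilon>_def using \<rho>0[of T] by (intro mult_left_mono) auto
        finally show "\<rho> T / \<epsilon> T \<le> sqrt (\<rho> T)" using \<epsilon>0[of T] by (simp add: divide_le_eq)
      qed simp
      finally show ?thesis
        using n by (simp add: diff_divide_distrib[symmetric] divide_le_eq mult.commute)
    qed
    have "(\<lambda>n. \<bar>expectation (\<lambda>\<omega>. (W n \<omega>)\<^sup>2) / real n - expectation (\<lambda>\<omega>. (WT T n \<omega>)\<^sup>2) / real n\<bar>) \<longlonglongrightarrow> \<bar>v - vT T\<bar>"
      by (intro tendsto_intros v vT)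
    then show ?thesis by (rule LIMSEQ_le_const2) (use bound in \<open>auto intro!: exI[of _ 1]\<close>)
  qed
  have \<epsilon>lim: "\<epsilon> \<longlonglongrightarrow> 0"
    unfolding \<epsilon>_def[abs_def]
    using tendsto_add[OF tendsto_real_sqrt[OF \<rho>lim] LIMSEQ_inverse_real_of_nat] by (simp add: inverse_eq_divide)
  have vlim: "(\<lambda>T. \<bar>v - vT T\<bar>) \<longlonglongrightarrow> 0"
  proof (rule tendsto_sandwich[OF _ _ tendsto_const])
    have "(\<lambda>T. \<epsilon> T * C + \<rho> T + sqrt (\<rho> T)) \<longlonglongrightarrow> 0 * C + 0 + sqrt 0"
      by (intro tendsto_intros \<epsilon>lim \<rho>lim)
    then show "(\<lambda>T. \<epsilon> T * C + \<rho> T + sqrt (\<rho> T)) \<longlonglongrightarrow> 0" by simp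
  qed (use vdiff in auto)
  have "(\<lambda>n. expectation (\<lambda>\<omega>. iexp (t / sqrt n * W n \<omega>))) \<longlonglongrightarrow> of_real (exp (- (t\<^sup>2 * v / 2)))" for t
  proof (rule tendstoI)
    fix e :: real assume e: "e > 0"
    \<comment> \<open>Three errors of size \<open>e / 3\<close>: truncation, uniformly in
      \<open>n\<close>; the change of the limiting variance; and the bounded central limit theorem
      at the level \<open>T\<close> fixed here.\<close>
    have lims: "(\<lambda>T. \<bar>t\<bar> * sqrt (\<rho> T)) \<longlonglongrightarrow> \<bar>t\<bar> * sqrt 0" "(\<lambda>T. t\<^sup>2 / 2 * \<bar>v - vT T\<bar>) \<longlonglongrightarrow> t\<^sup>2 / 2 * 0"
      by (intro tendsto_intros \<rho>lim vlim)+
    have "\<forall>\<^sub>F T in sequentially. \<bar>t\<bar> * sqrt (\<rho> T) < e / 3 \<and> t\<^sup>2 / 2 * \<bar>v - vT T\<bar> < e / 3"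
      by (intro eventually_conj order_tendstoD(2)[OF lims(1)] order_tendstoD(2)[OF lims(2)])
         (use e in auto)
    then obtain T where T: "\<bar>t\<bar> * sqrt (\<rho> T) < e / 3" "t\<^sup>2 / 2 * \<bar>v - vT T\<bar> < e / 3"
      using eventually_happens'[OF trivial_limit_sequentially] by blast
    have c: "dist (complex_of_real (exp (- (t\<^sup>2 * vT T / 2)))) (of_real (exp (- (t\<^sup>2 * v / 2)))) < e / 3"
    proof -
      have "\<bar>exp (- (t\<^sup>2 * vT T / 2)) - exp (- (t\<^sup>2 * v / 2))\<bar> \<le> \<bar>t\<^sup>2 * vT T / 2 - t\<^sup>2 * v / 2\<bar>"
        by (rule exp_minus_lipschitz) (use v vT in auto)
      also have "t\<^sup>2 * vT T / 2 - t\<^sup>2 * v / 2 = - (t\<^sup>2 / 2 * (v - vT T))" by (simp add: field_simps)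
      also have "\<bar>- (t\<^sup>2 / 2 * (v - vT T))\<bar> = t\<^sup>2 / 2 * \<bar>v - vT T\<bar>" by (simp add: abs_mult)
      finally have "\<bar>exp (- (t\<^sup>2 * vT T / 2)) - exp (- (t\<^sup>2 * v / 2))\<bar> < e / 3" using T(2) by simp
      then show ?thesis by (simp only: dist_norm of_real_diff[symmetric] norm_of_real)
    qed
    have "\<forall>\<^sub>F n in sequentially. dist (expectation (\<lambda>\<omega>. iexp (t / sqrt n * WT T n \<omega>))) (of_real (exp (- (t\<^sup>2 * vT T / 2)))) < e / 3"
      by (rule tendstoD[OF clt]) (use e in simp)
    then show "\<forall>\<^sub>F n in sequentially. dist (expectation (\<lambda>\<omega>. iexp (t / sqrt n * W n \<omega>))) (of_real (exp (- (t\<^sup>2 * v / 2)))) < e"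
      using eventually_gt_at_top[of "0::nat"]
    proof eventually_elim
      case (elim n)
      \<comment> \<open>The mean square error grows like \<open>n * \<rho> T\<close>, and the
        normalisation by \<open>sqrt n\<close> cancels \<open>n\<close>; this is the uniformity that
        allows \<open>T\<close> to be chosen before \<open>n\<close>.\<close>
      have "dist (expectation (\<lambda>\<omega>. iexp (t / sqrt n * W n \<omega>))) (expectation (\<lambda>\<omega>. iexp (t / sqrt n * WT T n \<omega>)))
        \<le> \<bar>t / sqrt n\<bar> * sqrt (expectation (\<lambda>\<omega>. (W n \<omega> - WT T n \<omega>)\<^sup>2))"
        unfolding dist_norm by (rule char_diff_le[OF _ _ id]) auto
      also have "\<dots> \<le> \<bar>t / sqrt n\<bar> * sqrt (real n * \<rho> T)"
        by (intro mult_left_mono real_sqrt_le_mono ed) auto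
      also have "\<dots> = \<bar>t\<bar> * sqrt (\<rho> T)" using elim by (simp add: real_sqrt_mult)
      also have "\<dots> < e / 3" by (rule T(1))
      finally show ?case
        using elim(1) c dist_triangle_third by blast
    qed
  qed
  with v show ?thesis unfolding W_def by blast
qed

end

theorem theorem1p4:
  fixes M :: "'a measure"
    and X Z :: "int \<Rightarrow> 'a \<Rightarrow> real"
    and \<delta> \<tau> :: real
  assumes "prob_space M"
    and "stationary_process M X"
    and "\<And>i. integrable M (X i)"
    and "\<And>i. prob_space.expectation M (X i) = 0"
    and "\<And>i. integrable M (\<lambda>\<omega>. (X i \<omega>)\<^sup>2)"
    and "\<delta> > 0"
    and "integrable M (\<lambda>\<omega>. \<bar>X 0 \<omega>\<bar> powr (2 + \<delta>))"
    and "summable (\<lambda>j. alpha_mixing M X (Suc j) powr (\<delta> / (2 + \<delta>)))"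
    and "\<tau> > 0"
    and "\<And>i. distributed M lborel (Z i) (\<lambda>z. ennreal (normal_density 0 (sqrt \<tau>) z))"
    and "prob_space.indep_vars M (\<lambda>_. borel) Z UNIV"
    and "prob_space.indep_var M
           (Pi\<^sub>M UNIV (\<lambda>_. borel)) (\<lambda>\<omega> i. X i \<omega>)
           (Pi\<^sub>M UNIV (\<lambda>_. borel)) (\<lambda>\<omega> i. Z i \<omega>)"
  shows "(\<lambda>n. std_fisher_information M (smoothed_sum X Z n)) \<longlonglongrightarrow> 0"
proof -
  interpret stationary_mixing M X
    using assms(1,2) by (simp add: stationary_mixing_def stationary_mixing_axioms_def)
  \<comment> \<open>Indices are shifted by one because the normalisation degenerates at
    \<open>n = 0\<close>; the limit is transferred back at the end.\<close>
  define N where "N n = real (Suc n)" for n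
  have N: "N n > 0" for n by (simp add: N_def)
  define S where "S n \<omega> = (\<Sum>i=1..int (Suc n). X i \<omega>) / sqrt (N n)" for n \<omega>
  define G where "G n \<omega> = (\<Sum>i=1..int (Suc n). Z i \<omega>) / sqrt (N n)" for n \<omega>
  obtain v where v: "v \<ge> 0" "(\<lambda>n. expectation (\<lambda>\<omega>. (\<Sum>i=1..int n. X i \<omega>)\<^sup>2) / real n) \<longlonglongrightarrow> v"
    "\<And>t. (\<lambda>n. expectation (\<lambda>\<omega>. iexp (t / sqrt n * (\<Sum>i=1..int n. X i \<omega>)))) \<longlonglongrightarrow> of_real (exp (- (t\<^sup>2 * v / 2)))"
    using central_limit_theorem_mixing[OF assms(6,7,5,4,8)] by blast
  have sm: "smoothed_sum X Z (Suc n) = (\<lambda>\<omega>. S n \<omega> + G n \<omega>)" for n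
    by (rule ext) (simp add: smoothed_sum_def S_def G_def N_def sum.distrib add_divide_distrib)
  have [measurable]: "S n \<in> borel_measurable M" for n unfolding S_def[abs_def] by measurable
  have indep: "indep_var borel (S n) borel (G n)" for n
  proof -
    have "indep_var borel ((\<lambda>x. (\<Sum>i=1..int (Suc n). x i) / sqrt (N n)) \<circ> (\<lambda>\<omega> i. X i \<omega>))
      borel ((\<lambda>x. (\<Sum>i=1..int (Suc n). x i) / sqrt (N n)) \<circ> (\<lambda>\<omega> i. Z i \<omega>))"
      by (rule indep_var_compose[OF assms(12)]) measurable
    then show ?thesis by (simp add: S_def[abs_def] G_def[abs_def] comp_def)
  qed
  have [measurable]: "G n \<in> borel_measurable M" for n using indep by (rule indep_var_rv2)
  have Gd: "distributed M lborel (G n) (\<lambda>x. ennreal (normal_density 0 (sqrt \<tau>) x))" for n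
  proof -
    have "distributed M lborel (\<lambda>\<omega>. \<Sum>i\<in>{1..int (Suc n)}. Z i \<omega>)
        (normal_density (\<Sum>i\<in>{1..int (Suc n)}. 0) (sqrt (\<Sum>i\<in>{1..int (Suc n)}. (sqrt \<tau>)\<^sup>2)))"
      by (rule sum_indep_normal) (use assms(9,10) in \<open>auto intro: indep_vars_subset[OF assms(11)]\<close>)
    then have D: "distributed M lborel (\<lambda>\<omega>. \<Sum>i\<in>{1..int (Suc n)}. Z i \<omega>) (normal_density 0 (sqrt (N n * \<tau>)))"
      using assms(9) by (simp add: N_def add.commute)
    have "distributed M lborel (\<lambda>\<omega>. 0 + 1 / sqrt (N n) * (\<Sum>i\<in>{1..int (Suc n)}. Z i \<omega>))
        (normal_density (0 + 1 / sqrt (N n) * 0) (\<bar>1 / sqrt (N n)\<bar> * sqrt (N n * \<tau>)))"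
      by (rule normal_density_affine[OF D]) (use N[of n] assms(9) in auto)
    moreover have "\<bar>1 / sqrt (N n)\<bar> * sqrt (N n * \<tau>) = sqrt \<tau>"
      using N[of n] by (simp add: real_sqrt_mult)
    ultimately show ?thesis by (simp add: G_def[abs_def])
  qed
  have \<tau>: "sqrt \<tau> > 0" using assms(9) by simp
  \<comment> \<open>Levy continuity. Representing the limit as a scaled standard normal law keeps
    the case \<open>v = 0\<close> within the same argument.\<close>
  have weak: "weak_conv_m (\<lambda>n. distr M borel (S n)) (distr std_normal_distribution borel (\<lambda>x. sqrt v * x))"
  proof (rule levy_continuity)
    interpret Nm: prob_space std_normal_distribution by (rule prob_space_normal_density) simp
    show "real_distribution (distr M borel (S n))" for n by (rule real_distribution_distr) simp
    show "real_distribution (distr std_normal_distribution borel (\<lambda>x. sqrt v * x))"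
      by (rule Nm.real_distribution_distr) simp
    fix t
    have "char (distr std_normal_distribution borel (\<lambda>x. sqrt v * x)) t = char std_normal_distribution (t * sqrt v)"
      unfolding char_def by (subst integral_distr) (auto simp: mult.assoc)
    also have "\<dots> = of_real (exp (- (t\<^sup>2 * v / 2)))"
      using v(1) by (simp add: char_std_normal_distribution power_mult_distrib)
    finally have c: "char (distr std_normal_distribution borel (\<lambda>x. sqrt v * x)) t = of_real (exp (- (t\<^sup>2 * v / 2)))" .
    have "char (distr M borel (S n)) t = expectation (\<lambda>\<omega>. iexp (t / sqrt (Suc n) * (\<Sum>i=1..int (Suc n). X i \<omega>)))" for n
      unfolding char_def by (subst integral_distr) (auto simp: S_def N_def)
    then show "(\<lambda>n. char (distr M borel (S n)) t) \<longlonglongrightarrow> char (distr std_normal_distribution borel (\<lambda>x. sqrt v * x)) t"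
      unfolding c using LIMSEQ_Suc[OF v(3)[of t]] by (simp only:)
  qed
  obtain J where J: "\<And>n. fisher_information M (\<lambda>\<omega>. S n \<omega> + G n \<omega>) = ennreal (J n)" "\<And>n. 0 \<le> J n"
    "J \<longlonglongrightarrow> 1 / ((sqrt v)\<^sup>2 + (sqrt \<tau>)\<^sup>2)"
    using tendsto_fisher_information_indep_normal_sum[OF assms(1) \<tau> _ Gd indep weak] v(1) by auto
  have iX2: "integrable M (\<lambda>\<omega>. (\<Sum>i=1..int n. X i \<omega>)\<^sup>2)" for n
    using second_moment_sum(1)[of "\<lambda>x. x" 0 "{1..int n}"] assms(4,5) by simp
  have iS: "integrable M (S n)" for n unfolding S_def[abs_def] using assms(3) by simp
  have eS: "expectation (S n) = 0" for n unfolding S_def[abs_def] using assms(3,4) by simp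
  have iS2: "integrable M (\<lambda>\<omega>. (S n \<omega>)\<^sup>2)" for n
    unfolding S_def power_divide by (rule integrable_divide_zero) (simp only: iX2)
  have eS2: "expectation (\<lambda>\<omega>. (S n \<omega>)\<^sup>2) = expectation (\<lambda>\<omega>. (\<Sum>i=1..int (Suc n). X i \<omega>)\<^sup>2) / real (Suc n)" for n
    unfolding S_def power_divide by (simp add: N_def)
  have eG: "expectation (G n) = 0" for n by (rule normal_distributed_expectation[OF \<tau> Gd])
  have eG2: "expectation (\<lambda>\<omega>. (G n \<omega>)\<^sup>2) = \<tau>" for n
    using normal_distributed_variance[OF \<tau> Gd[of n]] assms(9) by (simp add: eG)
  \<comment> \<open>The Bochner integral of a nonintegrable function is 0, so the value
    \<open>\<tau> > 0\<close> certifies integrability.\<close>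
  have iG2: "integrable M (\<lambda>\<omega>. (G n \<omega>)\<^sup>2)" for n
    using eG2[of n] assms(9) not_integrable_integral_eq by fastforce
  have iG: "integrable M (G n)" for n by (rule integrable_of_sq[OF _ iG2]) simp
  have var: "variance (\<lambda>\<omega>. S n \<omega> + G n \<omega>) = expectation (\<lambda>\<omega>. (S n \<omega>)\<^sup>2) + \<tau>" for n
  proof -
    have "expectation (\<lambda>\<omega>. S n \<omega> * G n \<omega>) = expectation (S n) * expectation (G n)"
      and i: "integrable M (\<lambda>\<omega>. S n \<omega> * G n \<omega>)"
      using indep_var_lebesgue_integral[OF indep iS iG] indep_var_integrable[OF indep iS iG] by auto
    then have SG: "expectation (\<lambda>\<omega>. S n \<omega> * G n \<omega>) = 0" by (simp add: eS)
    have "expectation (\<lambda>\<omega>. S n \<omega> + G n \<omega>) = 0" using iS iG eS eG by simp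
    then have "variance (\<lambda>\<omega>. S n \<omega> + G n \<omega>) = expectation (\<lambda>\<omega>. (S n \<omega>)\<^sup>2 + (G n \<omega>)\<^sup>2 + 2 * (S n \<omega> * G n \<omega>))"
      by (simp add: power2_sum mult.assoc)
    also have "\<dots> = expectation (\<lambda>\<omega>. (S n \<omega>)\<^sup>2) + \<tau>"
      using iS2 iG2 i SG eG2 by simp
    finally show ?thesis .
  qed
  have std: "std_fisher_information M (smoothed_sum X Z (Suc n)) = ereal ((expectation (\<lambda>\<omega>. (S n \<omega>)\<^sup>2) + \<tau>) * J n - 1)" for n
    unfolding std_fisher_information_def sm J(1) var using J(2)[of n]
    by (simp add: enn2ereal_ennreal one_ereal_def)
  \<comment> \<open>Variance and Fisher information have reciprocal limits, since a normal law
    attains equality in the Cramer-Rao bound.\<close>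
  have "(\<lambda>n. (expectation (\<lambda>\<omega>. (S n \<omega>)\<^sup>2) + \<tau>) * J n - 1) \<longlonglongrightarrow> (v + \<tau>) * (1 / ((sqrt v)\<^sup>2 + (sqrt \<tau>)\<^sup>2)) - 1"
    unfolding eS2 by (intro tendsto_intros LIMSEQ_Suc[OF v(2)] J(3))
  also have "(v + \<tau>) * (1 / ((sqrt v)\<^sup>2 + (sqrt \<tau>)\<^sup>2)) - 1 = 0"
    using v(1) assms(9) by simp
  finally have "(\<lambda>n. std_fisher_information M (smoothed_sum X Z (Suc n))) \<longlonglongrightarrow> 0"
    unfolding std zero_ereal_def by simp
  then show ?thesis by (rule LIMSEQ_imp_Suc)
qed

end
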